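(* Let $W$ be a Coxeter group which is either right-angled or a symmetric group, and let $u \leq v$ be elements of $W$. Then a perfect matching of the Hasse diagram of the Bruhat interval $[u,v]$ is a special matching if and only if it is a graph automorphism of $\Gamma(u,v)$.
   Context: For a Coxeter system $(W,S)$, the reflections $T$ are the conjugates of elements of $S$; $\ell$ is the length function and $\le$ the Bruhat order (transitive closure of $x<xt$ for $t\in T$ with $\ell(xt)>\ell(x)$), with $[u,v]=\{x: u\le x\le v\}$. $\Gamma(u,v)$ is the simple undirected graph with vertex set $[u,v]$ and edges $\{x,y\}$ whenever $y=xt$ for some $t\in T$. $W$ is right-angled if every pair of distinct simple generators either commutes or generates an infinite dihedral group. The Hasse diagram $H(P)$ of a poset $P$ is the graph on $P$ with edges $\{x,y\}$ for cover relations $x\lessdot y$. A perfect matching of a graph $G$ is a fixed-point-free involution $M$ on the vertices with $\{x,M(x)\}$ an edge for all $x$. A perfect matching $M$ of $H(P)$ is a special matching if for every cover relation $x\lessdot y$ in $P$, either $M(x)=y$ or $M(x)<M(y)$. *)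

theory Defs
  imports "HOL-Algebra.Sym_Groups"
begin

definition wprod :: "('a, 'b) monoid_scheme \<Rightarrow> 'a list \<Rightarrow> 'a" where
  "wprod W w = foldr (\<lambda>s g. s \<otimes>\<^bsub>W\<^esub> g) w \<one>\<^bsub>W\<^esub>"

text \<open>Coxeter matrix: values in nat, where 0 encodes infinity.\<close>
definition coxeter_matrix :: "'a set \<Rightarrow> ('a \<Rightarrow> 'a \<Rightarrow> nat) \<Rightarrow> bool" where
  "coxeter_matrix S m \<longleftrightarrow>
     (\<forall>s\<in>S. m s s = 1) \<and>
     (\<forall>s\<in>S. \<forall>t\<in>S. m s t = m t s) \<and>
     (\<forall>s\<in>S. \<forall>t\<in>S. s \<noteq> t \<longrightarrow> m s t = 0 \<or> m s t \<ge> 2)"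

definition coxeter_relators :: "'a set \<Rightarrow> ('a \<Rightarrow> 'a \<Rightarrow> nat) \<Rightarrow> 'a list set" where
  "coxeter_relators S m = {concat (replicate (m s t) [s, t]) | s t. s \<in> S \<and> t \<in> S \<and> m s t > 0}"

definition relator_step :: "'a list set \<Rightarrow> 'a list \<Rightarrow> 'a list \<Rightarrow> bool" where
  "relator_step R a b \<longleftrightarrow> (\<exists>x y r. r \<in> R \<and> a = x @ r @ y \<and> b = x @ y)"

text \<open>(W,S) is a Coxeter system: W is a group generated by S and the canonical map from
the free monoid on S to W identifies exactly the words equivalent modulo the Coxeter
relations, i.e. W has the presentation <S | (st)^m(s,t) = 1>.  (Since the relators
include s s, the monoid presented by these relations is a group, equal to the group
with this presentation.)\<close>
definition coxeter_system :: "('a, 'b) monoid_scheme \<Rightarrow> 'a set \<Rightarrow> bool" where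
  "coxeter_system W S \<longleftrightarrow> group W \<and> S \<subseteq> carrier W \<and>
     carrier W = wprod W ` lists S \<and>
     (\<exists>m. coxeter_matrix S m \<and>
        (\<forall>a\<in>lists S. \<forall>b\<in>lists S.
           wprod W a = wprod W b \<longleftrightarrow> equivclp (relator_step (coxeter_relators S m)) a b))"

definition reflections :: "('a, 'b) monoid_scheme \<Rightarrow> 'a set \<Rightarrow> 'a set" where
  "reflections W S = {g \<otimes>\<^bsub>W\<^esub> s \<otimes>\<^bsub>W\<^esub> inv\<^bsub>W\<^esub> g | g s. g \<in> carrier W \<and> s \<in> S}"

definition coxeter_length :: "('a, 'b) monoid_scheme \<Rightarrow> 'a set \<Rightarrow> 'a \<Rightarrow> nat" where
  "coxeter_length W S x = (LEAST n. \<exists>w\<in>lists S. length w = n \<and> wprod W w = x)"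

definition bruhat_step :: "('a, 'b) monoid_scheme \<Rightarrow> 'a set \<Rightarrow> 'a \<Rightarrow> 'a \<Rightarrow> bool" where
  "bruhat_step W S x y \<longleftrightarrow> x \<in> carrier W \<and>
     (\<exists>t\<in>reflections W S. y = x \<otimes>\<^bsub>W\<^esub> t \<and>
        coxeter_length W S y > coxeter_length W S x)"

definition bruhat_le :: "('a, 'b) monoid_scheme \<Rightarrow> 'a set \<Rightarrow> 'a \<Rightarrow> 'a \<Rightarrow> bool" where
  "bruhat_le W S x y \<longleftrightarrow> x \<in> carrier W \<and> y \<in> carrier W \<and> (bruhat_step W S)\<^sup>*\<^sup>* x y"

definition bruhat_less :: "('a, 'b) monoid_scheme \<Rightarrow> 'a set \<Rightarrow> 'a \<Rightarrow> 'a \<Rightarrow> bool" where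
  "bruhat_less W S x y \<longleftrightarrow> bruhat_le W S x y \<and> x \<noteq> y"

definition bruhat_interval :: "('a, 'b) monoid_scheme \<Rightarrow> 'a set \<Rightarrow> 'a \<Rightarrow> 'a \<Rightarrow> 'a set" where
  "bruhat_interval W S u v = {x \<in> carrier W. bruhat_le W S u x \<and> bruhat_le W S x v}"

definition right_angled :: "('a, 'b) monoid_scheme \<Rightarrow> 'a set \<Rightarrow> bool" where
  "right_angled W S \<longleftrightarrow> (\<forall>s\<in>S. \<forall>t\<in>S. s \<noteq> t \<longrightarrow>
     s \<otimes>\<^bsub>W\<^esub> t = t \<otimes>\<^bsub>W\<^esub> s \<or> infinite (generate W {s, t}))"

definition symmetric_type :: "('a, 'b) monoid_scheme \<Rightarrow> 'a set \<Rightarrow> bool" where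
  "symmetric_type W S \<longleftrightarrow> (\<exists>n \<phi>. n \<ge> 1 \<and> \<phi> \<in> iso W (sym_group n) \<and>
     \<phi> ` S = {transpose i (Suc i) | i. 1 \<le> i \<and> i < n})"

definition bruhat_cover_in :: "('a, 'b) monoid_scheme \<Rightarrow> 'a set \<Rightarrow> 'a set \<Rightarrow> 'a \<Rightarrow> 'a \<Rightarrow> bool" where
  "bruhat_cover_in W S P x y \<longleftrightarrow> x \<in> P \<and> y \<in> P \<and> bruhat_less W S x y \<and>
     \<not> (\<exists>z\<in>P. bruhat_less W S x z \<and> bruhat_less W S z y)"

definition hasse_perfect_matching :: "('a, 'b) monoid_scheme \<Rightarrow> 'a set \<Rightarrow> 'a set \<Rightarrow> ('a \<Rightarrow> 'a) \<Rightarrow> bool" where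
  "hasse_perfect_matching W S P M \<longleftrightarrow> (\<forall>x\<in>P. M x \<in> P \<and> M x \<noteq> x \<and> M (M x) = x \<and>
     (bruhat_cover_in W S P x (M x) \<or> bruhat_cover_in W S P (M x) x))"

definition special_matching :: "('a, 'b) monoid_scheme \<Rightarrow> 'a set \<Rightarrow> 'a set \<Rightarrow> ('a \<Rightarrow> 'a) \<Rightarrow> bool" where
  "special_matching W S P M \<longleftrightarrow> hasse_perfect_matching W S P M \<and>
     (\<forall>x\<in>P. \<forall>y\<in>P. bruhat_cover_in W S P x y \<longrightarrow> M x = y \<or> bruhat_less W S (M x) (M y))"

definition gamma_edge :: "('a, 'b) monoid_scheme \<Rightarrow> 'a set \<Rightarrow> 'a \<Rightarrow> 'a \<Rightarrow> bool" where
  "gamma_edge W S x y \<longleftrightarrow> x \<noteq> y \<and> (\<exists>t\<in>reflections W S. y = x \<otimes>\<^bsub>W\<^esub> t)"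

definition graph_automorphism :: "'a set \<Rightarrow> ('a \<Rightarrow> 'a \<Rightarrow> bool) \<Rightarrow> ('a \<Rightarrow> 'a) \<Rightarrow> bool" where
  "graph_automorphism V E f \<longleftrightarrow> bij_betw f V V \<and>
     (\<forall>x\<in>V. \<forall>y\<in>V. E x y \<longleftrightarrow> E (f x) (f y))"

end

theory Submission
  imports Defs Complex_Main
begin

text \<open>
  An edge of the Bruhat graph that is not a cover factors through two crossing squares, and four elements forming
  \<open>K\<^sub>3\<^sub>,\<^sub>3\<close> minus an edge in the graph force the missing edge. Hence a special matching preserves all edges
  as soon as it preserves covers, which follows from intervals of length two having exactly two midpoints.

  Conversely, suppose that an edge-preserving matching \<open>M\<close> is not special. Then there is a bad cover \<open>x < y\<close>, with \<open>M x\<close> above \<open>x\<close>,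
  \<open>M y\<close> below \<open>y\<close> and \<open>M x \<noteq> y\<close>, so that \<open>x\<close>, \<open>M y\<close> are both covered by \<open>y\<close>, \<open>M x\<close>. In a symmetric group this butterfly
  lies in a coset of \<open>S\<^sub>3\<close> whose bottom belongs to the interval, and \<open>M\<close> has no possible value there.
  In a right-angled group it occupies two consecutive ranks of a translate \<open>a \<langle>p, q\<rangle> b\<close> of an infinite dihedral parabolic subgroup.
  If \<open>x\<close> has least length, no element of the next lower rank lies in the interval; this forces a generator that is both a right
  descent of \<open>a\<close> and a left descent of \<open>b\<close>, and deleting it produces a shorter bad cover or an impossible reflection.

  The group is embedded by left multiplication into the permutations of its carrier, so that multiplication becomes a type class operation.
\<close>

section \<open>Coxeter groups and the exchange property\<close>

text \<open>Length, exchange and Bruhat order are all drawn from one invariant of words, the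
  inversion cocycle \<open>nn\<close>, whose well-definedness is the only consequence of the
  presentation used for them. The missing edge of K_{3,3} exists because the reflections joining the
  vertices are confined to rank two. In a symmetric group that is S_3, where three odd permutations
  multiply to a transposition. In a right-angled group it is a plane of the geometric
  representation: three reflections of a plane multiply to an involution, and an involution of odd
  length cannot be a product of three or more commuting generators, whose roots are independent, so
  it is a reflection. The obstacle in the right-angled converse is membership in the interval. A
  smaller \<open>w\<close> in \<open>a * w * b\<close> need not give a reduced product, so being
  above \<open>u\<close> cannot be read off from the factors. Dividing \<open>u\<close> by
  \<open>a\<close> (\<open>lquot\<close>) turns the question into one about \<open>w * b\<close>,
  and the failure is then concentrated in a single cancelling generator \<open>c\<close>. The case
  analysis follows what becomes of \<open>a\<close> when \<open>c\<close> is deleted from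
  it.\<close>

class grp = monoid_mult +
  fixes ginv :: "'a \<Rightarrow> 'a"
  assumes ginv_left [simp]: "ginv a * a = 1"
begin

lemma ginv_right [simp]: "a * ginv a = 1"
proof -
  have "a * ginv a = (ginv (ginv a) * ginv a) * (a * ginv a)" by simp
  also have "\<dots> = ginv (ginv a) * (ginv a * a) * ginv a" by (simp only: mult.assoc)
  also have "\<dots> = 1" by simp
  finally show ?thesis .
qed

lemma ginv_left_assoc [simp]: "ginv a * (a * b) = b"
  by (simp flip: mult.assoc)

lemma ginv_right_assoc [simp]: "a * (ginv a * b) = b"
  by (simp flip: mult.assoc)

lemma grp_cancel_left [simp]: "a * b = a * c \<longleftrightarrow> b = c"
  by (metis ginv_left_assoc)

lemma grp_cancel_right [simp]: "b * a = c * a \<longleftrightarrow> b = c"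
  by (metis mult.assoc ginv_right mult_1_right)

lemma ginv_unique: "a * b = 1 \<Longrightarrow> ginv a = b"
  by (metis ginv_left_assoc mult_1_right)

lemma ginv_ginv [simp]: "ginv (ginv a) = a"
  by (rule ginv_unique) simp

lemma ginv_mult [simp]: "ginv (a * b) = ginv b * ginv a"
  by (rule ginv_unique) (simp add: mult.assoc)

lemma ginv_one [simp]: "ginv 1 = 1"
  by (rule ginv_unique) simp

lemma ginv_eq_iff [simp]: "ginv a = ginv b \<longleftrightarrow> a = b"
  by (metis ginv_ginv)

end

locale coxeter =
  fixes S :: "'g::grp set" and m :: "'g \<Rightarrow> 'g \<Rightarrow> nat"
  assumes matrix: "coxeter_matrix S m"
    and relator_one: "r \<in> coxeter_relators S m \<Longrightarrow> prod_list r = 1"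
    and presentation: "\<lbrakk>a \<in> lists S; b \<in> lists S; prod_list a = prod_list b\<rbrakk>
      \<Longrightarrow> equivclp (relator_step (coxeter_relators S m)) a b"
begin

lemma relator_in_lists: "r \<in> coxeter_relators S m \<Longrightarrow> r \<in> lists S"
  by (auto simp: coxeter_relators_def)

text \<open>A statistic of words descends to the group once it survives deletion of a relator.
  Applied below to the parity of the length, to \<open>par\<close>, to the operators
  \<open>act\<close> and to letter counts.\<close>

lemma word_invariant:
  assumes inv: "\<And>x r y. \<lbrakk>x \<in> lists S; y \<in> lists S; r \<in> coxeter_relators S m\<rbrakk> \<Longrightarrow> F (x @ r @ y) = F (x @ y)"
    and a: "a \<in> lists S" and b: "b \<in> lists S" and eq: "prod_list a = prod_list b"
  shows "F a = F b"
proof -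
  \<comment> \<open>The connecting chain is traversed in both directions, so membership in
    \<open>lists S\<close> is carried as an equivalence.\<close>
  have *: "(y \<in> lists S \<longleftrightarrow> z \<in> lists S) \<and> (y \<in> lists S \<longrightarrow> F y = F z)"
    if st: "relator_step (coxeter_relators S m) y z" for y z
  proof -
    obtain c d r where "r \<in> coxeter_relators S m" "y = c @ r @ d" "z = c @ d"
      using st unfolding relator_step_def by blast
    then show ?thesis using inv[of c d r] relator_in_lists[of r] by auto
  qed
  from presentation[OF a b eq] have "b \<in> lists S \<and> F a = F b"
  proof (induction rule: equivclp_induct)
    case base then show ?case using a by simp
  next
    case (step y z)
    then show ?case using *[of y z] *[of z y] by auto
  qed
  then show ?thesis by simp
qed

lemma sq [simp]: "s \<in> S \<Longrightarrow> s * s = 1"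
proof -
  assume s: "s \<in> S"
  then have "m s s = 1" using matrix by (auto simp: coxeter_matrix_def)
  then have "[s,s] \<in> coxeter_relators S m" using s
    unfolding coxeter_relators_def by (force intro!: exI[of _ s])
  from relator_one[OF this] show ?thesis by simp
qed

lemma sq_assoc [simp]: "s \<in> S \<Longrightarrow> s * (s * x) = x"
  by (simp flip: mult.assoc)

lemma ginv_gen [simp]: "s \<in> S \<Longrightarrow> ginv s = s"
  by (rule ginv_unique) simp

definition W :: "'g set" where "W = prod_list ` lists S"

definition T :: "'g set" where "T = {x * s * ginv x | x s. x \<in> W \<and> s \<in> S}"

lemma prod_list_W [simp]: "w \<in> lists S \<Longrightarrow> prod_list w \<in> W"
  by (simp add: W_def)

lemma W_cases: assumes "x \<in> W" obtains w where "w \<in> lists S" "prod_list w = x"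
  using assms by (auto simp: W_def)

lemma W_one [simp, intro]: "1 \<in> W"
  using prod_list_W[of "[]"] by simp

lemma W_mult [simp, intro]: "x \<in> W \<Longrightarrow> y \<in> W \<Longrightarrow> x * y \<in> W"
  by (metis W_cases append_in_lists_conv prod_list.append prod_list_W)

lemma W_gen [simp, intro]: "s \<in> S \<Longrightarrow> s \<in> W"
  using prod_list_W[of "[s]"] by simp

lemma prod_list_rev: "w \<in> lists S \<Longrightarrow> prod_list (rev w) = ginv (prod_list w)"
  by (induction w) auto

lemma W_ginv [simp, intro]: "x \<in> W \<Longrightarrow> ginv x \<in> W"
  by (metis W_cases prod_list_rev prod_list_W in_lists_conv_set set_rev)

lemma W_mult_left_iff [simp]: "a \<in> W \<Longrightarrow> a * x \<in> W \<longleftrightarrow> x \<in> W"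
  by (metis W_ginv W_mult ginv_left_assoc)

lemma W_mult_right_iff [simp]: "a \<in> W \<Longrightarrow> x * a \<in> W \<longleftrightarrow> x \<in> W"
  by (metis W_ginv W_mult ginv_right mult.assoc mult_1_right)

lemma T_cases: assumes "t \<in> T" obtains x s where "x \<in> W" "s \<in> S" "t = x * s * ginv x"
  using assms by (auto simp: T_def)

lemma T_W [simp, intro]: "t \<in> T \<Longrightarrow> t \<in> W"
  by (auto simp: T_def)

lemma gen_T [simp, intro]: "s \<in> S \<Longrightarrow> s \<in> T"
  unfolding T_def by (force intro: exI[of _ 1])

lemma T_conj [simp, intro]: "t \<in> T \<Longrightarrow> x \<in> W \<Longrightarrow> x * t * ginv x \<in> T"
proof (elim T_cases)
  fix y s assume *: "x \<in> W" "y \<in> W" "s \<in> S" "t = y * s * ginv y"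
  then have "x * t * ginv x = (x * y) * s * ginv (x * y)" by (simp add: mult.assoc)
  then show ?thesis using * unfolding T_def by blast
qed

lemma T_conj' [simp, intro]: "t \<in> T \<Longrightarrow> x \<in> W \<Longrightarrow> ginv x * t * x \<in> T"
  using T_conj[of t "ginv x"] by simp

lemma T_sq [simp]: "t \<in> T \<Longrightarrow> t * t = 1"
  by (elim T_cases) (simp add: mult.assoc)

lemma T_sq_assoc [simp]: "t \<in> T \<Longrightarrow> t * (t * x) = x"
  by (simp flip: mult.assoc)

lemma T_ginv [simp]: "t \<in> T \<Longrightarrow> ginv t = t"
  by (rule ginv_unique) simp

section \<open>Parity of length and the inversion cocycle\<close>

lemma even_length_cong:
  assumes "a \<in> lists S" "b \<in> lists S" "prod_list a = prod_list b"
  shows "even (length a) = even (length b)"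
  by (rule word_invariant[where F = "\<lambda>w. even (length w)", OF _ assms])
    (auto simp: coxeter_relators_def length_concat sum_list_replicate)

text \<open>\<open>par w t\<close> is the parity of the number of \<open>i\<close> with \<open>t = s\<^sub>1 \<dots> s\<^sub>i \<dots> s\<^sub>1\<close>, where \<open>w = [s\<^sub>1, \<dots>, s\<^sub>n]\<close>.\<close>

primrec par :: "'g list \<Rightarrow> 'g \<Rightarrow> bool" where
  "par [] t = False"
| "par (s # w) t = ((t = s) \<noteq> par w (ginv s * t * s))"

text \<open>The cocycle rule: behind the prefix \<open>a\<close>, the word \<open>b\<close> is
  tested against the reflection conjugated by the product of \<open>a\<close>.\<close>

lemma par_append: "par (a @ b) t = (par a t \<noteq> par b (ginv (prod_list a) * t * prod_list a))"
  by (induction a arbitrary: t) (auto simp: mult.assoc)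

text \<open>The reflections attached to the prefixes of \<open>s t s t ...\<close> are
  \<open>(s * t) ^ i * s\<close>.\<close>

lemma par_alternating:
  assumes s: "s \<in> S" and t: "t \<in> S"
  shows "par (concat (replicate k [s, t])) u \<longleftrightarrow> odd (\<Sum>i<2*k. of_bool (u = (s * t) ^ i * s) :: nat)"
proof (induction k arbitrary: u)
  case (Suc k)
  have conj: "t * (s * (u * (s * t))) = (s * t) ^ i * s \<longleftrightarrow> u = (s * t) ^ (Suc (Suc i)) * s" for i
  proof -
    have "t * (s * (u * (s * t))) = (s * t) ^ i * s \<longleftrightarrow>
          (s * t) * (t * (s * (u * (s * t)))) * (t * s) = (s * t) * ((s * t) ^ i * s) * (t * s)"
      by (simp only: grp_cancel_left grp_cancel_right)
    also have "(s * t) * (t * (s * (u * (s * t)))) * (t * s) = u"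
      using s t by (simp add: mult.assoc)
    also have "(s * t) * ((s * t) ^ i * s) * (t * s) = (s * t) ^ (Suc (Suc i)) * s"
    proof -
      have "(s * t) ^ (Suc (Suc i)) = (s * t) * ((s * t) ^ i * (s * t))"
        by (metis power_Suc power_Suc2)
      then show ?thesis by (simp only: mult.assoc)
    qed
    finally show ?thesis .
  qed
  have 2: "s * (u * s) = t \<longleftrightarrow> u = s * t * s"
  proof -
    have "s * (u * s) = t \<longleftrightarrow> s * (s * (u * s)) * s = s * t * s" by simp
    then show ?thesis using s by (simp add: mult.assoc)
  qed
  have "par (concat (replicate (Suc k) [s, t])) u \<longleftrightarrow>
     ((u = s) \<noteq> ((s * (u * s) = t) \<noteq> par (concat (replicate k [s, t])) (t * (s * (u * (s * t))))))"
    using s t by (simp add: mult.assoc)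
  also have "\<dots> \<longleftrightarrow>
     ((u = s) \<noteq> ((u = s * t * s) \<noteq> odd (\<Sum>i<2*k. of_bool (u = (s * t) ^ (Suc (Suc i)) * s) :: nat)))"
    unfolding 2 Suc.IH conj ..
  also have "\<dots> \<longleftrightarrow> odd (\<Sum>i<Suc (Suc (2*k)). of_bool (u = (s * t) ^ i * s) :: nat)"
    by (simp only: sum.lessThan_Suc_shift) (simp add: mult.assoc)
  finally show ?case by simp
qed simp

text \<open>Since \<open>(s * t) ^ m s t = 1\<close>, the \<open>2 * m s t\<close> reflections of a
  relator run twice through the same list, so each occurs an even number of times.\<close>

lemma par_relator:
  assumes "r \<in> coxeter_relators S m" shows "\<not> par r u"
proof -
  obtain s t where st: "s \<in> S" "t \<in> S" "r = concat (replicate (m s t) [s, t])"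
    using assms by (auto simp: coxeter_relators_def)
  have pl: "prod_list (concat (replicate k [s, t])) = (s * t) ^ k" for k
    by (induction k) (auto simp: mult.assoc)
  have one: "(s * t) ^ m s t = 1" using relator_one[OF assms] st pl by simp
  let ?f = "\<lambda>i. of_bool (u = (s * t) ^ i * s) :: nat"
  have split: "(\<Sum>i<n + k. f i) = (\<Sum>i<n. f i) + (\<Sum>i<k. f (n + i))" for n k and f :: "nat \<Rightarrow> nat"
    by (induction k) auto
  have "(\<Sum>i<2 * m s t. ?f i) = (\<Sum>i<m s t. ?f i) + (\<Sum>i<m s t. ?f (m s t + i))"
    unfolding mult_2 by (rule split)
  also have "\<dots> = 2 * (\<Sum>i<m s t. ?f i)"
    by (simp add: power_add one)
  finally show ?thesis using par_alternating[OF st(1,2)] st(3) by simp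
qed

lemma par_cong:
  assumes "a \<in> lists S" "b \<in> lists S" "prod_list a = prod_list b"
  shows "par a t = par b t"
  by (rule word_invariant[where F = "\<lambda>w. par w t", OF _ assms])
    (auto simp: par_append par_relator relator_one)

text \<open>For a reflection \<open>t\<close> this says that \<open>t\<close> is a left inversion of
  \<open>x\<close>; see \<open>less_iff_nn\<close>.\<close>

definition nn :: "'g \<Rightarrow> 'g \<Rightarrow> bool" where
  "nn x t \<longleftrightarrow> (\<exists>w\<in>lists S. prod_list w = x \<and> par w t)"

lemma nn_word [simp]: "w \<in> lists S \<Longrightarrow> nn (prod_list w) t = par w t"
  unfolding nn_def using par_cong by blast

lemma nn_one [simp]: "\<not> nn 1 t"
  using nn_word[of "[]"] by simp

lemma nn_mult: "x \<in> W \<Longrightarrow> y \<in> W \<Longrightarrow> nn (x * y) t = (nn x t \<noteq> nn y (ginv x * t * x))"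
proof (elim W_cases)
  fix a b assume "a \<in> lists S" "b \<in> lists S" "prod_list a = x" "prod_list b = y"
  then show ?thesis using nn_word[of "a @ b" t] nn_word[of a t] nn_word[of b "ginv x * t * x"]
    by (simp add: par_append)
qed

lemma nn_gen [simp]: "s \<in> S \<Longrightarrow> nn s t \<longleftrightarrow> t = s"
  using nn_word[of "[s]"] by simp

lemma nn_ginv: "x \<in> W \<Longrightarrow> nn (ginv x) t = nn x (x * t * ginv x)"
  using nn_mult[of x "ginv x" "x * t * ginv x"] by (simp add: mult.assoc)

text \<open>In \<open>t = x * s * ginv x\<close> the contributions of \<open>x\<close> and
  \<open>ginv x\<close> cancel, and the middle letter \<open>s\<close> contributes exactly
  once.\<close>

lemma nn_refl: assumes "t \<in> T" shows "nn t t"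
proof -
  obtain x s where x: "x \<in> W" "s \<in> S" "t = x * s * ginv x" using T_cases assms by metis
  have "nn t t = (nn (x * s) t \<noteq> nn (ginv x) (s * ginv x * t * x * s))"
    using nn_mult[of "x * s" "ginv x" t] x by (simp add: mult.assoc)
  also have "s * ginv x * t * x * s = s" using x by (simp add: mult.assoc)
  also have "nn (x * s) t = (nn x t \<noteq> True)" using nn_mult[of x s t] x by (simp add: mult.assoc)
  also have "nn (ginv x) s = nn x t" using nn_ginv x by simp
  finally show ?thesis by simp
qed

section \<open>Length and the exchange property\<close>

definition len :: "'g \<Rightarrow> nat" where
  "len x = (LEAST n. \<exists>w\<in>lists S. length w = n \<and> prod_list w = x)"

lemma reduced_word:
  assumes "x \<in> W" obtains w where "w \<in> lists S" "prod_list w = x" "length w = len x"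
proof -
  have "\<exists>n. \<exists>w\<in>lists S. length w = n \<and> prod_list w = x" using assms unfolding W_def by blast
  from LeastI_ex[OF this] show ?thesis unfolding len_def[symmetric] using that by blast
qed

lemma len_le: "w \<in> lists S \<Longrightarrow> len (prod_list w) \<le> length w"
  unfolding len_def by (rule Least_le) blast

lemma even_len: "w \<in> lists S \<Longrightarrow> even (len (prod_list w)) = even (length w)"
  by (metis reduced_word even_length_cong prod_list_W)

lemma len_one [simp]: "len 1 = 0"
  using len_le[of "[]"] by simp

lemma len_eq_0 [simp]: "x \<in> W \<Longrightarrow> len x = 0 \<longleftrightarrow> x = 1"
  by (metis len_one length_0_conv prod_list.Nil reduced_word)

lemma even_len_mult: "x \<in> W \<Longrightarrow> y \<in> W \<Longrightarrow> even (len (x * y)) = (even (len x) = even (len y))"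
proof (elim W_cases)
  fix a b assume "a \<in> lists S" "b \<in> lists S" "prod_list a = x" "prod_list b = y"
  then show ?thesis using even_len[of a] even_len[of b] even_len[of "a @ b"] by auto
qed

lemma len_mult_le: "x \<in> W \<Longrightarrow> y \<in> W \<Longrightarrow> len (x * y) \<le> len x + len y"
  by (metis append_in_lists_conv length_append len_le prod_list.append reduced_word)

lemma len_ginv [simp]: assumes "x \<in> W" shows "len (ginv x) = len x"
proof -
  have "len (ginv y) \<le> len y" if "y \<in> W" for y
    by (metis that reduced_word len_le length_rev prod_list_rev in_lists_conv_set set_rev)
  from this[OF assms] this[OF W_ginv[OF assms]] show ?thesis by simp
qed

lemma len_gen [simp]: assumes "s \<in> S" shows "len s = 1"
proof -
  have "odd (len s)" using even_len[of "[s]"] assms by simp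
  moreover have "len s \<le> 1" using len_le[of "[s]"] assms by simp
  ultimately show ?thesis by (cases "len s") auto
qed

lemma odd_len_T: assumes "t \<in> T" shows "odd (len t)"
proof -
  obtain x s where "x \<in> W" "s \<in> S" "t = x * s * ginv x" using T_cases assms by metis
  then show ?thesis by (simp add: even_len_mult)
qed

lemma T_not_one [simp]: "t \<in> T \<Longrightarrow> t \<noteq> 1"
  using odd_len_T len_one by fastforce

text \<open>An odd number of occurrences is at least one, and deleting the letter at which
  \<open>t\<close> occurs multiplies the product by \<open>t\<close>.\<close>

lemma par_exchange:
  "w \<in> lists S \<Longrightarrow> par w t \<Longrightarrow> \<exists>a s b. w = a @ s # b \<and> t * prod_list w = prod_list (a @ b)"
proof (induction w arbitrary: t)
  case (Cons s w)
  then have sS: "s \<in> S" and wS: "w \<in> lists S" by auto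
  show ?case
  proof (cases "t = s")
    case True
    then show ?thesis using sS by (intro exI[of _ "[]"]) auto
  next
    case False
    then have "par w (s * t * s)" using Cons.prems sS by simp
    from Cons.IH[OF wS this] obtain a s' b where "w = a @ s' # b"
      "s * t * s * prod_list w = prod_list (a @ b)" by blast
    then have "s # w = (s # a) @ s' # b \<and> t * prod_list (s # w) = prod_list ((s # a) @ b)"
      using sS by (metis append_Cons mult.assoc prod_list.Cons sq_assoc)
    then show ?thesis by blast
  qed
qed simp

lemma exchange:
  assumes "w \<in> lists S" "nn (prod_list w) t"
  shows "\<exists>a s b. w = a @ s # b \<and> t * prod_list w = prod_list (a @ b)"
  using par_exchange assms by simp

lemma nn_imp_less: assumes "x \<in> W" "nn x t" shows "len (t * x) < len x"
proof -
  obtain w where w: "w \<in> lists S" "prod_list w = x" "length w = len x" using reduced_word assms by metis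
  then obtain a s b where ab: "w = a @ s # b" "t * x = prod_list (a @ b)" using exchange[of w t] assms by auto
  then have "len (t * x) \<le> length (a @ b)" using w(1) len_le[of "a @ b"] by simp
  then show ?thesis using ab w by simp
qed

text \<open>Because of \<open>nn_refl\<close>, exactly one of \<open>x\<close> and
  \<open>t * x\<close> has \<open>t\<close> as an inversion; \<open>nn_imp_less\<close> applied to
  that one decides which is shorter.\<close>

lemma less_iff_nn: assumes "x \<in> W" "t \<in> T" shows "len (t * x) < len x \<longleftrightarrow> nn x t"
proof
  assume l: "len (t * x) < len x"
  show "nn x t"
  proof (rule ccontr)
    assume "\<not> nn x t"
    then have "nn (t * x) t" using nn_mult[of t x t] nn_refl assms by (simp add: mult.assoc)
    then have "len (t * (t * x)) < len (t * x)" using nn_imp_less assms by blast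
    then show False using l assms by simp
  qed
qed (use nn_imp_less assms in blast)

lemma len_T_neq: "x \<in> W \<Longrightarrow> t \<in> T \<Longrightarrow> even (len (t * x)) \<longleftrightarrow> odd (len x)"
  using even_len_mult odd_len_T by auto

end

section \<open>Bruhat order\<close>

context coxeter
begin

text \<open>Reflections multiply on the left here and on the right in \<open>gamma_edge\<close>.
  Closure of \<open>T\<close> under conjugation makes the two graphs equal, see
  \<open>E_adj\<close>.\<close>

definition adj :: "'g \<Rightarrow> 'g \<Rightarrow> bool" where
  "adj x y \<longleftrightarrow> (\<exists>t\<in>T. y = t * x)"

definition arrow :: "'g \<Rightarrow> 'g \<Rightarrow> bool" where
  "arrow x y \<longleftrightarrow> x \<in> W \<and> y \<in> W \<and> adj x y \<and> len x < len y"

definition cov :: "'g \<Rightarrow> 'g \<Rightarrow> bool" where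
  "cov x y \<longleftrightarrow> arrow x y \<and> len y = Suc (len x)"

definition ble :: "'g \<Rightarrow> 'g \<Rightarrow> bool" where
  "ble x y \<longleftrightarrow> x \<in> W \<and> y \<in> W \<and> arrow\<^sup>*\<^sup>* x y"

definition dl :: "'g \<Rightarrow> 'g \<Rightarrow> bool" where
  "dl s x \<longleftrightarrow> len (s * x) < len x"

definition dr :: "'g \<Rightarrow> 'g \<Rightarrow> bool" where
  "dr s x \<longleftrightarrow> len (x * s) < len x"

lemma adj_sym: "adj x y \<Longrightarrow> adj y x"
  unfolding adj_def by force

lemma adj_iff: "adj x y \<longleftrightarrow> y * ginv x \<in> T"
  unfolding adj_def by (force simp: mult.assoc)

lemma adj_mult_left [simp]: "a \<in> W \<Longrightarrow> adj (a * x) (a * y) \<longleftrightarrow> adj x y"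
  unfolding adj_iff using T_conj[of "y * ginv x" a] T_conj'[of "a * (y * (ginv x * ginv a))" a]
  by (auto simp: mult.assoc)

lemma adj_mult_right [simp]: "adj (x * a) (y * a) \<longleftrightarrow> adj x y"
  unfolding adj_iff by (simp add: mult.assoc)

lemma adj_ginv [simp]: "x \<in> W \<Longrightarrow> y \<in> W \<Longrightarrow> adj (ginv x) (ginv y) \<longleftrightarrow> adj x y"
proof -
  assume x: "x \<in> W" and y: "y \<in> W"
  have "adj (ginv x) (ginv y) \<longleftrightarrow> adj (y * (ginv x * x)) (y * (ginv y * x))" using x y
    by (simp only: adj_mult_left adj_mult_right)
  also have "\<dots> \<longleftrightarrow> adj x y" by (auto intro: adj_sym)
  finally show ?thesis .
qed

lemma adj_irrefl [simp]: "\<not> adj x x"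
  by (auto simp: adj_iff dest: T_not_one)

lemma adj_W: "adj x y \<Longrightarrow> x \<in> W \<longleftrightarrow> y \<in> W"
  by (auto simp: adj_def)

lemma adj_gen [simp]: "s \<in> S \<Longrightarrow> adj x (s * x)"
  by (auto simp: adj_def)

lemma adj_gen' [simp]: "s \<in> S \<Longrightarrow> adj (s * x) x"
  by (auto intro: adj_sym)

lemma adj_parity: "adj x y \<Longrightarrow> x \<in> W \<Longrightarrow> even (len y) \<longleftrightarrow> odd (len x)"
  unfolding adj_def using len_T_neq by auto

lemma adj_arrow: "adj x y \<Longrightarrow> x \<in> W \<Longrightarrow> arrow x y \<or> arrow y x"
  unfolding arrow_def using adj_W adj_sym adj_parity by (metis linorder_neqE_nat)

lemma arrowI: "adj x y \<Longrightarrow> x \<in> W \<Longrightarrow> len x < len y \<Longrightarrow> arrow x y"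
  using adj_W by (auto simp: arrow_def)

lemma arrow_adj: "arrow x y \<Longrightarrow> adj x y" by (simp add: arrow_def)
lemma arrow_len: "arrow x y \<Longrightarrow> len x < len y" by (simp add: arrow_def)
lemma arrow_W: "arrow x y \<Longrightarrow> x \<in> W" "arrow x y \<Longrightarrow> y \<in> W" by (auto simp: arrow_def)
lemma cov_arrow: "cov x y \<Longrightarrow> arrow x y" by (simp add: cov_def)
lemma cov_adj: "cov x y \<Longrightarrow> adj x y" by (simp add: cov_def arrow_def)
lemma cov_len: "cov x y \<Longrightarrow> len y = Suc (len x)" by (simp add: cov_def)
lemma cov_W: "cov x y \<Longrightarrow> x \<in> W" "cov x y \<Longrightarrow> y \<in> W" by (auto simp: cov_def arrow_def)
lemma covI: "adj x y \<Longrightarrow> x \<in> W \<Longrightarrow> len y = Suc (len x) \<Longrightarrow> cov x y"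
  by (simp add: cov_def arrowI)

lemma arrow_ginv [simp]: "x \<in> W \<Longrightarrow> y \<in> W \<Longrightarrow> arrow (ginv x) (ginv y) \<longleftrightarrow> arrow x y"
  by (simp add: arrow_def)

lemma cov_ginv [simp]: "x \<in> W \<Longrightarrow> y \<in> W \<Longrightarrow> cov (ginv x) (ginv y) \<longleftrightarrow> cov x y"
  by (simp add: cov_def)

lemma dl_ginv [simp]: "x \<in> W \<Longrightarrow> s \<in> S \<Longrightarrow> dl s (ginv x) \<longleftrightarrow> dr s x"
  unfolding dl_def dr_def by (metis W_gen W_mult ginv_gen ginv_mult len_ginv)

lemma dr_ginv [simp]: "x \<in> W \<Longrightarrow> s \<in> S \<Longrightarrow> dr s (ginv x) \<longleftrightarrow> dl s x"
  using dl_ginv[of "ginv x" s] by simp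

lemma dl_iff_nn: "x \<in> W \<Longrightarrow> s \<in> S \<Longrightarrow> dl s x \<longleftrightarrow> nn x s"
  unfolding dl_def by (rule less_iff_nn) auto

lemma len_gen_mult:
  assumes "x \<in> W" "s \<in> S"
  shows "len (s * x) = (if dl s x then len x - 1 else Suc (len x))" "dl s x \<Longrightarrow> len x > 0"
proof -
  have 1: "len (s * x) \<le> Suc (len x)" using len_mult_le[of s x] assms by simp
  have 2: "len x \<le> Suc (len (s * x))" using len_mult_le[of s "s * x"] assms by simp
  have 3: "even (len (s * x)) \<longleftrightarrow> odd (len x)" using len_T_neq assms by auto
  show "len (s * x) = (if dl s x then len x - 1 else Suc (len x))"
    using 1 2 3 unfolding dl_def by (auto simp: le_Suc_eq not_less)
qed (auto simp: dl_def)

lemma dl_gen_mult [simp]: "x \<in> W \<Longrightarrow> s \<in> S \<Longrightarrow> dl s (s * x) \<longleftrightarrow> \<not> dl s x"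
  using len_gen_mult[of x s] unfolding dl_def by (auto split: if_splits)

lemma dr_gen_mult [simp]: "x \<in> W \<Longrightarrow> s \<in> S \<Longrightarrow> dr s (x * s) \<longleftrightarrow> \<not> dr s x"
  using dl_gen_mult[of "ginv x" s] by (metis W_gen W_ginv W_mult dl_ginv ginv_gen ginv_mult)

lemma len_dl: "x \<in> W \<Longrightarrow> s \<in> S \<Longrightarrow> dl s x \<Longrightarrow> len x = Suc (len (s * x))"
  using len_gen_mult[of x s] by auto

lemma len_not_dl: "x \<in> W \<Longrightarrow> s \<in> S \<Longrightarrow> \<not> dl s x \<Longrightarrow> len (s * x) = Suc (len x)"
  using len_gen_mult[of x s] by auto

lemma len_dr: "x \<in> W \<Longrightarrow> s \<in> S \<Longrightarrow> dr s x \<Longrightarrow> len x = Suc (len (x * s))"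
  using len_dl[of "ginv x" s] by (metis W_gen W_ginv W_mult dl_ginv ginv_gen ginv_mult len_ginv)

lemma len_not_dr: "x \<in> W \<Longrightarrow> s \<in> S \<Longrightarrow> \<not> dr s x \<Longrightarrow> len (x * s) = Suc (len x)"
  using len_not_dl[of "ginv x" s] by (metis W_gen W_ginv W_mult dl_ginv ginv_gen ginv_mult len_ginv)

lemma not_dl_one [simp]: "\<not> dl s 1" by (simp add: dl_def)
lemma not_dr_one [simp]: "\<not> dr s 1" by (simp add: dr_def)

lemma ex_dl: assumes "x \<in> W" "x \<noteq> 1" shows "\<exists>s\<in>S. dl s x"
proof -
  obtain w where w: "w \<in> lists S" "prod_list w = x" "length w = len x" using reduced_word assms by metis
  then obtain s v where v: "w = s # v" using assms by (cases w) auto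
  then have "len (s * x) \<le> length v" using w len_le[of v] by auto
  then show ?thesis using w v unfolding dl_def by (intro bexI[of _ s]) auto
qed

lemma ex_dr: assumes "x \<in> W" "x \<noteq> 1" shows "\<exists>s\<in>S. dr s x"
proof -
  have "ginv x \<noteq> 1" using assms by (metis ginv_ginv ginv_one)
  then show ?thesis using ex_dl[of "ginv x"] assms by auto
qed

lemma W_left_induct [consumes 1, case_names one gen]:
  assumes "x \<in> W" "P 1"
    and step: "\<And>s y. \<lbrakk>s \<in> S; y \<in> W; \<not> dl s y; P y\<rbrakk> \<Longrightarrow> P (s * y)"
  shows "P x"
  using assms(1)
proof (induction "len x" arbitrary: x)
  case 0 then show ?case using assms(2) by simp
next
  case (Suc n)
  then have "x \<noteq> 1" by auto
  then obtain s where s: "s \<in> S" "dl s x" using ex_dl Suc by blast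
  then have "P (s * x)" using Suc.hyps Suc.prems len_dl[of x s] by simp
  then show ?case using step[of s "s * x"] s Suc.prems by simp
qed

lemma nn_gen_mult: "x \<in> W \<Longrightarrow> s \<in> S \<Longrightarrow> nn (s * x) (s * t * s) \<longleftrightarrow> (t = s) \<noteq> nn x t"
proof -
  assume x: "x \<in> W" and s: "s \<in> S"
  have "s * t * s = s \<longleftrightarrow> t = s"
  proof -
    have "s * t * s = s \<longleftrightarrow> s * (s * t * s) * s = s * s * s" by simp
    then show ?thesis using s by (simp add: mult.assoc)
  qed
  then show ?thesis using nn_mult[of s x "s * t * s"] x s by (simp add: mult.assoc)
qed

text \<open>Multiplication by \<open>s\<close> conjugates the inversions and toggles only
  \<open>s\<close> itself (\<open>nn_gen_mult\<close>). Hence every edge except the one between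
  \<open>x\<close> and \<open>s * x\<close> keeps its direction.\<close>

lemma arrow_gen_mult:
  assumes "arrow x y" "s \<in> S" "y \<noteq> s * x"
  shows "arrow (s * x) (s * y)"
proof -
  obtain t where t: "t \<in> T" "y = t * x" using assms by (auto simp: arrow_def adj_def)
  have x: "x \<in> W" using assms arrow_W by auto
  have "\<not> nn x t" using less_iff_nn[of x t] arrow_len[OF assms(1)] t x by simp
  moreover have "t \<noteq> s" using t assms by auto
  ultimately have "\<not> nn (s * x) (s * t * s)" using nn_gen_mult x assms by simp
  moreover have t': "s * t * s \<in> T" using T_conj[of t s] t assms by simp
  moreover have eq: "(s * t * s) * (s * x) = s * y" using t assms by (simp add: mult.assoc)
  ultimately have "\<not> len (s * y) < len (s * x)" using less_iff_nn[of "s * x" "s * t * s"] x assms by simp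
  moreover have "adj (s * x) (s * y)" using eq t' unfolding adj_def by force
  ultimately show ?thesis using adj_arrow[of "s * x" "s * y"] x assms arrow_len by auto
qed

lemma arrow_gen_mult_right:
  assumes "arrow x y" "s \<in> S" "y \<noteq> x * s"
  shows "arrow (x * s) (y * s)"
proof -
  have W: "x \<in> W" "y \<in> W" using assms arrow_W by auto
  have "ginv y \<noteq> s * ginv x" using assms by (metis ginv_gen ginv_ginv ginv_mult)
  then have "arrow (s * ginv x) (s * ginv y)" using arrow_gen_mult[of "ginv x" "ginv y" s] assms W by simp
  then have "arrow (ginv (x * s)) (ginv (y * s))" using assms by simp
  then show ?thesis using W assms by (simp del: ginv_mult)
qed

lemma dl_commute:
  assumes "s \<in> S" "t \<in> S" "s \<noteq> t" "s * t = t * s" "x \<in> W"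
  shows "dl s (t * x) \<longleftrightarrow> dl s x"
proof -
  have e: "t * s * t = s" using assms by (metis mult.assoc sq_assoc)
  have "nn (t * x) (t * s * t) \<longleftrightarrow> nn x s" using nn_gen_mult[of x t s] assms by simp
  then show ?thesis using dl_iff_nn[of x s] dl_iff_nn[of "t * x" s] assms e by simp
qed

section \<open>Lifting property of the Bruhat order\<close>

definition lmin :: "'g \<Rightarrow> 'g \<Rightarrow> 'g" where
  "lmin s x = (if dl s x then s * x else x)"

definition lmax :: "'g \<Rightarrow> 'g \<Rightarrow> 'g" where
  "lmax s x = (if dl s x then x else s * x)"

lemma lmin_W [simp]: "x \<in> W \<Longrightarrow> s \<in> S \<Longrightarrow> lmin s x \<in> W" by (simp add: lmin_def)
lemma lmax_W [simp]: "x \<in> W \<Longrightarrow> s \<in> S \<Longrightarrow> lmax s x \<in> W" by (simp add: lmax_def)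

lemma ble_W: "ble x y \<Longrightarrow> x \<in> W" "ble x y \<Longrightarrow> y \<in> W" by (auto simp: ble_def)
lemma ble_refl [simp]: "x \<in> W \<Longrightarrow> ble x x" by (simp add: ble_def)
lemma ble_trans [trans]: "ble x y \<Longrightarrow> ble y z \<Longrightarrow> ble x z" by (auto simp: ble_def)
lemma arrow_ble: "arrow x y \<Longrightarrow> ble x y" by (auto simp: ble_def arrow_def)
lemma cov_ble: "cov x y \<Longrightarrow> ble x y" by (simp add: arrow_ble cov_arrow)

lemma ble_len: "ble x y \<Longrightarrow> len x \<le> len y \<and> (len x = len y \<longrightarrow> x = y)"
proof -
  have "arrow\<^sup>*\<^sup>* x y \<Longrightarrow> len x \<le> len y \<and> (len x = len y \<longrightarrow> x = y)"
    by (induction rule: rtranclp_induct) (auto dest!: arrow_len)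
  then show "ble x y \<Longrightarrow> ?thesis" by (simp add: ble_def)
qed

lemma ble_antisym: "ble x y \<Longrightarrow> ble y x \<Longrightarrow> x = y"
  using ble_len by (metis le_antisym)

lemma ble_first_arrow:
  assumes "ble x y" "x \<noteq> y" obtains z where "arrow x z" "ble z y"
proof -
  have "arrow\<^sup>*\<^sup>* x y" using assms by (simp add: ble_def)
  then obtain z where "arrow x z" "arrow\<^sup>*\<^sup>* z y" using assms(2) by (metis converse_rtranclpE)
  then show ?thesis using that arrow_W assms by (auto simp: ble_def)
qed

lemma ble_Suc_cov: "ble x y \<Longrightarrow> len y = Suc (len x) \<Longrightarrow> cov x y"
  by (metis ble_first_arrow arrow_len ble_len cov_def le_antisym Suc_leI lessI nat_neq_iff)

lemma ble_gen: "x \<in> W \<Longrightarrow> s \<in> S \<Longrightarrow> ble (lmin s x) x" "x \<in> W \<Longrightarrow> s \<in> S \<Longrightarrow> ble x (lmax s x)"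
  using len_dl len_not_dl by (auto simp: lmin_def lmax_def intro!: arrow_ble arrowI)

text \<open>The lifting property as monotonicity of the two projections. An arrow other than the
  \<open>s\<close>-edge survives multiplication by \<open>s\<close>, so both \<open>x\<close> and
  \<open>s * x\<close> lie below their counterparts; the chain is then closed through whichever of
  them is the projection.\<close>

lemma ble_lmin_lmax:
  assumes "ble x y" "s \<in> S"
  shows "ble (lmin s x) (lmin s y)" "ble (lmax s x) (lmax s y)"
proof -
  have step: "ble (lmin s x) (lmin s y) \<and> ble (lmax s x) (lmax s y)" if xy: "arrow x y" for x y
  proof (cases "y = s * x")
    case True
    then show ?thesis using xy \<open>s \<in> S\<close> arrow_W[OF xy]
      by (auto simp: lmin_def lmax_def)
  next
    case False
    then have a: "ble (s * x) (s * y)" "ble x y" using arrow_gen_mult xy \<open>s \<in> S\<close> arrow_ble by auto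
    have g: "ble (lmin s x) x" "ble (lmin s x) (s * x)" "ble y (lmax s y)" "ble (s * y) (lmax s y)"
      using ble_gen[of x s] ble_gen[of "s * x" s] ble_gen[of y s] ble_gen[of "s * y" s] arrow_W[OF xy] \<open>s \<in> S\<close>
      by (auto simp: lmin_def lmax_def)
    have "ble (lmin s x) (lmin s y)"
      using a g by (cases "dl s y") (auto simp: lmin_def[of s y] intro: ble_trans)
    moreover have "ble (lmax s x) (lmax s y)"
      using a g by (cases "dl s x") (auto simp: lmax_def[of s x] intro: ble_trans)
    ultimately show ?thesis ..
  qed
  have "arrow\<^sup>*\<^sup>* x y" "x \<in> W" using assms by (auto simp: ble_def)
  then have "ble (lmin s x) (lmin s y) \<and> ble (lmax s x) (lmax s y)"
    using \<open>s \<in> S\<close> by (induction rule: rtranclp_induct) (auto dest: step intro: ble_trans)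
  then show "ble (lmin s x) (lmin s y)" "ble (lmax s x) (lmax s y)" by auto
qed

text \<open>\<open>lmin s\<close> and \<open>lmax s\<close> form a Galois connection. This is what
  later allows dividing a lower bound by a group element.\<close>

lemma ble_lmin_iff: "u \<in> W \<Longrightarrow> y \<in> W \<Longrightarrow> s \<in> S \<Longrightarrow> ble u (lmax s y) \<longleftrightarrow> ble (lmin s u) y"
proof
  assume a: "u \<in> W" "y \<in> W" "s \<in> S"
  { assume "ble u (lmax s y)"
    from ble_lmin_lmax(1)[OF this a(3)] have "ble (lmin s u) (lmin s y)"
      using a by (auto simp: lmin_def lmax_def split: if_splits)
    then show "ble (lmin s u) y" using ble_gen(1)[OF a(2,3)] ble_trans by blast }
  { assume "ble (lmin s u) y"
    from ble_lmin_lmax(2)[OF this a(3)] have "ble (lmax s u) (lmax s y)"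
      using a by (auto simp: lmin_def lmax_def split: if_splits)
    then show "ble u (lmax s y)" using ble_gen(2)[OF a(1,3)] ble_trans by blast }
qed

lemma ble_ginv [simp]: "x \<in> W \<Longrightarrow> y \<in> W \<Longrightarrow> ble (ginv x) (ginv y) \<longleftrightarrow> ble x y"
proof -
  have *: "ble (ginv x) (ginv y)" if "ble x y" for x y
  proof -
    have "arrow\<^sup>*\<^sup>* x y" "x \<in> W" using that by (auto simp: ble_def)
    then have "ble (ginv x) (ginv y)"
    proof (induction rule: rtranclp_induct)
      case (step y z)
      then have "ble (ginv y) (ginv z)" using arrow_W[of y z] by (intro arrow_ble) simp
      then show ?case using step ble_trans by blast
    qed simp
    then show ?thesis .
  qed
  show "x \<in> W \<Longrightarrow> y \<in> W \<Longrightarrow> ble (ginv x) (ginv y) \<longleftrightarrow> ble x y"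
    using *[of x y] *[of "ginv x" "ginv y"] by auto
qed

text \<open>Lifting puts \<open>x\<close> below \<open>s * y\<close>, and the two have equal
  length.\<close>

lemma cov_dl_eq:
  assumes "cov x y" "s \<in> S" "dl s y" "\<not> dl s x"
  shows "x = s * y" "y = s * x"
proof -
  have "ble x (s * y)" using ble_lmin_lmax(1)[OF cov_ble[OF assms(1)] assms(2)] assms by (simp add: lmin_def)
  moreover have "len (s * y) = len x" using len_dl[of y s] assms cov_len cov_W by auto
  ultimately show "x = s * y" using ble_len by auto
  then show "y = s * x" using assms by simp
qed

lemma cov_gen_mult:
  assumes "cov x y" "s \<in> S" "dl s x \<longleftrightarrow> dl s y"
  shows "cov (s * x) (s * y)"
proof -
  have W: "x \<in> W" "y \<in> W" using assms cov_W by auto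
  have "y \<noteq> s * x" using assms W by auto
  then have "arrow (s * x) (s * y)" using arrow_gen_mult assms cov_arrow by auto
  then show ?thesis using assms len_dl[of x s] len_dl[of y s] len_not_dl[of x s] len_not_dl[of y s] cov_len[of x y] W
    by (cases "dl s y") (auto simp: cov_def)
qed

section \<open>Intervals of length two\<close>

definition mid :: "'g \<Rightarrow> 'g \<Rightarrow> 'g set" where
  "mid u w = {a. cov u a \<and> cov a w}"

text \<open>Both cases reduce to \<open>s w\<close> for a left descent \<open>s\<close> of \<open>w\<close>.\<close>

lemma card_mid:
  assumes "ble u w" "len w = len u + 2"
  shows "card (mid u w) = 2"
  using assms
proof (induction "len w" arbitrary: u w rule: less_induct)
  case less
  have W: "u \<in> W" "w \<in> W" using less.prems ble_W by auto
  have "w \<noteq> 1" using less.prems W by auto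
  then obtain s where s: "s \<in> S" "dl s w" using ex_dl W by blast
  have lw: "len w = Suc (len (s * w))" using len_dl W s by blast
  show ?case
  proof (cases "dl s u")
    case False
    have lu: "len (s * u) = Suc (len u)" using len_not_dl W s False by blast
    have "ble u (s * w)" using ble_lmin_lmax(1)[OF less.prems(1) s(1)] False s by (simp add: lmin_def)
    then have "cov u (s * w)" using less.prems lw by (intro ble_Suc_cov) auto
    moreover have "cov (s * w) w" using lw s W by (intro covI) auto
    ultimately have 1: "s * w \<in> mid u w" by (simp add: mid_def)
    have "ble (s * u) w" using ble_lmin_lmax(2)[OF less.prems(1) s(1)] False s by (simp add: lmax_def)
    then have "cov (s * u) w" using less.prems lu by (intro ble_Suc_cov) auto
    moreover have "cov u (s * u)" using lu s W by (intro covI) auto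
    ultimately have 2: "s * u \<in> mid u w" by (simp add: mid_def)
    have "x = s * u \<or> x = s * w" if "x \<in> mid u w" for x
      using that cov_dl_eq[of u x s] cov_dl_eq[of x w s] s False
      by (cases "dl s x") (auto simp: mid_def)
    then have "mid u w = {s * u, s * w}" using 1 2 by blast
    moreover have "u \<noteq> w" using False s by auto
    ultimately show ?thesis by simp
  next
    case True
    have lu: "len u = Suc (len (s * u))" using len_dl W s True by blast
    have b: "ble (s * u) (s * w)" using ble_lmin_lmax(1)[OF less.prems(1) s(1)] True s by (simp add: lmin_def)
    have ih: "card (mid (s * u) (s * w)) = 2" using less.hyps[OF _ b] lw lu less.prems by simp
    let ?h = "\<lambda>a. if a = u then s * w else s * a"
    have "mid u w = ?h ` mid (s * u) (s * w)"
    proof (intro equalityI subsetI)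
      fix x assume x: "x \<in> mid u w"
      show "x \<in> ?h ` mid (s * u) (s * w)"
      proof (cases "dl s x")
        case dx: True
        have "s * x \<in> mid (s * u) (s * w)" using x dx True s by (auto simp: mid_def intro: cov_gen_mult)
        moreover have "s * x \<noteq> u" using True dx s x by (auto simp: mid_def dest: cov_W)
        ultimately show ?thesis using s by (intro image_eqI[of _ _ "s * x"]) auto
      next
        case dx: False
        then have xs: "x = s * w" using x s cov_dl_eq[of x w s] by (auto simp: mid_def)
        then have "u \<in> mid (s * u) (s * w)" using x True s lu W by (auto simp: mid_def intro!: covI)
        then show ?thesis using xs by (intro image_eqI[of _ _ u]) auto
      qed
    next
      fix x assume "x \<in> ?h ` mid (s * u) (s * w)"
      then obtain a where a: "cov (s * u) a" "cov a (s * w)" "x = ?h a" by (auto simp: mid_def)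
      show "x \<in> mid u w"
      proof (cases "a = u")
        case True
        then show ?thesis using a s lw W by (auto simp: mid_def intro!: covI)
      next
        case False
        have "\<not> dl s a" using cov_dl_eq(2)[of "s * u" a s] a False True s W by auto
        then have "dl s (s * u) \<longleftrightarrow> dl s a" "dl s a \<longleftrightarrow> dl s (s * w)" using True s W by simp_all
        then have "cov (s * (s * u)) (s * a)" "cov (s * a) (s * (s * w))"
          using cov_gen_mult a(1,2) s(1) by blast+
        then have "cov u (s * a)" "cov (s * a) w" using s(1) by simp_all
        then show ?thesis using s a False by (simp add: mid_def)
      qed
    qed
    moreover have "inj_on ?h (mid (s * u) (s * w))"
    proof (rule inj_onI)
      fix a b assume *: "a \<in> mid (s * u) (s * w)" "b \<in> mid (s * u) (s * w)" "?h a = ?h b"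
      then have "len a < len w" "len b < len w"
        using cov_len[of a "s * w"] cov_len[of b "s * w"] lw by (auto simp: mid_def)
      then have "w \<noteq> a" "w \<noteq> b" by auto
      then show "a = b" using *(3) by (simp split: if_splits)
    qed
    ultimately show ?thesis using ih card_image by metis
  qed
qed

lemma mid_other:
  assumes "cov u a" "cov a w" obtains b where "b \<noteq> a" "cov u b" "cov b w"
proof -
  have "ble u w" using assms cov_ble ble_trans by blast
  then have c: "card (mid u w) = 2" using card_mid assms cov_len by auto
  have "\<not> mid u w \<subseteq> {a}" using c card_mono[of "{a}" "mid u w"] by auto
  then show ?thesis using that by (auto simp: mid_def)
qed

lemma mid_unique:
  assumes "cov u a" "cov a w" "cov u b" "cov b w" "a \<noteq> b" "cov u c" "cov c w"
  shows "c = a \<or> c = b"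
proof -
  have "ble u w" using assms cov_ble ble_trans by blast
  then have c: "card (mid u w) = 2" using card_mid assms cov_len by auto
  then have "{a, b} = mid u w"
    using assms by (intro card_subset_eq) (auto simp: mid_def card_eq_0_iff intro: card_ge_0_finite)
  then show ?thesis using assms by (auto simp: mid_def)
qed

end

section \<open>Matchings of Bruhat intervals\<close>

context coxeter
begin

definition interval :: "'g \<Rightarrow> 'g \<Rightarrow> 'g set" where
  "interval u v = {x. ble u x \<and> ble x v}"

definition hasse_matching :: "'g set \<Rightarrow> ('g \<Rightarrow> 'g) \<Rightarrow> bool" where
  "hasse_matching I M \<longleftrightarrow> (\<forall>x\<in>I. M x \<in> I \<and> M (M x) = x \<and> (cov x (M x) \<or> cov (M x) x))"

definition preserves_adj :: "'g set \<Rightarrow> ('g \<Rightarrow> 'g) \<Rightarrow> bool" where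
  "preserves_adj I M \<longleftrightarrow> (\<forall>x\<in>I. \<forall>y\<in>I. adj x y \<longrightarrow> adj (M x) (M y))"

definition special :: "'g set \<Rightarrow> ('g \<Rightarrow> 'g) \<Rightarrow> bool" where
  "special I M \<longleftrightarrow> (\<forall>x\<in>I. \<forall>y\<in>I. cov x y \<longrightarrow> M x = y \<or> ble (M x) (M y) \<and> M x \<noteq> M y)"

definition bad :: "'g set \<Rightarrow> ('g \<Rightarrow> 'g) \<Rightarrow> 'g \<Rightarrow> 'g \<Rightarrow> bool" where
  "bad I M x y \<longleftrightarrow> x \<in> I \<and> y \<in> I \<and> cov x y \<and> cov x (M x) \<and> cov (M y) y \<and> M x \<noteq> y"

lemma hasse_matchingD:
  assumes "hasse_matching I M" "a \<in> I"
  shows "M a \<in> I" "M (M a) = a" "cov a (M a) \<or> cov (M a) a"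
  using assms unfolding hasse_matching_def by blast+

lemma interval_W: "x \<in> interval u v \<Longrightarrow> x \<in> W"
  by (auto simp: interval_def dest: ble_W)

lemma interval_between: "a \<in> interval u v \<Longrightarrow> b \<in> interval u v \<Longrightarrow> ble a x \<Longrightarrow> ble x b \<Longrightarrow> x \<in> interval u v"
  unfolding interval_def using ble_trans by blast

lemma bad_partner:
  assumes "hasse_matching I M" "preserves_adj I M" "bad I M x y"
  shows "cov (M y) (M x)" "M x \<in> I" "M y \<in> I" "M (M x) = x" "M (M y) = y" "x \<noteq> M y" "M x \<noteq> y"
proof -
  have I: "x \<in> I" "y \<in> I" "cov x y" "cov x (M x)" "cov (M y) y" "M x \<noteq> y"
    using assms(3) by (auto simp: bad_def)
  then show "M x \<in> I" "M y \<in> I" and M: "M (M x) = x" "M (M y) = y" "M x \<noteq> y"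
    using hasse_matchingD[OF assms(1)] by blast+
  then show "x \<noteq> M y" by metis
  have "adj (M x) (M y)" using assms(2) I cov_adj by (auto simp: preserves_adj_def)
  then show "cov (M y) (M x)" 
    using I cov_len[of x y] cov_len[of x "M x"] cov_len[of "M y" y] cov_W[of "M y" y]
    by (intro covI) (auto intro: adj_sym)
qed

end

text \<open>The interface to the two families of groups. \<open>K33\<close> and
  \<open>long_arrow\<close> carry a special matching to an edge-preserving one,
  \<open>no_bad\<close> serves the opposite direction, and \<open>long_arrow\<close> also identifies
  the covers.\<close>

locale bruhat_axioms = coxeter +
  assumes K33: "\<lbrakk>x \<in> W; z1 \<noteq> z2; w1 \<noteq> w2; x \<noteq> w1; x \<noteq> w2; adj x z1; adj x z2;
      adj z1 w1; adj z1 w2; adj z2 w1; adj z2 w2; adj w1 y; adj w2 y\<rbrakk> \<Longrightarrow> adj x y"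
    and long_arrow: "\<lbrakk>arrow x y; len y \<noteq> Suc (len x)\<rbrakk> \<Longrightarrow>
      \<exists>z1 z2 w1 w2. z1 \<noteq> z2 \<and> w1 \<noteq> w2 \<and> arrow x z1 \<and> arrow x z2 \<and>
        arrow z1 w1 \<and> arrow z1 w2 \<and> arrow z2 w1 \<and> arrow z2 w2 \<and> arrow w1 y \<and> arrow w2 y"
    and no_bad: "\<lbrakk>hasse_matching (interval u v) M; preserves_adj (interval u v) M\<rbrakk> \<Longrightarrow> \<not> bad (interval u v) M x y"
begin

text \<open>An arrow of length difference above one has an intermediate element by
  \<open>long_arrow\<close>, so poset covers and arrows of difference one coincide.\<close>

lemma cov_iff_cover:
  assumes "x \<in> interval u v" "y \<in> interval u v"
  shows "cov x y \<longleftrightarrow> ble x y \<and> x \<noteq> y \<and>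
    \<not> (\<exists>z\<in>interval u v. ble x z \<and> x \<noteq> z \<and> ble z y \<and> z \<noteq> y)" (is "_ \<longleftrightarrow> ?R")
proof
  assume c: "cov x y"
  have False if "ble x z" "x \<noteq> z" "ble z y" "z \<noteq> y" for z
    using that ble_len[of x z] ble_len[of z y] cov_len[OF c] by linarith
  then show ?R using c cov_len[OF c] cov_ble by auto
next
  assume R: ?R
  then obtain z where z: "arrow x z" "ble z y" using ble_first_arrow by blast
  then have "z \<in> interval u v" using interval_between assms arrow_ble by blast
  then have "z = y" using R z arrow_ble arrow_len by blast
  then have xy: "arrow x y" using z by simp
  have "len y = Suc (len x)"
  proof (rule ccontr)
    assume "len y \<noteq> Suc (len x)"
    then obtain z w where zw: "arrow x z" "arrow z w" "arrow w y" using long_arrow[OF xy] by blast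
    then have b: "ble x z" "ble z y" using arrow_ble ble_trans by blast+
    then have "z \<in> interval u v" using interval_between assms by blast
    moreover have "x \<noteq> z" "z \<noteq> y" using zw arrow_len[of x z] arrow_len[of z w] arrow_len[of w y] by auto
    ultimately show False using R b by blast
  qed
  then show "cov x y" using xy by (simp add: cov_def)
qed

lemma preserves_adj_imp_special:
  assumes hm: "hasse_matching (interval u v) M" and ad: "preserves_adj (interval u v) M"
  shows "special (interval u v) M"
  unfolding special_def
proof (intro ballI impI)
  fix x y assume I: "x \<in> interval u v" "y \<in> interval u v" and c: "cov x y"
  have MI: "M x \<in> interval u v" "M y \<in> interval u v" using hasse_matchingD[OF hm] I by blast+
  have adjM: "adj (M x) (M y)" using ad I c cov_adj by (auto simp: preserves_adj_def)
  show "M x = y \<or> ble (M x) (M y) \<and> M x \<noteq> M y"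
  proof (cases "arrow (M x) (M y)")
    case True
    then show ?thesis using arrow_ble[OF True] arrow_len[OF True] by auto
  next
    case False
    then have a: "arrow (M y) (M x)" using adj_arrow[OF adjM] interval_W MI by blast
    have "cov x (M x) \<or> cov (M x) x" "cov y (M y) \<or> cov (M y) y"
      using hasse_matchingD[OF hm] I by blast+
    \<comment> \<open>\<open>M\<close> changes lengths by one, so it can reverse the cover only by
      moving \<open>x\<close> up and \<open>y\<close> down.\<close>
    then have "cov x (M x)" "cov (M y) y"
      using arrow_len[OF a] cov_len[OF c] cov_len[of x "M x"] cov_len[of "M x" x]
        cov_len[of y "M y"] cov_len[of "M y" y] by auto
    then have "M x = y" using no_bad[OF hm ad, of x y] I c by (auto simp: bad_def)
    then show ?thesis ..
  qed
qed

lemma special_imp_cover_edge: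
  assumes hm: "hasse_matching (interval u v) M" and sp: "special (interval u v) M"
    and I: "x \<in> interval u v" "y \<in> interval u v" and c: "cov x y"
  shows "adj (M x) (M y)"
proof (cases "M x = y")
  case True
  then show ?thesis using hasse_matchingD(2)[OF hm I(1)] adj_sym[OF cov_adj[OF c]] by simp
next
  case neq: False
  have hmD: "M a \<in> interval u v" "M (M a) = a" "cov a (M a) \<or> cov (M a) a" if "a \<in> interval u v" for a
    using hasse_matchingD[OF hm that] by auto
  have spD: "M a = b \<or> ble (M a) (M b) \<and> M a \<noteq> M b" if "a \<in> interval u v" "b \<in> interval u v" "cov a b" for a b
    using sp that unfolding special_def by blast
  have b: "ble (M x) (M y)" "M x \<noteq> M y" using spD[OF I c] neq by auto
  have W: "x \<in> W" "y \<in> W" "M x \<in> W" "M y \<in> W" using hmD(1) I interval_W by blast+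
  show ?thesis
  proof (cases "len (M y) = Suc (len (M x))")
    case True
    then show ?thesis using ble_Suc_cov b cov_adj by blast
  next
    case False
    have less: "len (M x) < len (M y)" using ble_len[OF b(1)] b(2) by linarith
    then have x0: "cov (M x) x" and y1: "cov y (M y)"
      using False hmD(3)[OF I(1)] hmD(3)[OF I(2)] cov_len[OF c] cov_len[of x "M x"] cov_len[of "M x" x]
        cov_len[of y "M y"] cov_len[of "M y" y] by auto
    \<comment> \<open>The remaining case has \<open>M x\<close> below \<open>x\<close> and
      \<open>M y\<close> above \<open>y\<close>, a difference of three. The other midpoint
      \<open>a\<close> of \<open>M x\<close> and \<open>y\<close> is forced to be matched upwards
      between \<open>x\<close> and \<open>M y\<close>, so that \<open>M x\<close>; \<open>x\<close>,
      \<open>a\<close>; \<open>y\<close>, \<open>M a\<close>; \<open>M y\<close> is the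
      configuration of \<open>K33\<close>.\<close>
    obtain a where a: "a \<noteq> x" "cov (M x) a" "cov a y" using mid_other[OF x0 c] by blast
    have aI: "a \<in> interval u v" using interval_between[OF hmD(1)[OF I(1)] I(2)] a cov_ble by blast
    have xa: "ble x (M a)" "x \<noteq> M a" using spD[OF hmD(1)[OF I(1)] aI a(2)] hmD(2)[OF I(1)] a(1) by auto
    have "M a \<noteq> y" using hmD(2)[OF aI] cov_len[OF y1] cov_len[OF a(3)] by auto
    then have ay: "ble (M a) (M y)" "M a \<noteq> M y" using spD[OF aI I(2) a(3)] by auto
    have "len x < len (M a)" using ble_len[OF xa(1)] xa(2) by linarith
    then have aMa: "cov a (M a)" using hmD(3)[OF aI] cov_len[OF x0] cov_len[OF a(2)] cov_len[of "M a" a] by auto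
    have xMa: "cov x (M a)" using xa cov_len[OF x0] cov_len[OF a(2)] cov_len[OF aMa] by (intro ble_Suc_cov) auto
    have May: "cov (M a) (M y)" using ay cov_len[OF a(3)] cov_len[OF aMa] cov_len[OF y1] by (intro ble_Suc_cov) auto
    have "len (M x) < len y" "len (M x) < len (M a)" using cov_len[OF x0] cov_len[OF c] cov_len[OF xMa] by linarith+
    then have "M x \<noteq> y" "M x \<noteq> M a" by auto
    then show ?thesis
      using K33[OF W(3) a(1)[symmetric] \<open>M a \<noteq> y\<close>[symmetric] _ _ cov_adj[OF x0] cov_adj[OF a(2)] cov_adj[OF c]
        cov_adj[OF xMa] cov_adj[OF a(3)] cov_adj[OF aMa] cov_adj[OF y1] cov_adj[OF May]] by auto
  qed
qed

lemma special_imp_preserves_adj: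
  assumes hm: "hasse_matching (interval u v) M" and sp: "special (interval u v) M"
  shows "preserves_adj (interval u v) M"
proof -
  have inj: "M a \<noteq> M b" if "a \<in> interval u v" "b \<in> interval u v" "a \<noteq> b" for a b
    using hm that unfolding hasse_matching_def by metis
  have arr: "adj (M x) (M y)" if "x \<in> interval u v" "y \<in> interval u v" "arrow x y" for x y
    using that
  proof (induction "len y - len x" arbitrary: x y rule: less_induct)
    case less
    show ?case
    proof (cases "len y = Suc (len x)")
      case True
      then show ?thesis using special_imp_cover_edge[OF hm sp] less.prems by (auto simp: cov_def)
    next
      case False
      obtain z1 z2 w1 w2 where d: "z1 \<noteq> z2" "w1 \<noteq> w2" and a: "arrow x z1" "arrow x z2"
        "arrow z1 w1" "arrow z1 w2" "arrow z2 w1" "arrow z2 w2" "arrow w1 y" "arrow w2 y"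
        using long_arrow[OF less.prems(3) False] by blast
      have b: "ble x z1" "ble x z2" "ble z1 w1" "ble z1 w2" "ble z2 w1" "ble z2 w2" "ble w1 y" "ble w2 y"
        using a arrow_ble by auto
      then have b': "ble z1 y" "ble z2 y" "ble x w1" "ble x w2" using ble_trans by blast+
      have I: "z1 \<in> interval u v" "z2 \<in> interval u v" "w1 \<in> interval u v" "w2 \<in> interval u v"
        using interval_between[OF less.prems(1,2)] b b' by auto
      have l: "len x < len z1" "len x < len z2" "len z1 < len w1" "len z2 < len w2" "len w1 < len y" "len w2 < len y"
        "len z1 < len w2" "len z2 < len w1"
        using a arrow_len by auto
      have ne: "x \<noteq> w1" "x \<noteq> w2" using l by auto
      have "M x \<in> W" using hasse_matchingD(1)[OF hm less.prems(1)] interval_W by blast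
      then show ?thesis
        by (rule K33[of "M x" "M z1" "M z2" "M w1" "M w2"])
          (use inj[OF I(1,2) d(1)] inj[OF I(3,4) d(2)] inj[OF less.prems(1) I(3) ne(1)]
            inj[OF less.prems(1) I(4) ne(2)] I less.prems(1,2) l in \<open>auto intro!: less.hyps a\<close>)
    qed
  qed
  show ?thesis unfolding preserves_adj_def
    using arr adj_arrow adj_sym interval_W by metis
qed

theorem special_iff_preserves_adj:
  "hasse_matching (interval u v) M \<Longrightarrow> special (interval u v) M \<longleftrightarrow> preserves_adj (interval u v) M"
  using special_imp_preserves_adj preserves_adj_imp_special by blast

end

section \<open>Symmetric groups\<close>

lemma transpose_comp_moved:
  assumes "a \<noteq> b" "c \<noteq> d" "transpose a b \<noteq> transpose c d"
  shows "{i. (transpose a b \<circ> transpose c d) i \<noteq> i} = {a, b, c, d}"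
proof -
  have "\<not> (a = c \<and> b = d)" "\<not> (a = d \<and> b = c)" using assms by (auto simp: transpose_commute)
  then show ?thesis using assms(1,2) by (auto simp: transpose_def)
qed

lemma transpose_comp_eq_id: "transpose a b \<circ> transpose c d = id \<longleftrightarrow> transpose a b = transpose c d"
  by (metis comp_assoc comp_id transpose_comp_involutory)

text \<open>If \<open>(a b)(e f) = (c d)(g h)\<close>, the two middle vertices of the resulting square differ by \<open>(c d)(a b) = (g h)(e f)\<close>.\<close>

lemma transpose_square:
  assumes ne: "a \<noteq> b" "c \<noteq> d" "e \<noteq> f" "g \<noteq> h"
    and d: "transpose a b \<noteq> transpose c d" "transpose e f \<noteq> transpose a b"
    and eq: "transpose a b \<circ> transpose e f = transpose c d \<circ> transpose g h"
  shows "{a, b, c, d} = {e, f, g, h}"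
    and "{a, b} \<inter> {c, d} = {} \<Longrightarrow> transpose e f = transpose c d"
proof -
  have eq': "transpose c d \<circ> transpose a b = transpose g h \<circ> transpose e f"
  proof -
    have "transpose c d \<circ> transpose a b = transpose c d \<circ> (transpose a b \<circ> transpose e f) \<circ> transpose e f"
      by (simp add: comp_assoc)
    also have "\<dots> = transpose g h \<circ> transpose e f"
      unfolding eq by (simp flip: comp_assoc)
    finally show ?thesis .
  qed
  have d': "transpose g h \<noteq> transpose e f"
    using eq' d(1) transpose_comp_eq_id by metis
  have "{c, d, a, b} = {g, h, e, f}"
    using transpose_comp_moved[OF ne(2,1) d(1)[symmetric]] transpose_comp_moved[OF ne(4,3) d'] eq' by simp
  then show P: "{a, b, c, d} = {e, f, g, h}" by (simp add: insert_commute)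
  \<comment> \<open>For disjoint supports the product is a double transposition, which determines
    its factors up to order; \<open>transpose e f\<close> is not \<open>transpose a b\<close>, so it
    is the other factor.\<close>
  assume dis: "{a, b} \<inter> {c, d} = {}"
  have v: "(transpose g h \<circ> transpose e f) a = b" "(transpose g h \<circ> transpose e f) c = d"
    using dis ne unfolding eq'[symmetric] by (auto simp: transpose_def)
  have "card {a, b, c, d} = 4" using dis ne by auto
  then have c4: "card {e, f, g, h} = 4" using P by simp
  have dis': "{e, f} \<inter> {g, h} = {}"
  proof (rule ccontr)
    assume "{e, f} \<inter> {g, h} \<noteq> {}"
    then have "card {e, f, g, h} \<le> 3" by (auto simp: card_insert_if)
    then show False using c4 by simp
  qed
  consider "a \<in> {e, f}" | "c \<in> {e, f}" "a \<in> {g, h}" | "a \<in> {g, h}" "c \<in> {g, h}" using P by blast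
  then show "transpose e f = transpose c d"
  proof cases
    case 1
    then have "{a, b} = {e, f}" using v(1) dis' by (auto simp: transpose_def split: if_splits)
    then have "transpose a b = transpose e f" by (auto simp: doubleton_eq_iff transpose_commute)
    then show ?thesis using d by simp
  next
    case 2
    then have "{c, d} = {e, f}" using v(2) dis' by (auto simp: transpose_def split: if_splits)
    then show ?thesis by (auto simp: doubleton_eq_iff transpose_commute)
  next
    case 3
    then have "{a, b} = {g, h}" "{c, d} = {g, h}" using v dis' by (auto simp: transpose_def split: if_splits)
    then show ?thesis using dis ne by auto
  qed
qed

section \<open>Transpositions of three points\<close>

definition transps :: "'b \<Rightarrow> 'b \<Rightarrow> 'b \<Rightarrow> ('b \<Rightarrow> 'b) set" where
  "transps p q r = {transpose p q, transpose q r, transpose p r}"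

lemma transps_iff:
  assumes "a \<noteq> b" "distinct [p, q, r]"
  shows "{a, b} \<subseteq> {p, q, r} \<longleftrightarrow> transpose a b \<in> transps p q r"
proof
  assume "{a, b} \<subseteq> {p, q, r}"
  then show "transpose a b \<in> transps p q r" using assms by (auto simp: transps_def transpose_commute)
next
  assume "transpose a b \<in> transps p q r"
  then obtain c d where cd: "c \<in> {p,q,r}" "d \<in> {p,q,r}" "transpose a b = transpose c d" by (auto simp: transps_def)
  have "{i. transpose a b i \<noteq> i} = {a, b}" "{i. transpose c d i \<noteq> i} \<subseteq> {c, d}"
    using assms by (auto simp: transpose_def)
  then show "{a, b} \<subseteq> {p, q, r}" using cd by auto
qed

lemma transps_rel:
  assumes "distinct [p, q, r]"
  shows "transpose q r \<circ> transpose p q = transpose p q \<circ> transpose p r"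
    "transpose p r \<circ> transpose p q = transpose p q \<circ> transpose q r"
    "transpose p r \<circ> transpose q r = transpose p q \<circ> transpose p r"
    "transpose q r \<circ> transpose p r = transpose p q \<circ> transpose q r"
  using assms by (auto simp: fun_eq_iff transpose_def)

text \<open>A product of three odd permutations of three points is odd, hence a
  transposition.\<close>

lemma transps_comp3:
  assumes d: "distinct [p, q, r]" and abc: "a \<in> transps p q r" "b \<in> transps p q r" "c \<in> transps p q r"
  shows "a \<circ> b \<circ> c \<in> transps p q r"
proof -
  have inv: "x \<circ> x = id" if "x \<in> transps p q r" for x using that by (auto simp: transps_def)
  have tc: "transpose q p = transpose p q" "transpose r q = transpose q r" "transpose r p = transpose p r"
    by (simp_all add: transpose_commute)
  have d': "q \<noteq> p" "r \<noteq> p" "r \<noteq> q" using d by auto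
  note t3 = transpose_comp_triple[of p r q] transpose_comp_triple[of q r p] transpose_comp_triple[of r p q]
    transpose_comp_triple[of q p r] transpose_comp_triple[of r q p] transpose_comp_triple[of p q r]
  have conj: "x \<circ> y \<circ> x \<in> transps p q r" if "x \<in> transps p q r" "y \<in> transps p q r" for x y
    using that t3 d d' inv[of x] unfolding transps_def tc by (elim insertE) (simp_all add: tc)
  have e: "transpose p q \<circ> transpose q r \<circ> transpose p r = transpose q r"
    "transpose p r \<circ> transpose q r \<circ> transpose p q = transpose q r"
    "transpose q r \<circ> transpose p q \<circ> transpose p r = transpose p q"
    "transpose p r \<circ> transpose p q \<circ> transpose q r = transpose p q"
    "transpose p q \<circ> transpose p r \<circ> transpose q r = transpose p r"
    "transpose q r \<circ> transpose p r \<circ> transpose p q = transpose p r"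
    by (rule ext, use d d' in \<open>auto simp: transpose_def\<close>)+
  have third: "x \<circ> y \<circ> z = y" if "x \<in> transps p q r" "y \<in> transps p q r" "z \<in> transps p q r"
    "x \<noteq> y" "y \<noteq> z" "x \<noteq> z" for x y z
    using that unfolding transps_def by (elim insertE emptyE) (simp_all add: e)
  consider "a = b" | "b = c" | "a = c" | "a \<noteq> b" "b \<noteq> c" "a \<noteq> c" by blast
  then show ?thesis
  proof cases
    case 1 then show ?thesis using abc inv by simp
  next
    case 2 then show ?thesis using abc inv by (simp add: comp_assoc)
  next
    case 3 then show ?thesis using abc conj by simp
  next
    case 4 then show ?thesis using third abc by simp
  qed
qed

text \<open>With this order of composition, left multiplication permutes values and right
  multiplication permutes positions. Edges are described by positions from here on.\<close>

locale symmetric_coxeter = coxeter S m for S :: "'g::grp set" and m +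
  fixes n :: nat and \<sigma> :: "'g \<Rightarrow> nat \<Rightarrow> nat"
  assumes hom: "\<lbrakk>x \<in> W; y \<in> W\<rbrakk> \<Longrightarrow> \<sigma> (x * y) = \<sigma> x \<circ> \<sigma> y"
    and perm: "x \<in> W \<Longrightarrow> \<sigma> x permutes {1..n}"
    and inj: "inj_on \<sigma> W"
    and surj: "p permutes {1..n} \<Longrightarrow> \<exists>x\<in>W. \<sigma> x = p"
    and gens: "\<sigma> ` S = {transpose i (Suc i) | i. 1 \<le> i \<and> i < n}"
begin

lemma sigma_eq_iff: "x \<in> W \<Longrightarrow> y \<in> W \<Longrightarrow> \<sigma> x = \<sigma> y \<longleftrightarrow> x = y"
  using inj by (auto simp: inj_on_def)

lemma sigma_inj [simp]: "x \<in> W \<Longrightarrow> \<sigma> x a = \<sigma> x b \<longleftrightarrow> a = b"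
  using permutes_inj[OF perm] by (auto dest: injD)

lemma sigma_one: "\<sigma> 1 = id"
proof -
  have "\<sigma> 1 (\<sigma> 1 a) = \<sigma> 1 a" for a using hom[of 1 1] by (metis W_one comp_apply mult_1)
  then show ?thesis by (simp add: fun_eq_iff)
qed

lemma sigma_ginv: "x \<in> W \<Longrightarrow> \<sigma> x \<circ> \<sigma> (ginv x) = id" "x \<in> W \<Longrightarrow> \<sigma> (ginv x) \<circ> \<sigma> x = id"
  using hom[of x "ginv x"] hom[of "ginv x" x] by (simp_all add: sigma_one)

lemma sigma_range: "x \<in> W \<Longrightarrow> \<sigma> x a \<in> {1..n} \<longleftrightarrow> a \<in> {1..n}"
  using permutes_in_image[OF perm] .

lemma gen_cases:
  assumes "s \<in> S" obtains i where "1 \<le> i" "i < n" "\<sigma> s = transpose i (Suc i)"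
proof -
  have "\<sigma> s \<in> \<sigma> ` S" using assms by (rule imageI)
  then show ?thesis using that unfolding gens by blast
qed

lemma gen_exists: "1 \<le> i \<Longrightarrow> i < n \<Longrightarrow> \<exists>s\<in>S. \<sigma> s = transpose i (Suc i)"
proof -
  assume "1 \<le> i" "i < n"
  then have "transpose i (Suc i) \<in> \<sigma> ` S" unfolding gens by blast
  then show ?thesis by force
qed

lemma transpose_conj:
  "x \<in> W \<Longrightarrow> \<sigma> x \<circ> transpose a b = transpose (\<sigma> x a) (\<sigma> x b) \<circ> \<sigma> x"
  by (auto simp: fun_eq_iff transpose_def)

lemma sigma_T:
  assumes "t \<in> T" shows "\<exists>a b. a \<in> {1..n} \<and> b \<in> {1..n} \<and> a \<noteq> b \<and> \<sigma> t = transpose a b"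
proof -
  obtain x s where x: "x \<in> W" "s \<in> S" "t = x * s * ginv x" using T_cases assms by metis
  obtain i where i: "1 \<le> i" "i < n" "\<sigma> s = transpose i (Suc i)" using gen_cases x by metis
  have "\<sigma> t = \<sigma> x \<circ> transpose i (Suc i) \<circ> \<sigma> (ginv x)" using x i by (simp add: hom)
  also have "\<dots> = transpose (\<sigma> x i) (\<sigma> x (Suc i)) \<circ> (\<sigma> x \<circ> \<sigma> (ginv x))"
    unfolding transpose_conj[OF x(1)] by (simp add: comp_assoc)
  finally have "\<sigma> t = transpose (\<sigma> x i) (\<sigma> x (Suc i))" using sigma_ginv x by simp
  moreover have "\<sigma> x i \<in> {1..n}" "\<sigma> x (Suc i) \<in> {1..n}"
    using i sigma_range[OF x(1), of i] sigma_range[OF x(1), of "Suc i"] by auto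
  ultimately show ?thesis using x by (metis n_not_Suc_n sigma_inj)
qed

lemma transposition_exists:
  assumes "a \<in> {1..n}" "b \<in> {1..n}" "a < b"
  shows "\<exists>t\<in>T. \<sigma> t = transpose a b"
proof -
  obtain s where s: "s \<in> S" "\<sigma> s = transpose a (Suc a)" using gen_exists[of a] assms by auto
  have "transpose b (Suc a) permutes {1..n}" using assms by (intro permutes_swap_id) auto
  then obtain x where x: "x \<in> W" "\<sigma> x = transpose b (Suc a)" using surj by blast
  have "\<sigma> (x * s * ginv x) = \<sigma> x \<circ> transpose a (Suc a) \<circ> \<sigma> (ginv x)" using x s by (simp add: hom)
  also have "\<dots> = transpose (\<sigma> x a) (\<sigma> x (Suc a)) \<circ> (\<sigma> x \<circ> \<sigma> (ginv x))"
    unfolding transpose_conj[OF x(1)] by (simp add: comp_assoc)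
  finally have "\<sigma> (x * s * ginv x) = transpose (\<sigma> x a) (\<sigma> x (Suc a))"
    unfolding sigma_ginv(1)[OF x(1)] by simp
  moreover have "\<sigma> x a = a" "\<sigma> x (Suc a) = b" using x assms by (auto simp: transpose_def)
  ultimately have "\<sigma> (x * s * ginv x) = transpose a b" by simp
  moreover have "x * s * ginv x \<in> T" using s x by simp
  ultimately show ?thesis by blast
qed

lemma adj_transpose:
  assumes "adj x y" "x \<in> W"
  obtains a b where "a \<in> {1..n}" "b \<in> {1..n}" "a < b" "\<sigma> y = \<sigma> x \<circ> transpose a b"
proof -
  obtain t where t: "t \<in> T" "y = t * x" using assms by (auto simp: adj_def)
  have t': "ginv x * t * x \<in> T" using t assms by simp
  have y: "y = x * (ginv x * t * x)" using t by (simp add: mult.assoc)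
  obtain a b where ab: "a \<in> {1..n}" "b \<in> {1..n}" "a \<noteq> b" "\<sigma> (ginv x * t * x) = transpose a b"
    using sigma_T[OF t'] by blast
  have "\<sigma> y = \<sigma> x \<circ> transpose a b" unfolding y using hom[OF assms(2) T_W[OF t']] ab(4) by simp
  then show ?thesis using that[of a b] that[of b a] ab
    by (cases "a < b") (auto simp: transpose_commute)
qed

lemma swap_exists:
  assumes "x \<in> W" "a \<in> {1..n}" "b \<in> {1..n}" "a < b"
  obtains y where "y \<in> W" "\<sigma> y = \<sigma> x \<circ> transpose a b" "adj x y"
proof -
  obtain t where t: "t \<in> T" "\<sigma> t = transpose a b" using transposition_exists assms by blast
  have "adj x (x * t)" using t assms by (simp add: adj_iff)
  then show ?thesis using that[of "x * t"] t assms by (simp add: hom)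
qed

lemma transpose_imp_adj:
  assumes "x \<in> W" "y \<in> W" "a \<in> {1..n}" "b \<in> {1..n}" "a < b" "\<sigma> y = \<sigma> x \<circ> transpose a b"
  shows "adj x y"
proof -
  obtain z where "z \<in> W" "\<sigma> z = \<sigma> x \<circ> transpose a b" "adj x z"
    using swap_exists[OF assms(1,3,4,5)] .
  then show ?thesis using sigma_eq_iff[of y z] assms by simp
qed

text \<open>Swapping two positions goes up exactly when it creates an inversion. In the induction,
  left multiplication by a generator exchanges the values \<open>i\<close> and \<open>Suc i\<close>;
  this reverses the order of the two entries only if they are these values, and then the edge is the
  \<open>s\<close>-edge itself.\<close>

lemma arrow_iff:
  assumes "x \<in> W" "y \<in> W" "a \<in> {1..n}" "b \<in> {1..n}" "a < b" "\<sigma> y = \<sigma> x \<circ> transpose a b"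
  shows "arrow x y \<longleftrightarrow> \<sigma> x a < \<sigma> x b"
  using assms(1,2,6)
proof (induction x arbitrary: y rule: W_left_induct)
  case one
  then have "adj 1 y" using transpose_imp_adj assms by blast
  moreover have "y \<noteq> 1" using \<open>adj 1 y\<close> by auto
  ultimately have "arrow 1 y" using one by (intro arrowI) (auto intro!: gr0I)
  then show ?case using assms by (simp add: sigma_one)
next
  case (gen s x)
  note g = gen.hyps gen.prems(1)
  obtain i where i: "1 \<le> i" "i < n" "\<sigma> s = transpose i (Suc i)" by (rule gen_cases[OF g(1)])
  have sy: "s * y \<in> W" using g by simp
  have e: "\<sigma> (s * y) = \<sigma> x \<circ> transpose a b"
    using hom[of s y] hom[of s "s * x"] g gen.prems(2) by (simp add: comp_def)
  have IH: "arrow x (s * y) \<longleftrightarrow> \<sigma> x a < \<sigma> x b" using gen.IH[OF sy e] .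
  have ne: "\<sigma> x a \<noteq> \<sigma> x b" using g assms by simp
  have v: "\<sigma> (s * x) c = transpose i (Suc i) (\<sigma> x c)" for c using hom g i by simp
  have ad: "adj x (s * y)" using transpose_imp_adj[of x "s * y"] g sy assms e by blast
  show ?case
  proof (cases "s * y = s * x")
    case True
    then have yx: "y = x" by simp
    have up: "arrow x (s * x)" using g len_not_dl[of x s] by (intro arrowI) auto
    have "\<not> arrow (s * x) y" using arrow_len[OF up] arrow_len[of "s * x" x] yx by auto
    moreover have "\<sigma> (s * x) a = \<sigma> x b" "\<sigma> (s * x) b = \<sigma> x a"
      using e True by (auto simp: fun_eq_iff transpose_def split: if_splits)
    moreover have "\<sigma> x a < \<sigma> x b" using IH up True by simp
    ultimately show ?thesis by simp
  next
    case False
    have "arrow x (s * y) \<longleftrightarrow> arrow (s * x) y"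
    proof
      assume "arrow x (s * y)"
      then have "arrow (s * x) (s * (s * y))" using arrow_gen_mult[of x "s * y" s] g False by simp
      then show "arrow (s * x) y" using g by simp
    next
      assume "arrow (s * x) y"
      moreover have "y \<noteq> s * (s * x)" using False g by auto
      ultimately have "arrow (s * (s * x)) (s * y)" using arrow_gen_mult[of "s * x" y s] g by blast
      then show "arrow x (s * y)" using g by simp
    qed
    moreover have "\<not> (\<sigma> x a = i \<and> \<sigma> x b = Suc i)" "\<not> (\<sigma> x a = Suc i \<and> \<sigma> x b = i)"
    proof -
      have "\<sigma> (s * y) = \<sigma> (s * x)" if "{\<sigma> x a, \<sigma> x b} = {i, Suc i}"
      proof -
        have "transpose (\<sigma> x a) (\<sigma> x b) = transpose i (Suc i)"
          using that by (auto simp: doubleton_eq_iff transpose_commute)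
        then show ?thesis using e transpose_conj[of x a b] hom[of s x] g i by simp
      qed
      then show "\<not> (\<sigma> x a = i \<and> \<sigma> x b = Suc i)" "\<not> (\<sigma> x a = Suc i \<and> \<sigma> x b = i)"
        using False sigma_eq_iff g by (auto simp: doubleton_eq_iff)
    qed
    moreover from this have "\<sigma> (s * x) a < \<sigma> (s * x) b \<longleftrightarrow> \<sigma> x a < \<sigma> x b"
      using ne unfolding v by (auto simp: transpose_def)
    ultimately show ?thesis using IH by simp
  qed
qed

text \<open>Right multiplication by the adjacent transposition of \<open>b - 1\<close> and
  \<open>b\<close> narrows the gap. With no intermediate value at \<open>b - 1\<close>, that
  position compares with \<open>b\<close> in the same way in \<open>x\<close> and in
  \<open>y\<close>, so both lengths change by the same amount.\<close>

lemma no_between_imp_len: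
  assumes "x \<in> W" "y \<in> W" "a \<in> {1..n}" "b \<in> {1..n}" "a < b" "\<sigma> y = \<sigma> x \<circ> transpose a b"
    "\<sigma> x a < \<sigma> x b" "\<And>c. a < c \<Longrightarrow> c < b \<Longrightarrow> \<not> (\<sigma> x a < \<sigma> x c \<and> \<sigma> x c < \<sigma> x b)"
  shows "len y = Suc (len x)"
  using assms
proof (induction "b - a" arbitrary: x y b rule: less_induct)
  case less
  have xy: "arrow x y" using arrow_iff[OF less.prems(1-6)] less.prems by simp
  define c where "c = b - 1"
  have c: "b = Suc c" "1 \<le> c" "c < n" using less.prems by (auto simp: c_def)
  obtain s where s: "s \<in> S" "\<sigma> s = transpose c b" using gen_exists[of c] c by auto
  show ?case
  proof (cases "a = c")
    case True
    then have "\<sigma> y = \<sigma> (x * s)" using less.prems s hom by simp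
    then have "y = x * s" using sigma_eq_iff less.prems s by simp
    then show ?thesis using arrow_len[OF xy] len_not_dr[of x s] less.prems s by (auto simp: dr_def)
  next
    case False
    then have ac: "a < c" "c < b" using c less.prems by auto
    have cr: "c \<in> {1..n}" using c by auto
    have xs: "\<sigma> (x * s) = \<sigma> x \<circ> transpose c b" and ys: "\<sigma> (y * s) = \<sigma> y \<circ> transpose c b"
      using hom less.prems s by auto
    have e: "\<sigma> (y * s) = \<sigma> (x * s) \<circ> transpose a c"
      unfolding xs ys less.prems(6) using ac by (auto simp: fun_eq_iff transpose_def)
    have "len (y * s) = Suc (len (x * s))"
    proof (rule less.hyps[OF _ _ _ less.prems(3) cr ac(1) e])
      show "c - a < b - a" using ac by simp
      show "x * s \<in> W" "y * s \<in> W" using less.prems s by auto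
      show "\<sigma> (x * s) a < \<sigma> (x * s) c" using less.prems(7) ac unfolding xs by (simp add: transpose_def)
      show "\<not> (\<sigma> (x * s) a < \<sigma> (x * s) d \<and> \<sigma> (x * s) d < \<sigma> (x * s) c)" if "a < d" "d < c" for d
        using less.prems(8)[of d] that ac unfolding xs by (simp add: transpose_def)
    qed
    moreover have "arrow x (x * s) \<longleftrightarrow> \<sigma> x c < \<sigma> x b"
      using arrow_iff[OF less.prems(1) _ cr less.prems(4) ac(2) xs] less.prems s by simp
    moreover have "arrow y (y * s) \<longleftrightarrow> \<sigma> y c < \<sigma> y b"
      using arrow_iff[OF less.prems(2) _ cr less.prems(4) ac(2) ys] less.prems s by simp
    moreover have "\<sigma> x c < \<sigma> x b \<longleftrightarrow> \<sigma> y c < \<sigma> y b"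
    proof -
      have "\<sigma> x c \<noteq> \<sigma> x a" "\<sigma> x c \<noteq> \<sigma> x b" using less.prems(1) ac by auto
      then show ?thesis using less.prems(7) less.prems(8)[OF ac] ac unfolding less.prems(6)
        by (auto simp: transpose_def)
    qed
    moreover have "arrow z (z * s) \<longleftrightarrow> \<not> dr s z" if "z \<in> W" for z
      using that s len_not_dr[of z s] by (auto simp: arrow_def dr_def adj_iff)
    ultimately have "dr s x \<longleftrightarrow> dr s y" using less.prems by blast
    then show ?thesis using \<open>len (y * s) = Suc (len (x * s))\<close> len_dr[of x s] len_dr[of y s]
        len_not_dr[of x s] len_not_dr[of y s] less.prems s by (cases "dr s x") auto
  qed
qed

text \<open>A position \<open>c\<close> with intermediate value makes \<open>x\<close> increasing
  and \<open>y\<close> decreasing on \<open>a\<close>, \<open>c\<close>, \<open>b\<close>. These are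
  bottom and top of a copy of S_3, and the four elements are its two middle ranks.\<close>

lemma symmetric_long_arrow:
  assumes xy: "arrow x y" and long: "len y \<noteq> Suc (len x)"
  shows "\<exists>z1 z2 w1 w2. z1 \<noteq> z2 \<and> w1 \<noteq> w2 \<and> arrow x z1 \<and> arrow x z2 \<and>
    arrow z1 w1 \<and> arrow z1 w2 \<and> arrow z2 w1 \<and> arrow z2 w2 \<and> arrow w1 y \<and> arrow w2 y"
proof -
  have W: "x \<in> W" "y \<in> W" using arrow_W[OF xy] by auto
  obtain a b where ab: "a \<in> {1..n}" "b \<in> {1..n}" "a < b" "\<sigma> y = \<sigma> x \<circ> transpose a b"
    using adj_transpose[OF arrow_adj[OF xy] W(1)] .
  have lt: "\<sigma> x a < \<sigma> x b" using arrow_iff[OF W ab] xy by simp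
  obtain c where c: "a < c" "c < b" "\<sigma> x a < \<sigma> x c" "\<sigma> x c < \<sigma> x b"
    using no_between_imp_len[OF W ab lt] long by blast
  have cr: "c \<in> {1..n}" using ab c by auto
  obtain z1 where z1: "z1 \<in> W" "\<sigma> z1 = \<sigma> x \<circ> transpose a c" using swap_exists[OF W(1) ab(1) cr c(1)] .
  obtain z2 where z2: "z2 \<in> W" "\<sigma> z2 = \<sigma> x \<circ> transpose c b" using swap_exists[OF W(1) cr ab(2) c(2)] .
  obtain w1 where w1: "w1 \<in> W" "\<sigma> w1 = \<sigma> z1 \<circ> transpose c b" using swap_exists[OF z1(1) cr ab(2) c(2)] .
  obtain w2 where w2: "w2 \<in> W" "\<sigma> w2 = \<sigma> z1 \<circ> transpose a b" using swap_exists[OF z1(1) ab(1-3)] .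
  have v: "\<sigma> z1 a = \<sigma> x c" "\<sigma> z1 c = \<sigma> x a" "\<sigma> z1 b = \<sigma> x b"
    "\<sigma> z2 a = \<sigma> x a" "\<sigma> z2 c = \<sigma> x b" "\<sigma> z2 b = \<sigma> x c"
    "\<sigma> w1 a = \<sigma> x c" "\<sigma> w1 c = \<sigma> x b" "\<sigma> w1 b = \<sigma> x a"
    "\<sigma> w2 a = \<sigma> x b" "\<sigma> w2 c = \<sigma> x a" "\<sigma> w2 b = \<sigma> x c"
    using c unfolding z1 z2 w1 w2 by (auto simp: transpose_def)
  have e: "\<sigma> w1 = \<sigma> z2 \<circ> transpose a b" "\<sigma> w2 = \<sigma> z2 \<circ> transpose a c"
    "\<sigma> y = \<sigma> w1 \<circ> transpose a c" "\<sigma> y = \<sigma> w2 \<circ> transpose c b"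
    using c unfolding w1 w2 z1 z2 ab(4) by (auto simp: fun_eq_iff transpose_def)
  have "arrow x z1" using arrow_iff[OF W(1) z1(1) ab(1) cr c(1) z1(2)] c v by simp
  moreover have "arrow x z2" using arrow_iff[OF W(1) z2(1) cr ab(2) c(2) z2(2)] c v by simp
  moreover have "arrow z1 w1" using arrow_iff[OF z1(1) w1(1) cr ab(2) c(2) w1(2)] c v lt by simp
  moreover have "arrow z1 w2" using arrow_iff[OF z1(1) w2(1) ab(1-3) w2(2)] c v lt by simp
  moreover have "arrow z2 w1" using arrow_iff[OF z2(1) w1(1) ab(1-3) e(1)] c v lt by simp
  moreover have "arrow z2 w2" using arrow_iff[OF z2(1) w2(1) ab(1) cr c(1) e(2)] c v lt by simp
  moreover have "arrow w1 y" using arrow_iff[OF w1(1) W(2) ab(1) cr c(1) e(3)] c v lt by simp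
  moreover have "arrow w2 y" using arrow_iff[OF w2(1) W(2) cr ab(2) c(2) e(4)] c v lt by simp
  moreover have "z1 \<noteq> z2" "w1 \<noteq> w2" using v c by auto
  ultimately show ?thesis by blast
qed

lemma adj_sigma: "adj x y \<Longrightarrow> x \<in> W \<Longrightarrow> \<exists>a b. a \<noteq> b \<and> \<sigma> y = \<sigma> x \<circ> transpose a b"
  using adj_transpose by (metis less_imp_neq)

lemma sigma_cancel: "x \<in> W \<Longrightarrow> \<sigma> x \<circ> f = \<sigma> x \<circ> g \<longleftrightarrow> f = g"
  by (auto simp: fun_eq_iff)

lemma adj_if_sigma:
  assumes W: "x \<in> W" "y \<in> W" and e: "\<sigma> y = \<sigma> x \<circ> transpose a b" "a \<noteq> b"
  shows "adj x y"
proof -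
  have r: "c \<in> {1..n}" if "transpose a b c \<noteq> c" for c
  proof (rule ccontr)
    assume "c \<notin> {1..n}"
    then have "\<sigma> y c = c" "\<sigma> x c = c" using W perm by (auto simp: permutes_def)
    then have "\<sigma> x (transpose a b c) = \<sigma> x c" using e by simp
    then show False using that W by simp
  qed
  then have "a \<in> {1..n}" "b \<in> {1..n}" using r[of a] r[of b] e by auto
  then show ?thesis using transpose_imp_adj[OF W, of a b] transpose_imp_adj[OF W, of b a] e
    by (cases "a < b") (auto simp: transpose_commute)
qed

text \<open>Two elements with at least three common neighbours differ by a \<open>3\<close>-cycle, so everything happens in a coset of \<open>S\<^sub>3\<close>.\<close>

lemma symmetric_K33:
  assumes x: "x \<in> W" and d: "z1 \<noteq> z2" "w1 \<noteq> w2" "x \<noteq> w1" "x \<noteq> w2"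
    and e: "adj x z1" "adj x z2" "adj z1 w1" "adj z1 w2" "adj z2 w1" "adj z2 w2" "adj w1 y" "adj w2 y"
  shows "adj x y"
proof -
  have W: "z1 \<in> W" "z2 \<in> W" "w1 \<in> W" "w2 \<in> W" "y \<in> W"
    using x adj_W[OF e(1)] adj_W[OF e(2)] adj_W[OF e(3)] adj_W[OF e(4)] adj_W[OF e(7)] by auto
  obtain a b where ab: "a \<noteq> b" "\<sigma> z1 = \<sigma> x \<circ> transpose a b" using adj_sigma[OF e(1) x] by blast
  obtain c d' where cd: "c \<noteq> d'" "\<sigma> z2 = \<sigma> x \<circ> transpose c d'" using adj_sigma[OF e(2) x] by blast
  obtain a1 b1 where a1: "a1 \<noteq> b1" "\<sigma> w1 = \<sigma> z1 \<circ> transpose a1 b1" using adj_sigma[OF e(3) W(1)] by blast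
  obtain a2 b2 where a2: "a2 \<noteq> b2" "\<sigma> w2 = \<sigma> z1 \<circ> transpose a2 b2" using adj_sigma[OF e(4) W(1)] by blast
  obtain c1 d1 where c1: "c1 \<noteq> d1" "\<sigma> w1 = \<sigma> z2 \<circ> transpose c1 d1" using adj_sigma[OF e(5) W(2)] by blast
  obtain c2 d2 where c2: "c2 \<noteq> d2" "\<sigma> w2 = \<sigma> z2 \<circ> transpose c2 d2" using adj_sigma[OF e(6) W(2)] by blast
  obtain p1 q1 where p1: "p1 \<noteq> q1" "\<sigma> y = \<sigma> w1 \<circ> transpose p1 q1" using adj_sigma[OF e(7) W(3)] by blast
  obtain p2 q2 where p2: "p2 \<noteq> q2" "\<sigma> y = \<sigma> w2 \<circ> transpose p2 q2" using adj_sigma[OF e(8) W(4)] by blast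
  have ne: "transpose a b \<noteq> transpose c d'"
    using d(1) ab cd sigma_eq_iff W by metis
  have id: "\<sigma> u = \<sigma> x \<circ> transpose i j \<circ> transpose i j \<Longrightarrow> u \<in> W \<Longrightarrow> u = x" for u i j
    using sigma_eq_iff x by (simp add: comp_assoc)
  have ne1: "transpose a1 b1 \<noteq> transpose a b" "transpose a2 b2 \<noteq> transpose a b"
    using d(3,4) id[of w1 a b] id[of w2 a b] a1 a2 ab W by auto
  have ne2: "transpose a1 b1 \<noteq> transpose a2 b2" using d(2) a1 a2 sigma_eq_iff W by metis
  have eq1: "transpose a b \<circ> transpose a1 b1 = transpose c d' \<circ> transpose c1 d1"
    using a1(2) c1(2) unfolding ab cd comp_assoc by (simp add: sigma_cancel x)
  have eq2: "transpose a b \<circ> transpose a2 b2 = transpose c d' \<circ> transpose c2 d2"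
    using a2(2) c2(2) unfolding ab cd comp_assoc by (simp add: sigma_cancel x)
  have eq3: "transpose a1 b1 \<circ> transpose p1 q1 = transpose a2 b2 \<circ> transpose p2 q2"
    using p1(2) p2(2) unfolding a1(2) a2(2) comp_assoc by (simp add: sigma_cancel W)
  note sq1 = transpose_square[OF ab(1) cd(1) a1(1) c1(1) ne ne1(1) eq1]
  note sq2 = transpose_square[OF ab(1) cd(1) a2(1) c2(1) ne ne1(2) eq2]
  \<comment> \<open>With disjoint supports, both \<open>transpose a1 b1\<close> and
    \<open>transpose a2 b2\<close> would equal \<open>transpose c d'\<close>, contradicting
    \<open>w1 \<noteq> w2\<close>.\<close>
  have "{a, b} \<inter> {c, d'} \<noteq> {}" using sq1(2) sq2(2) ne2 by metis
  moreover have "{a, b} \<noteq> {c, d'}" using ne by (auto simp: doubleton_eq_iff transpose_commute)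
  ultimately have "\<exists>p q r. distinct [p, q, r] \<and> {a, b, c, d'} = {p, q, r}"
  proof -
    assume "{a, b} \<inter> {c, d'} \<noteq> {}" "{a, b} \<noteq> {c, d'}"
    then consider "a = c" "b \<noteq> d'" | "a = d'" "b \<noteq> c" | "b = c" "a \<noteq> d'" | "b = d'" "a \<noteq> c"
      by (auto simp: doubleton_eq_iff)
    then show ?thesis
    proof cases
      case 1 then show ?thesis using ab cd by (intro exI[of _ a] exI[of _ b] exI[of _ d']) auto
    next
      case 2 then show ?thesis using ab cd by (intro exI[of _ a] exI[of _ b] exI[of _ c]) auto
    next
      case 3 then show ?thesis using ab cd by (intro exI[of _ a] exI[of _ b] exI[of _ d']) auto
    next
      case 4 then show ?thesis using ab cd by (intro exI[of _ a] exI[of _ b] exI[of _ c]) auto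
    qed
  qed
  then obtain p q r where pqr: "distinct [p, q, r]" "{a, b, c, d'} = {p, q, r}" by blast
  have t1: "transpose a b \<in> transps p q r" using transps_iff[OF ab(1) pqr(1)] pqr(2) by blast
  have s1: "{a1, b1} \<subseteq> {p, q, r}" "{a2, b2} \<subseteq> {p, q, r}" 
  proof -
    have "{a1, b1, c1, d1} = {p, q, r}" by (rule trans[OF sq1(1)[symmetric] pqr(2)])
    moreover have "{a2, b2, c2, d2} = {p, q, r}" by (rule trans[OF sq2(1)[symmetric] pqr(2)])
    ultimately show "{a1, b1} \<subseteq> {p, q, r}" "{a2, b2} \<subseteq> {p, q, r}" by (metis insert_subset order_refl)+
  qed
  then have t2: "transpose a1 b1 \<in> transps p q r" using transps_iff[OF a1(1) pqr(1)] by blast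
  have "transpose p1 q1 \<in> transps p q r"
  proof (cases "transpose p1 q1 = transpose a1 b1")
    case True then show ?thesis using t2 by simp
  next
    case False
    then have "{a1, b1, a2, b2} = {p1, q1, p2, q2}"
      using transpose_square(1)[OF a1(1) a2(1) p1(1) p2(1) ne2 _ eq3] by blast
    moreover have "{a1, b1, a2, b2} \<subseteq> {p, q, r}" using s1 by simp
    ultimately have "{p1, q1} \<subseteq> {p, q, r}" by (metis insert_subset)
    then show ?thesis using transps_iff[OF p1(1) pqr(1)] by blast
  qed
  then have t: "transpose a b \<circ> transpose a1 b1 \<circ> transpose p1 q1 \<in> transps p q r"
    using transps_comp3[OF pqr(1) t1 t2] by blast
  then obtain i j where ij: "i \<noteq> j" "transpose a b \<circ> transpose a1 b1 \<circ> transpose p1 q1 = transpose i j"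
    unfolding transps_def using pqr(1) by auto
  have "\<sigma> y = \<sigma> x \<circ> transpose i j"
    unfolding p1(2) a1(2) ab(2) ij(2)[symmetric] by (simp add: comp_assoc)
  then show ?thesis using adj_if_sigma x W ij by blast
qed

text \<open>The rank matrix, whose entrywise order is the Bruhat order by \<open>ble_rk\<close> and
  \<open>rk_imp_ble\<close>.\<close>

definition rk :: "'g \<Rightarrow> nat \<Rightarrow> nat \<Rightarrow> nat" where
  "rk x i j = (\<Sum>k=1..i. of_bool (j \<le> \<sigma> x k))"

lemma rk_transpose:
  assumes W: "x \<in> W" and ab: "1 \<le> a" "a < b" and y: "\<sigma> y = \<sigma> x \<circ> transpose a b"
    and lt: "\<sigma> x a < \<sigma> x b"
  shows "rk y i j = rk x i j + of_bool (a \<le> i \<and> i < b \<and> \<sigma> x a < j \<and> j \<le> \<sigma> x b)"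
proof -
  define f g :: "nat \<Rightarrow> nat" where "f k = of_bool (j \<le> \<sigma> x k)" and "g k = of_bool (j \<le> \<sigma> y k)" for k
  have same: "g k = f k" if "k \<noteq> a" "k \<noteq> b" for k using that y by (simp add: f_def g_def)
  have ya: "f a = of_bool (j \<le> \<sigma> x a)" "f b = of_bool (j \<le> \<sigma> x b)" "g a = f b" "g b = f a"
    using y by (simp_all add: f_def g_def)
  have rk: "rk x i j = sum f {1..i}" "rk y i j = sum g {1..i}" 
    unfolding rk_def by (intro sum.cong; simp add: f_def g_def)+
  have ra: "sum h {1..i} = h a + sum h ({1..i} - {a})" if "a \<le> i" for h :: "nat \<Rightarrow> nat"
    using that ab by (intro sum.remove) auto
  consider "i < a" | "a \<le> i" "i < b" | "b \<le> i" by linarith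
  then show ?thesis
  proof cases
    case 1
    then have "sum g {1..i} = sum f {1..i}" using ab by (intro sum.cong) (auto simp: same)
    then show ?thesis using 1 rk by simp
  next
    case 2
    have "sum g ({1..i} - {a}) = sum f ({1..i} - {a})"
      using 2 by (intro sum.cong) (auto simp: same)
    then have "rk y i j + f a = rk x i j + f b" using ra[of f] ra[of g] 2 rk ya(3) by simp
    then show ?thesis using 2 lt ya by (auto split: if_splits)
  next
    case 3
    have rb: "sum h ({1..i} - {a}) = h b + sum h ({1..i} - {a} - {b})" for h :: "nat \<Rightarrow> nat"
      using 3 ab by (intro sum.remove) auto
    have "sum g ({1..i} - {a} - {b}) = sum f ({1..i} - {a} - {b})"
      by (intro sum.cong) (auto simp: same)
    then have "rk y i j = rk x i j" using ra[of f] ra[of g] rb[of f] rb[of g] 3 ab rk ya(3,4) by simp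
    then show ?thesis using 3 by simp
  qed
qed

lemma arrow_rk: "arrow x y \<Longrightarrow> rk x i j \<le> rk y i j"
proof -
  assume xy: "arrow x y"
  have W: "x \<in> W" "y \<in> W" using arrow_W[OF xy] by auto
  obtain a b where ab: "a \<in> {1..n}" "b \<in> {1..n}" "a < b" "\<sigma> y = \<sigma> x \<circ> transpose a b"
    using adj_transpose[OF arrow_adj[OF xy] W(1)] .
  then show ?thesis using rk_transpose[OF W(1) _ ab(3,4)] arrow_iff[OF W ab] xy by simp
qed

lemma ble_rk: assumes "ble x y" shows "rk x i j \<le> rk y i j"
proof -
  have "arrow\<^sup>*\<^sup>* x y" using assms by (simp add: ble_def)
  then show ?thesis by (induction rule: rtranclp_induct) (auto dest: arrow_rk[of _ _ i j])
qed

text \<open>At the first position \<open>a\<close> where they differ, \<open>u\<close> has the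
  smaller value. It is swapped with the first later entry whose value is above
  \<open>\<sigma> u a\<close> and at most \<open>\<sigma> x a\<close>; taking the first one is what
  keeps the result below \<open>x\<close>.\<close>

lemma rk_step:
  assumes W: "u \<in> W" "x \<in> W" and le: "\<And>i j. rk u i j \<le> rk x i j" and ne: "u \<noteq> x"
  shows "\<exists>w. arrow u w \<and> (\<forall>i j. rk w i j \<le> rk x i j)"
proof -
  note [simp del] = sum_of_bool_eq
  have "\<exists>a. \<sigma> u a \<noteq> \<sigma> x a" using ne sigma_eq_iff[OF W] by (auto simp: fun_eq_iff)
  then have dif: "\<sigma> u (LEAST a. \<sigma> u a \<noteq> \<sigma> x a) \<noteq> \<sigma> x (LEAST a. \<sigma> u a \<noteq> \<sigma> x a)" by (rule LeastI_ex)
  define a where "a = (LEAST a. \<sigma> u a \<noteq> \<sigma> x a)"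
  have a: "\<sigma> u a \<noteq> \<sigma> x a" using dif by (simp add: a_def)
  have below: "\<sigma> u k = \<sigma> x k" if "k < a" for k using not_less_Least[of k] that unfolding a_def by blast
  have ar: "a \<in> {1..n}"
  proof (rule ccontr)
    assume "a \<notin> {1..n}"
    then have "\<sigma> u a = a" "\<sigma> x a = a" using W perm by (auto simp: permutes_def)
    then show False using a by simp
  qed
  have split: "rk z i j = (\<Sum>k\<in>{1..<a}. of_bool (j \<le> \<sigma> z k)) + (\<Sum>k\<in>{a..i}. of_bool (j \<le> \<sigma> z k))"
    if "a \<le> i" for z i j
  proof -
    have "{1..i} = {1..<a} \<union> {a..i}" using that ar by auto
    then show ?thesis unfolding rk_def by (simp only:) (intro sum.union_disjoint, auto)
  qed
  have pre: "(\<Sum>k\<in>{1..<a}. of_bool (j \<le> \<sigma> u k)) = (\<Sum>k\<in>{1..<a}. of_bool (j \<le> \<sigma> x k) :: nat)" for j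
    by (intro sum.cong) (auto simp: below)
  have lt: "\<sigma> u a < \<sigma> x a"
  proof (rule ccontr)
    assume "\<not> \<sigma> u a < \<sigma> x a"
    then have "\<sigma> x a < \<sigma> u a" using a by simp
    then show False using le[of a "\<sigma> u a"] split[of a u "\<sigma> u a"] split[of a x "\<sigma> u a"] pre[of "\<sigma> u a"] by simp
  qed
  let ?P = "\<lambda>b. a < b \<and> \<sigma> u a < \<sigma> u b \<and> \<sigma> u b \<le> \<sigma> x a"
  have "\<exists>b. ?P b"
  proof -
    obtain b where b: "\<sigma> u b = \<sigma> x a" using permutes_surj[OF perm[OF W(1)]] by (metis surjD)
    have "\<not> b < a" using below[of b] b W by auto
    moreover have "b \<noteq> a" using b a by auto
    ultimately show ?thesis using b lt by (intro exI[of _ b]) auto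
  qed
  then have Pb: "?P (LEAST b. ?P b)" by (rule LeastI_ex)
  define b where "b = (LEAST b. ?P b)"
  have b: "a < b" "\<sigma> u a < \<sigma> u b" "\<sigma> u b \<le> \<sigma> x a" using Pb unfolding b_def by blast+
  have nb: "\<not> ?P k" if "k < b" for k using not_less_Least[of k ?P] that unfolding b_def by blast
  have br: "b \<in> {1..n}"
  proof (rule ccontr)
    assume "b \<notin> {1..n}"
    then have "\<sigma> u b = b" "n < b" using W perm ar b by (auto simp: permutes_def)
    moreover have "\<sigma> x a \<in> {1..n}" using sigma_range W ar by blast
    ultimately show False using b by simp
  qed
  obtain w where w: "w \<in> W" "\<sigma> w = \<sigma> u \<circ> transpose a b" using swap_exists[OF W(1) ar br b(1)] .
  have uw: "arrow u w" using arrow_iff[OF W(1) w(1) ar br b(1) w(2)] b by simp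
  have "rk w i j \<le> rk x i j" for i j
  proof (cases "a \<le> i \<and> i < b \<and> \<sigma> u a < j \<and> j \<le> \<sigma> u b")
    case False
    then show ?thesis using rk_transpose[OF W(1) _ b(1) w(2) b(2), of i j] le[of i j] ar by auto
  next
    case True
    \<comment> \<open>On positions \<open>a\<close> to \<open>i\<close>, \<open>u\<close> has no
      value in the gap above \<open>\<sigma> u a\<close> up to \<open>\<sigma> x a\<close>, so its
      count is unchanged when the threshold \<open>j\<close> is raised to \<open>?v\<close>. For
      \<open>x\<close> the raise loses the entry at \<open>a\<close>, which yields the strict
      inequality.\<close>
    let ?v = "Suc (\<sigma> x a)"
    have rem: "sum h {a..i} = h a + sum h ({a..i} - {a})" for h :: "nat \<Rightarrow> nat"
      using True by (intro sum.remove) auto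
    have u_mid: "of_bool (j \<le> \<sigma> u k) = (of_bool (?v \<le> \<sigma> u k) :: nat)" if "k \<in> {a..i}" for k
    proof (cases "k = a")
      case False
      then have "\<not> ?P k" using nb that True by auto
      then show ?thesis using that True False b lt by auto
    qed (use True lt in auto)
    have "(\<Sum>k\<in>{a..i}. of_bool (j \<le> \<sigma> u k)) = (\<Sum>k\<in>{a..i}. of_bool (?v \<le> \<sigma> u k) :: nat)"
      using u_mid by (intro sum.cong) auto
    also have "\<dots> \<le> (\<Sum>k\<in>{a..i}. of_bool (?v \<le> \<sigma> x k))"
      using le[of i ?v] split[of i u ?v] split[of i x ?v] pre[of ?v] True by simp
    also have "\<dots> = (\<Sum>k\<in>{a..i} - {a}. of_bool (?v \<le> \<sigma> x k))"
      using True unfolding rem[of "\<lambda>k. of_bool (?v \<le> \<sigma> x k)"] by simp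
    also have "\<dots> \<le> (\<Sum>k\<in>{a..i} - {a}. of_bool (j \<le> \<sigma> x k))"
      using True b by (intro sum_mono) auto
    also have "\<dots> < (\<Sum>k\<in>{a..i}. of_bool (j \<le> \<sigma> x k))"
      using True b unfolding rem[of "\<lambda>k. of_bool (j \<le> \<sigma> x k)"] by simp
    finally have "rk u i j < rk x i j" using split[of i u j] split[of i x j] pre[of j] True by simp
    then show ?thesis using rk_transpose[OF W(1) _ b(1) w(2) b(2), of i j] True ar by simp
  qed
  then show ?thesis using uw by blast
qed

lemma len_bounded: "\<exists>N. \<forall>x\<in>W. len x \<le> N"
proof -
  have "finite (\<sigma> ` W)" by (rule finite_subset[OF _ finite_permutations[of "{1..n}"]]) (use perm in auto)
  then have "finite W" using inj finite_imageD by blast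
  then show ?thesis by (intro exI[of _ "Max (len ` W)"]) auto
qed

lemma rk_imp_ble:
  assumes "u \<in> W" "x \<in> W" "\<And>i j. rk u i j \<le> rk x i j"
  shows "ble u x"
proof -
  obtain N where N: "\<forall>x\<in>W. len x \<le> N" using len_bounded by blast
  show ?thesis using assms
  proof (induction "N - len u" arbitrary: u rule: less_induct)
    case less
    show ?case
    proof (cases "u = x")
      case True then show ?thesis using less.prems by simp
    next
      case False
      then obtain w where w: "arrow u w" "\<forall>i j. rk w i j \<le> rk x i j" using rk_step less.prems by blast
      have "N - len w < N - len u" using arrow_len[OF w(1)] arrow_W[OF w(1)] N by (simp add: diff_less_mono2 order.strict_trans2)
      then have "ble w x" using less.hyps[of w] less.prems arrow_W[OF w(1)] w(2) by blast
      then show ?thesis using arrow_ble[OF w(1)] ble_trans by blast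
    qed
  qed
qed

end

lemma transpose_comp_cancel: "transpose a b \<circ> (transpose a b \<circ> f) = f"
  by (simp flip: comp_assoc)

text \<open>The criterion of \<open>arrow_iff\<close> for a swap among three positions, split by the
  swap so that the case analysis below can simplify it.\<close>

definition ascent :: "'b \<Rightarrow> 'b \<Rightarrow> 'b \<Rightarrow> ('b \<Rightarrow> nat) \<Rightarrow> ('b \<Rightarrow> 'b) \<Rightarrow> bool" where
  "ascent p q r Z t \<longleftrightarrow> (t = transpose p q \<longrightarrow> Z p < Z q) \<and> (t = transpose q r \<longrightarrow> Z q < Z r) \<and>
    (t = transpose p r \<longrightarrow> Z p < Z r)"

text \<open>In a coset of S_3, two elements with two common upper neighbours can only be the two
  atoms. The alternatives tell which of \<open>X\<close>, \<open>Y\<close> arises from the bottom by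
  \<open>transpose p q\<close>; the other arises by \<open>transpose q r\<close>.\<close>

lemma ascent_butterfly:
  assumes d: "distinct [p, q, r]"
    and t: "t1 \<in> transps p q r" "t2 \<in> transps p q r" "t3 \<in> transps p q r" "t4 \<in> transps p q r"
    and ne: "t1 \<noteq> t2" "t3 \<noteq> t1" and eq: "t1 \<circ> t3 = t2 \<circ> t4"
    and Y: "\<And>i. Y i = X (t1 (t3 i))"
    and up: "ascent p q r X t1" "ascent p q r X t2" "ascent p q r Y t3" "ascent p q r Y t4"
  shows "(X q < X p \<and> X p < X r \<and> t1 \<circ> t3 = transpose p q \<circ> transpose q r \<and> {t1, t2} = {transpose p r, transpose q r}) \<or>
    (Y q < Y p \<and> Y p < Y r \<and> t3 \<circ> t1 = transpose p q \<circ> transpose q r \<and> {t3, t4} = {transpose p r, transpose q r})"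
proof -
  have d': "p \<noteq> q" "p \<noteq> r" "q \<noteq> r" "q \<noteq> p" "r \<noteq> p" "r \<noteq> q" using d by auto
  have tp: "transpose p q p = q" "transpose p q q = p" "transpose p q r = r" "transpose q r p = p"
    "transpose q r q = r" "transpose q r r = q" "transpose p r p = r" "transpose p r q = q" "transpose p r r = p"
    using d' by (simp_all add: transpose_def)
  have "transpose p q p \<noteq> transpose q r p" "transpose p q p \<noteq> transpose p r p" "transpose q r p \<noteq> transpose p r p"
    using d' unfolding tp by simp_all
  then have tne: "transpose p q \<noteq> transpose q r" "transpose p q \<noteq> transpose p r" "transpose q r \<noteq> transpose p r"
    by metis+
  note tne' = tne tne[symmetric]
  have e: "t1 (t3 p) = t2 (t4 p)" "t1 (t3 q) = t2 (t4 q)"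
    using fun_cong[OF eq, of p] fun_cong[OF eq, of q] by simp_all
  show ?thesis
    using t ne e up unfolding transps_def ascent_def
    by (elim insertE emptyE) (simp_all add: Y tp tne' d' transps_rel[OF d] insert_commute)
qed

context symmetric_coxeter
begin

text \<open>The rank criterion shows that the bottom \<open>B\<close> of the \<open>S\<^sub>3\<close>-coset of a butterfly still lies in the interval;
the matching has no admissible value at \<open>B\<close>.\<close>

lemma no_crossing_S3:
  assumes hm: "hasse_matching (interval u v) M" and ad: "preserves_adj (interval u v) M"
    and pqr: "p \<in> {1..n}" "q \<in> {1..n}" "r \<in> {1..n}" "p < q" "q < r"
    and I: "x1 \<in> interval u v" "x2 \<in> interval u v"
    and M: "{M x1, M x2} = {ya, yb}" and cov: "cov x1 ya" "cov x1 yb"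
    and B: "B \<in> W" "\<sigma> B p < \<sigma> B q" "\<sigma> B q < \<sigma> B r"
    and x: "\<sigma> x1 = \<sigma> B \<circ> transpose p q" "\<sigma> x2 = \<sigma> B \<circ> transpose q r"
    and y: "\<sigma> ya = \<sigma> x1 \<circ> transpose p r" "\<sigma> yb = \<sigma> x1 \<circ> transpose q r"
  shows False
proof -
  note W = interval_W[OF I(1)] interval_W[OF I(2)]
  have Wy: "ya \<in> W" "yb \<in> W" using cov cov_W by auto
  have pr: "p < r" using pqr by simp
  have d: "distinct [p, q, r]" using pqr by auto
  have ax1: "arrow B x1" using arrow_iff[OF B(1) W(1) pqr(1,2,4) x(1)] B by simp
  have ax2: "arrow B x2" using arrow_iff[OF B(1) W(2) pqr(2,3,5) x(2)] B by simp
  have uW: "u \<in> W" using I by (auto simp: interval_def dest: ble_W)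
  \<comment> \<open>The rectangles on which \<open>x1\<close> and \<open>x2\<close> exceed
    \<open>B\<close> are disjoint, one having \<open>i < q\<close> and the other
    \<open>q \<le> i\<close>. At each entry one of the two agrees with \<open>B\<close>.\<close>
  have "rk u i j \<le> rk B i j" for i j
  proof -
    have "rk u i j \<le> rk x1 i j" "rk u i j \<le> rk x2 i j" using I ble_rk by (auto simp: interval_def)
    moreover have "rk x1 i j = rk B i j + of_bool (p \<le> i \<and> i < q \<and> \<sigma> B p < j \<and> j \<le> \<sigma> B q)"
      using rk_transpose[OF B(1) _ pqr(4) x(1) B(2)] pqr by simp
    moreover have "rk x2 i j = rk B i j + of_bool (q \<le> i \<and> i < r \<and> \<sigma> B q < j \<and> j \<le> \<sigma> B r)"
      using rk_transpose[OF B(1) _ pqr(5) x(2) B(3)] pqr by simp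
    ultimately show ?thesis by (cases "i < q") auto
  qed
  then have "ble u B" using rk_imp_ble uW B by blast
  moreover have "ble B v" using I ble_trans[OF arrow_ble[OF ax1], of v] by (simp add: interval_def)
  ultimately have BI: "B \<in> interval u v" by (simp add: interval_def)
  have MB: "M B \<in> interval u v" "M (M B) = B" "cov B (M B) \<or> cov (M B) B"
    using hasse_matchingD[OF hm BI] by auto
  have "adj (M B) (M x1)" "adj (M B) (M x2)"
    using ad BI I ax1 ax2 arrow_adj by (auto simp: preserves_adj_def)
  then have "adj ya (M B)" "adj yb (M B)" using M adj_sym by (auto simp: doubleton_eq_iff)
  then obtain a b c e where ab: "a \<noteq> b" "\<sigma> (M B) = \<sigma> ya \<circ> transpose a b"
    and ce: "c \<noteq> e" "\<sigma> (M B) = \<sigma> yb \<circ> transpose c e" using adj_sigma Wy by metis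
  have lenB: "len B < len x1" "len ya = Suc (len x1)" "len yb = Suc (len x1)"
    using ax1 arrow_len cov cov_len by auto
  have MM: "M (M x1) = x1" "M (M x2) = x2" using hasse_matchingD(2)[OF hm] I by auto
  have nx: "M B \<noteq> x1" "M B \<noteq> x2"
  proof -
    have "M x1 = ya \<or> M x1 = yb" "M x2 = ya \<or> M x2 = yb" using M by auto
    moreover have "B \<noteq> ya" "B \<noteq> yb" using lenB by auto
    ultimately show "M B \<noteq> x1" "M B \<noteq> x2" using MB(2) by metis+
  qed
  have xa: "\<sigma> ya \<circ> transpose p r = \<sigma> x1" using y by (simp add: comp_assoc)
  have ne1: "transpose a b \<noteq> transpose p r" using nx(1) ab xa sigma_eq_iff W MB interval_W by metis
  have "transpose p r p \<noteq> transpose q r p" using d by auto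
  then have ne: "transpose p r \<noteq> transpose q r" by metis
  have eq: "transpose p r \<circ> transpose a b = transpose q r \<circ> transpose c e"
    using ab(2) ce(2) unfolding y comp_assoc by (simp add: sigma_cancel W)
  have "{p, r, q, r} = {a, b, c, e}"
    using transpose_square(1)[OF _ _ ab(1) ce(1) ne ne1 eq] d by auto
  then have "{a, b} \<subseteq> {p, q, r}" by (metis insert_commute insert_absorb2 insert_subset subset_insertI)
  then have "transpose a b \<in> transps p q r" using transps_iff[OF ab(1) d] by blast
  \<comment> \<open>The neighbours of \<open>ya\<close> in the coset are \<open>x1\<close>,
    \<open>x2\<close> and the top. The first two are already matched with \<open>ya\<close> and
    \<open>yb\<close>, and the top is too long to be a cover of \<open>B\<close>.\<close>
  then consider "transpose a b = transpose p q" | "transpose a b = transpose q r"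
    using ne1 by (auto simp: transps_def)
  then show False
  proof cases
    case 1
    have "\<sigma> (M B) = \<sigma> B \<circ> (transpose p q \<circ> (transpose p r \<circ> transpose p q))"
      unfolding ab(2) 1 y x by (simp add: comp_assoc)
    also have "\<dots> = \<sigma> x2" unfolding transps_rel(2)[OF d] x(2) by (simp add: transpose_comp_cancel)
    finally show False using nx sigma_eq_iff W MB interval_W by blast
  next
    case 2
    have "\<sigma> (M B) = \<sigma> B \<circ> (transpose p q \<circ> (transpose p r \<circ> transpose q r))"
      unfolding ab(2) 2 y x by (simp add: comp_assoc)
    have "\<sigma> ya q < \<sigma> ya r" using B d unfolding y x by (simp add: transpose_def)
    then have "arrow ya (M B)"
      using arrow_iff[OF Wy(1) interval_W[OF MB(1)] pqr(2,3,5)] ab(2) 2 by simp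
    then show False using MB(3) arrow_len lenB cov_len by fastforce
  qed
qed

lemma symmetric_no_bad:
  assumes hm: "hasse_matching (interval u v) M" and ad: "preserves_adj (interval u v) M"
  shows "\<not> bad (interval u v) M x y"
proof
  assume bd: "bad (interval u v) M x y"
  note bp = bad_partner[OF hm ad bd]
  have I: "x \<in> interval u v" "y \<in> interval u v" and c: "cov x y" "cov x (M x)" "cov (M y) y"
    using bd by (auto simp: bad_def)
  note W = interval_W[OF I(1)] interval_W[OF I(2)] interval_W[OF bp(2)] interval_W[OF bp(3)]
  obtain a b where ab: "a \<in> {1..n}" "b \<in> {1..n}" "a < b" "\<sigma> y = \<sigma> x \<circ> transpose a b"
    using adj_transpose[OF cov_adj[OF c(1)] W(1)] .
  obtain c1 d1 where cd: "c1 \<in> {1..n}" "d1 \<in> {1..n}" "c1 < d1" "\<sigma> (M x) = \<sigma> x \<circ> transpose c1 d1"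
    using adj_transpose[OF cov_adj[OF c(2)] W(1)] .
  obtain e f where ef: "e \<in> {1..n}" "f \<in> {1..n}" "e < f" "\<sigma> (M y) = \<sigma> y \<circ> transpose e f"
    using adj_transpose[OF adj_sym[OF cov_adj[OF c(3)]] W(2)] .
  obtain g h where gh: "g \<in> {1..n}" "h \<in> {1..n}" "g < h" "\<sigma> (M y) = \<sigma> (M x) \<circ> transpose g h"
    using adj_transpose[OF adj_sym[OF cov_adj[OF bp(1)]] W(3)] .
  have ne: "transpose a b \<noteq> transpose c1 d1" using bp(7) ab(4) cd(4) sigma_eq_iff W by metis
  have ne1: "transpose e f \<noteq> transpose a b"
  proof
    assume "transpose e f = transpose a b"
    then have "\<sigma> (M y) = \<sigma> x" unfolding ef(4) ab(4) by (simp add: comp_assoc)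
    then show False using bp(6) sigma_eq_iff W by metis
  qed
  have eq: "transpose a b \<circ> transpose e f = transpose c1 d1 \<circ> transpose g h"
    using ef(4) gh(4) unfolding ab(4) cd(4) comp_assoc by (simp add: sigma_cancel W)
  have ne0: "a \<noteq> b" "c1 \<noteq> d1" "e \<noteq> f" "g \<noteq> h" using ab cd ef gh by auto
  note sq = transpose_square[OF ne0 ne ne1 eq]
  have My: "\<sigma> (M y) = \<sigma> x \<circ> (transpose a b \<circ> transpose e f)" unfolding ef(4) ab(4) by (simp add: comp_assoc)
  show False
  proof (cases "{a, b} \<inter> {c1, d1} = {}")
    case True
    then have ef': "transpose e f = transpose c1 d1" by (rule sq(2))
    have y': "\<sigma> y = \<sigma> (M y) \<circ> transpose c1 d1" unfolding ef(4) ef' by (simp add: comp_assoc)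
    \<comment> \<open>The square commutes, so the pair \<open>c1\<close>, \<open>d1\<close> is
      already inverted in \<open>M y\<close>, and swapping it again cannot lead up to
      \<open>y\<close>.\<close>
    have "\<sigma> x c1 < \<sigma> x d1" using arrow_iff[OF W(1,3) cd] cov_arrow c by blast
    moreover have "\<sigma> (M y) c1 < \<sigma> (M y) d1" using arrow_iff[OF W(4,2) cd(1-3) y'] cov_arrow c by blast
    moreover have "\<sigma> (M y) c1 = \<sigma> x d1" "\<sigma> (M y) d1 = \<sigma> x c1"
      using True cd(3) unfolding My ef' by (auto simp: transpose_def)
    ultimately show False by simp
  next
    case False
    have "{a, b} \<noteq> {c1, d1}" using ne by (auto simp: doubleton_eq_iff transpose_commute)
    then have "\<exists>p q r. p < q \<and> q < r \<and> {a, b, c1, d1} = {p, q, r}"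
    proof -
      assume "{a, b} \<noteq> {c1, d1}"
      then have "card {a, b, c1, d1} = 3" using False ab(3) cd(3) by (auto simp: card_insert_if)
      then obtain xs where xs: "sorted xs" "distinct xs" "set xs = {a, b, c1, d1}" "length xs = 3"
        by (metis distinct_sorted_list_of_set finite.emptyI finite_insert length_sorted_list_of_set set_sorted_list_of_set sorted_sorted_list_of_set)
      then obtain p q r where "xs = [p, q, r]" by (metis length_0_conv length_Suc_conv numeral_3_eq_3)
      then have "p < q \<and> q < r \<and> {a, b, c1, d1} = {p, q, r}" using xs by auto
      then show ?thesis by blast
    qed
    then obtain p q r where pq: "p < q" "q < r" and P: "{a, b, c1, d1} = {p, q, r}" by blast
    have d: "distinct [p, q, r]" using pq by auto
    have "p \<in> {a, b, c1, d1}" "q \<in> {a, b, c1, d1}" "r \<in> {a, b, c1, d1}" unfolding P by auto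
    then have rg: "p \<in> {1..n}" "q \<in> {1..n}" "r \<in> {1..n}" using ab cd by blast+
    have P': "{e, f, g, h} = {p, q, r}" by (rule trans[OF sq(1)[symmetric] P])
    have "{a, b} \<subseteq> {a, b, c1, d1}" "{c1, d1} \<subseteq> {a, b, c1, d1}" "{e, f} \<subseteq> {e, f, g, h}" "{g, h} \<subseteq> {e, f, g, h}" by auto
    then have sub: "{a, b} \<subseteq> {p, q, r}" "{c1, d1} \<subseteq> {p, q, r}" "{e, f} \<subseteq> {p, q, r}" "{g, h} \<subseteq> {p, q, r}"
      unfolding P P' by auto
    note t = iffD1[OF transps_iff[OF ne0(1) d] sub(1)] iffD1[OF transps_iff[OF ne0(2) d] sub(2)]
      iffD1[OF transps_iff[OF ne0(3) d] sub(3)] iffD1[OF transps_iff[OF ne0(4) d] sub(4)]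
    have pr: "p < r" using pq by simp
    have up: "ascent p q r (\<sigma> z) t" if "cov z w" "\<sigma> w = \<sigma> z \<circ> t" for z w t
      using cov_W[OF that(1)] cov_arrow[OF that(1)] that(2) arrow_iff[of z w, OF _ _ rg(1,2) pq(1)]
        arrow_iff[of z w, OF _ _ rg(2,3) pq(2)] arrow_iff[of z w, OF _ _ rg(1,3) pr] by (simp add: ascent_def)
    have y': "\<sigma> y = \<sigma> (M y) \<circ> transpose e f" "\<sigma> (M x) = \<sigma> (M y) \<circ> transpose g h"
      by (simp add: ef(4) comp_assoc) (simp add: gh(4) comp_assoc)
    have "\<sigma> (M y) i = \<sigma> x (transpose a b (transpose e f i))" for i unfolding My by simp
    note ascent_butterfly[OF d t ne ne1 eq this up[OF c(1) ab(4)] up[OF c(2) cd(4)] up[OF c(3) y'(1)] up[OF bp(1) y'(2)]]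
    then show False
    proof (elim disjE conjE)
      assume h: "\<sigma> x q < \<sigma> x p" "\<sigma> x p < \<sigma> x r" "transpose a b \<circ> transpose e f = transpose p q \<circ> transpose q r"
        "{transpose a b, transpose c1 d1} = {transpose p r, transpose q r}"
      obtain B where B: "B \<in> W" "\<sigma> B = \<sigma> x \<circ> transpose p q" using swap_exists[OF W(1) rg(1,2) pq(1)] .
      have 1: "\<sigma> x = \<sigma> B \<circ> transpose p q" unfolding B by (simp add: comp_assoc)
      have 2: "\<sigma> (M y) = \<sigma> B \<circ> transpose q r" unfolding My h(3) B by (simp add: comp_assoc)
      have Bv: "\<sigma> B p < \<sigma> B q" "\<sigma> B q < \<sigma> B r" using h d unfolding B by (auto simp: transpose_def)
      note fin = no_crossing_S3[OF hm ad rg pq I(1) bp(3) _ _ _ B(1) Bv 1 2]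
      show False
        using h(4) fin[of y "M x"] fin[of "M x" y] ab(4) cd(4) c bp(5) by (auto simp: doubleton_eq_iff)
    next
      assume h: "\<sigma> (M y) q < \<sigma> (M y) p" "\<sigma> (M y) p < \<sigma> (M y) r" "transpose e f \<circ> transpose a b = transpose p q \<circ> transpose q r"
        "{transpose e f, transpose g h} = {transpose p r, transpose q r}"
      obtain B where B: "B \<in> W" "\<sigma> B = \<sigma> (M y) \<circ> transpose p q" using swap_exists[OF W(4) rg(1,2) pq(1)] .
      have 1: "\<sigma> (M y) = \<sigma> B \<circ> transpose p q" unfolding B by (simp add: comp_assoc)
      have "\<sigma> x = \<sigma> (M y) \<circ> (transpose e f \<circ> transpose a b)" unfolding My by (simp add: comp_assoc transpose_comp_cancel)
      then have 2: "\<sigma> x = \<sigma> B \<circ> transpose q r" unfolding h(3) B by (simp add: comp_assoc)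
      have Bv: "\<sigma> B p < \<sigma> B q" "\<sigma> B q < \<sigma> B r" using h d unfolding B by (auto simp: transpose_def)
      note fin = no_crossing_S3[OF hm ad rg pq bp(3) I(1) _ _ _ B(1) Bv 1 2]
      show False
        using h(4) fin[of y "M x"] fin[of "M x" y] y' c bp by (auto simp: doubleton_eq_iff)
    qed
  qed
qed

end

sublocale symmetric_coxeter \<subseteq> bruhat_axioms
proof
qed (fact symmetric_K33 symmetric_long_arrow symmetric_no_bad)+

section \<open>Right-angled groups: the geometric representation\<close>

locale right_angled_coxeter = coxeter S m for S :: "'g::grp set" and m +
  assumes right_angled: "\<lbrakk>s \<in> S; t \<in> S; s \<noteq> t; s * t \<noteq> t * s\<rbrakk> \<Longrightarrow> m s t = 0"
begin

text \<open>Vectors live in the geometric representation extended by a dual copy: index \<open>(q, True)\<close> is the pairing with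
the simple root \<open>q\<close>, and \<open>(q, False)\<close> is the coordinate along it, so that \<open>coroot s\<close> are linearly independent.\<close>

definition coroot :: "'g \<Rightarrow> 'g \<times> bool \<Rightarrow> real" where
  "coroot s i = (case i of (q, b) \<Rightarrow>
     if b then (if q = s then 2 else if s * q = q * s then 0 else -2) else of_bool (q = s))"

definition act :: "'g \<Rightarrow> ('g \<times> bool \<Rightarrow> real) \<Rightarrow> 'g \<times> bool \<Rightarrow> real" where
  "act s f = (\<lambda>i. f i - f (s, True) * coroot s i)"

lemma coroot_simps [simp]: "coroot s (s, True) = 2" "coroot s (q, False) = of_bool (q = s)"
  by (simp_all add: coroot_def)

lemma coroot_sym: "coroot s (t, True) = coroot t (s, True)"
  by (auto simp: coroot_def)

lemma act_act: "act s (act s f) = f"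
  by (simp add: act_def)

lemma act_commute: "s \<noteq> t \<Longrightarrow> s * t = t * s \<Longrightarrow> act s (act t f) = act t (act s f)"
  by (auto simp: act_def coroot_def algebra_simps)

text \<open>Only evenness of \<open>m s t\<close> is extracted for commuting generators: from
  \<open>(s * t) ^ 2 = 1\<close>, an odd entry would give \<open>s * t = 1\<close>. Evenness
  suffices for every invariant checked on relators below.\<close>

lemma relator_cases:
  assumes "r \<in> coxeter_relators S m"
  obtains s where "s \<in> S" "r = [s, s]"
  | s t k where "s \<in> S" "t \<in> S" "s \<noteq> t" "s * t = t * s" "r = concat (replicate (2 * k) [s, t])"
proof -
  obtain s t where st: "s \<in> S" "t \<in> S" "r = concat (replicate (m s t) [s, t])" "m s t > 0"
    using assms by (auto simp: coxeter_relators_def)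
  show ?thesis
  proof (cases "s = t")
    case True
    then have "m s t = 1" using matrix st by (auto simp: coxeter_matrix_def)
    then show ?thesis using that(1) st True by simp
  next
    case False
    have c: "s * t = t * s" using right_angled[of s t] st False by auto
    have pl: "prod_list (concat (replicate k [s, t])) = (s * t) ^ k" for k
      by (induction k) (auto simp: mult.assoc)
    have sq: "(s * t) ^ 2 = 1"
    proof -
      have "(s * t) ^ 2 = (s * t) * (t * s)" using c by (simp add: power2_eq_square)
      then show ?thesis using st by (simp add: mult.assoc)
    qed
    have "even (m s t)"
    proof (rule ccontr)
      assume "odd (m s t)"
      then obtain k where "m s t = Suc (2 * k)" by (elim oddE) simp
      then have "(s * t) ^ m s t = s * t" using sq by (simp add: power_mult)
      moreover have "(s * t) ^ m s t = 1" using relator_one[OF assms] pl st by simp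
      ultimately have "s * t = s * s" using st by simp
      then show False using False by simp
    qed
    then obtain k where "m s t = 2 * k" by (elim evenE)
    then show ?thesis using that(2)[of s t k] st False c by simp
  qed
qed

lemma relator_act:
  assumes "r \<in> coxeter_relators S m" shows "foldr act r f = f"
  using assms
proof (cases rule: relator_cases)
  case (1 s)
  then show ?thesis by (simp add: act_act)
next
  case (2 s t k)
  have "act s (act t (act s (act t g))) = g" for g
    using act_commute[OF 2(3,4), of g] by (simp add: act_act)
  then have "foldr act (concat (replicate (2 * k) [s, t])) f = f"
    by (induction k) auto
  then show ?thesis using 2 by simp
qed

definition rho :: "'g \<Rightarrow> ('g \<times> bool \<Rightarrow> real) \<Rightarrow> 'g \<times> bool \<Rightarrow> real" where
  "rho x = foldr act (SOME w. w \<in> lists S \<and> prod_list w = x)"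

lemma rho_word: assumes "w \<in> lists S" shows "rho (prod_list w) f = foldr act w f"
proof -
  let ?v = "SOME v. v \<in> lists S \<and> prod_list v = prod_list w"
  have v: "?v \<in> lists S \<and> prod_list ?v = prod_list w" 
    by (rule someI[of _ w]) (use assms in simp)
  show ?thesis unfolding rho_def
  proof (rule word_invariant[where F = "\<lambda>w. foldr act w f"])
    show "?v \<in> lists S" "w \<in> lists S" "prod_list ?v = prod_list w" using v assms by blast+
  qed (simp add: relator_act)
qed

lemma rho_one [simp]: "rho 1 f = f"
  using rho_word[of "[]"] by simp

lemma rho_mult: "x \<in> W \<Longrightarrow> y \<in> W \<Longrightarrow> rho (x * y) f = rho x (rho y f)"
proof (elim W_cases)
  fix a b assume "a \<in> lists S" "b \<in> lists S" "prod_list a = x" "prod_list b = y"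
  then show ?thesis using rho_word[of "a @ b" f] rho_word[of a] rho_word[of b] by auto
qed

lemma rho_gen: "s \<in> S \<Longrightarrow> rho s f = act s f"
  using rho_word[of "[s]"] by simp

lemma rho_gen_mult: "s \<in> S \<Longrightarrow> x \<in> W \<Longrightarrow> rho (s * x) f = act s (rho x f)"
  by (simp add: rho_mult rho_gen)

lemma rho_ginv [simp]: "x \<in> W \<Longrightarrow> rho (ginv x) (rho x f) = f" "x \<in> W \<Longrightarrow> rho x (rho (ginv x) f) = f"
  using rho_mult[of "ginv x" x f] rho_mult[of x "ginv x" f] by simp_all

lemma rho_linear: "x \<in> W \<Longrightarrow> rho x (\<lambda>i. a * f i + b * g i) = (\<lambda>i. a * rho x f i + b * rho x g i)"
proof (induction rule: W_left_induct)
  case (gen s y)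
  then show ?case by (simp add: rho_gen_mult act_def algebra_simps)
qed simp

text \<open>A point inside the fundamental chamber, with zero coordinates along the roots. Signs of
  its image at \<open>True\<close> show descents, entries at \<open>False\<close> show which letters
  occur.\<close>

definition ones :: "'g \<times> bool \<Rightarrow> real" where "ones i = of_bool (snd i)"

text \<open>The inequality for sums is the induction invariant: for noncommuting \<open>s\<close>,
  \<open>t\<close>, reflecting in \<open>t\<close> turns the pairings \<open>(y_s, y_t)\<close> into
  \<open>(y_s + 2 y_t, - y_t)\<close>, which leaves the sum unchanged. It also keeps the pairing
  with one of them positive when the other is a descent.\<close>

lemma rho_sign:
  assumes "x \<in> W" "t \<in> S"
  shows "(dl t x \<longrightarrow> rho x ones (t, True) < 0 \<and>
      (\<forall>s\<in>S. s * t \<noteq> t * s \<longrightarrow> rho x ones (s, True) + rho x ones (t, True) > 0)) \<and>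
    (\<not> dl t x \<longrightarrow> rho x ones (t, True) > 0)"
  using assms
proof (induction "len x" arbitrary: x t rule: less_induct)
  case less
  have desc: "rho x ones (t, True) < 0 \<and> (\<forall>s\<in>S. s * t \<noteq> t * s \<longrightarrow> rho x ones (s, True) + rho x ones (t, True) > 0)"
    if t: "t \<in> S" "dl t x" for t
  proof -
    let ?y = "t * x"
    have y: "?y \<in> W" "len ?y < len x" "\<not> dl t ?y" using less.prems t len_dl[of x t] by auto
    have IH: "\<And>s. s \<in> S \<Longrightarrow> (dl s ?y \<longrightarrow> rho ?y ones (s, True) < 0 \<and>
      (\<forall>r\<in>S. r * s \<noteq> s * r \<longrightarrow> rho ?y ones (r, True) + rho ?y ones (s, True) > 0)) \<and>
      (\<not> dl s ?y \<longrightarrow> rho ?y ones (s, True) > 0)" using less.hyps y by blast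
    have x: "rho x ones = act t (rho ?y ones)" using rho_gen_mult[of t ?y ones] t y by simp
    have pos: "rho ?y ones (t, True) > 0" using IH[OF t(1)] y by simp
    have "rho x ones (s, True) + rho x ones (t, True) > 0" if s: "s \<in> S" "s * t \<noteq> t * s" for s
    proof -
      have "coroot t (s, True) = -2" using s by (auto simp: coroot_def)
      moreover have "rho ?y ones (s, True) + rho ?y ones (t, True) > 0"
        using IH[OF s(1)] pos s t by (cases "dl s ?y") auto
      ultimately show ?thesis unfolding x act_def by simp
    qed
    moreover have "rho x ones (t, True) < 0" using pos unfolding x act_def by simp
    ultimately show ?thesis by blast
  qed
  have "rho x ones (t, True) > 0" if nt: "\<not> dl t x"
  proof (cases "x = 1")
    case True then show ?thesis by (simp add: ones_def)
  next
    case False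
    then obtain s where s: "s \<in> S" "dl s x" using ex_dl less.prems by blast
    have "s \<noteq> t" using s nt by auto
    show ?thesis
    proof (cases "s * t = t * s")
      case False
      then show ?thesis using desc[OF s] less.prems(2) by fastforce
    next
      case True
      have y: "s * x \<in> W" "len (s * x) < len x" using less.prems s len_dl[of x s] by auto
      have "\<not> dl t (s * x)" using dl_commute[of t s x] True \<open>s \<noteq> t\<close> s less.prems nt by simp
      then have "rho (s * x) ones (t, True) > 0" using less.hyps y less.prems by blast
      moreover have "rho x ones = act s (rho (s * x) ones)" using rho_gen_mult[of s "s * x" ones] s y by simp
      moreover have "coroot s (t, True) = 0" using True \<open>s \<noteq> t\<close> by (auto simp: coroot_def)
      ultimately show ?thesis by (simp add: act_def)
    qed
  qed
  then show ?case using desc less.prems by blast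
qed

lemma dl_iff_sign: "x \<in> W \<Longrightarrow> t \<in> S \<Longrightarrow> dl t x \<longleftrightarrow> rho x ones (t, True) < 0"
  using rho_sign[of x t] by force

lemma dl_commutes: assumes "x \<in> W" "s \<in> S" "t \<in> S" "dl s x" "dl t x" shows "s * t = t * s"
proof (rule ccontr)
  assume "s * t \<noteq> t * s"
  then show False using rho_sign[of x s] rho_sign[of x t] assms by fastforce
qed

lemma dr_commutes: "x \<in> W \<Longrightarrow> s \<in> S \<Longrightarrow> t \<in> S \<Longrightarrow> dr s x \<Longrightarrow> dr t x \<Longrightarrow> s * t = t * s"
  using dl_commutes[of "ginv x" s t] by simp

lemma rho_faithful: assumes "x \<in> W" "y \<in> W" "rho x ones = rho y ones" shows "x = y"
proof -
  have W: "ginv y * x \<in> W" using assms by simp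
  have "rho (ginv y * x) ones = ones" using assms by (simp add: rho_mult)
  then have "\<not> dl s (ginv y * x)" if "s \<in> S" for s using dl_iff_sign[OF W that] by (simp add: ones_def)
  then have "ginv y * x = 1" using ex_dl W by blast
  then have "y * (ginv y * x) = y" by simp
  then show ?thesis by simp
qed

text \<open>Along a reduced word every letter subtracts a positive multiple of its
  \<open>coroot\<close>, so nothing cancels and the \<open>False\<close> coordinate of each letter
  used is negative.\<close>

lemma rho_support:
  assumes "x \<in> W" "\<And>q. q \<notin> Q \<Longrightarrow> rho x ones (q, False) = 0" "Q \<subseteq> S"
  shows "x \<in> prod_list ` lists Q"
proof -
  have "\<exists>w\<in>lists S. prod_list w = x \<and> (\<forall>q. rho x ones (q, False) \<le> 0 \<and> (q \<in> set w \<longrightarrow> rho x ones (q, False) < 0))"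
    using assms(1)
  proof (induction rule: W_left_induct)
    case one then show ?case by (intro bexI[of _ "[]"]) (auto simp: ones_def)
  next
    case (gen s y)
    then obtain w where w: "w \<in> lists S" "prod_list w = y"
      "\<forall>q. rho y ones (q, False) \<le> 0 \<and> (q \<in> set w \<longrightarrow> rho y ones (q, False) < 0)" by blast
    have "rho y ones (s, True) > 0" using rho_sign[of y s] gen by blast
    then have "rho (s * y) ones (q, False) \<le> 0 \<and> (q \<in> set (s # w) \<longrightarrow> rho (s * y) ones (q, False) < 0)" for q
      using spec[OF w(3), of q] gen.hyps by (cases "q = s") (simp_all add: rho_gen_mult act_def)
    then show ?case using w gen.hyps by (intro bexI[of _ "s # w"]) auto
  qed
  then obtain w where w: "w \<in> lists S" "prod_list w = x" "\<And>q. q \<in> set w \<Longrightarrow> rho x ones (q, False) < 0" by blast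
  have "w \<in> lists Q" using w(3) assms(2) by (metis in_listsI less_irrefl)
  then show ?thesis using w by blast
qed

text \<open>\<open>v\<close> is a root vector of the reflection \<open>t\<close> and
  \<open>L\<close> the pairing with it, as in the formula \<open>rho_root\<close>. It is a relation
  because \<open>w\<close> and \<open>s\<close> are not determined by \<open>t\<close>.\<close>

definition is_root :: "'g \<Rightarrow> ('g \<times> bool \<Rightarrow> real) \<Rightarrow> (('g \<times> bool \<Rightarrow> real) \<Rightarrow> real) \<Rightarrow> bool" where
  "is_root t v L \<longleftrightarrow> (\<exists>w\<in>W. \<exists>s\<in>S. t = w * s * ginv w \<and> v = rho w (coroot s) \<and> L = (\<lambda>f. rho (ginv w) f (s, True)))"

lemma is_root_exists: "t \<in> T \<Longrightarrow> \<exists>v L. is_root t v L"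
  unfolding is_root_def by (elim T_cases) blast

lemma is_root_T: "is_root t v L \<Longrightarrow> t \<in> T"
  unfolding is_root_def T_def by blast

lemma rho_diff: "x \<in> W \<Longrightarrow> rho x (\<lambda>i. f i - c * g i) = (\<lambda>i. rho x f i - c * rho x g i)"
  using rho_linear[of x 1 f "-c" g] by simp

lemma rho_root: assumes "is_root t v L" shows "rho t f = (\<lambda>i. f i - L f * v i)"
proof -
  obtain w s where w: "w \<in> W" "s \<in> S" "t = w * s * ginv w" "v = rho w (coroot s)"
    "L = (\<lambda>f. rho (ginv w) f (s, True))" using assms by (auto simp: is_root_def)
  have "rho t f = rho w (act s (rho (ginv w) f))" using w by (simp add: rho_mult rho_gen)
  also have "\<dots> = (\<lambda>i. f i - L f * v i)" unfolding act_def using rho_diff[OF w(1)] w by simp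
  finally show ?thesis .
qed

lemma root_linear: assumes "is_root t v L" shows "L (\<lambda>i. a * f i + b * g i) = a * L f + b * L g"
proof -
  obtain w s where w: "w \<in> W" "s \<in> S" "L = (\<lambda>f. rho (ginv w) f (s, True))" using assms by (auto simp: is_root_def)
  show ?thesis using rho_linear[of "ginv w"] w by simp
qed

lemma root_norm: assumes "is_root t v L" shows "L v = 2"
proof -
  obtain w s where w: "w \<in> W" "s \<in> S" "v = rho w (coroot s)" "L = (\<lambda>f. rho (ginv w) f (s, True))"
    using assms by (auto simp: is_root_def)
  then show ?thesis by simp
qed

text \<open>The same coefficients express the vector in the \<open>coroot\<close> vectors and the
  functional in the simple pairings. Allowing every finite \<open>F\<close> above \<open>F0\<close>
  lets several roots be summed over a common index set.\<close>

definition expansion :: "('g \<times> bool \<Rightarrow> real) \<Rightarrow> (('g \<times> bool \<Rightarrow> real) \<Rightarrow> real) \<Rightarrow> ('g \<Rightarrow> real) \<Rightarrow> 'g set \<Rightarrow> bool" where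
  "expansion v L c F0 \<longleftrightarrow> finite F0 \<and> (\<forall>r. r \<notin> F0 \<longrightarrow> c r = 0) \<and> (\<forall>F. finite F \<longrightarrow> F0 \<subseteq> F \<longrightarrow>
    (\<forall>i. v i = (\<Sum>r\<in>F. c r * coroot r i)) \<and> (\<forall>f. L f = (\<Sum>r\<in>F. c r * f (r, True))))"

lemma expansionD:
  assumes "expansion v L c F0"
  shows "finite F0" "r \<notin> F0 \<Longrightarrow> c r = 0"
    "finite F \<Longrightarrow> F0 \<subseteq> F \<Longrightarrow> v i = (\<Sum>r\<in>F. c r * coroot r i)"
    "finite F \<Longrightarrow> F0 \<subseteq> F \<Longrightarrow> L f = (\<Sum>r\<in>F. c r * f (r, True))"
  using assms unfolding expansion_def by blast+

lemma expansion_exists: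
  assumes "w \<in> W" "s \<in> S"
  shows "\<exists>c F0. expansion (rho w (coroot s)) (\<lambda>f. rho (ginv w) f (s, True)) c F0"
  using assms(1)
proof (induction rule: W_left_induct)
  case one
  show ?case
  proof (rule exI[of _ "\<lambda>r. of_bool (r = s)"], rule exI[of _ "{s}"])
    have "(\<Sum>r\<in>F. of_bool (r = s) * h r) = h s" if "finite F" "{s} \<subseteq> F" for F and h :: "'g \<Rightarrow> real"
    proof -
      have "(\<Sum>r\<in>F. of_bool (r = s) * h r) = (\<Sum>r\<in>F. if r = s then h r else 0)" by (intro sum.cong) auto
      then show ?thesis using that by (simp add: sum.delta)
    qed
    then show "expansion (rho 1 (coroot s)) (\<lambda>f. rho (ginv 1) f (s, True)) (\<lambda>r. of_bool (r = s)) {s}"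
      unfolding expansion_def by simp
  qed
next
  case (gen u y)
  then obtain c F0 where E: "expansion (rho y (coroot s)) (\<lambda>f. rho (ginv y) f (s, True)) c F0" by blast
  note c = expansionD(1,2)[OF E] and e = expansionD(3,4)[OF E]
  define k where "k = rho y (coroot s) (u, True)"
  define c' where "c' r = c r - of_bool (r = u) * k" for r
  show ?case
  proof (rule exI[of _ c'], rule exI[of _ "insert u F0"], unfold expansion_def, intro conjI allI impI)
    show "finite (insert u F0)" using c by simp
    show "c' r = 0" if "r \<notin> insert u F0" for r using that c by (simp add: c'_def)
    fix F assume F: "finite F" "insert u F0 \<subseteq> F"
    have sum': "(\<Sum>r\<in>F. c' r * h r) = (\<Sum>r\<in>F. c r * h r) - k * h u" for h
    proof -
      have "(\<Sum>r\<in>F. c' r * h r) = (\<Sum>r\<in>F. c r * h r) - (\<Sum>r\<in>F. of_bool (r = u) * k * h r)"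
        by (simp add: c'_def left_diff_distrib sum_subtractf)
      also have "(\<Sum>r\<in>F. of_bool (r = u) * k * h r) = (\<Sum>r\<in>F. if r = u then k * h r else 0)"
        by (intro sum.cong) auto
      also have "\<dots> = k * h u" using F by (simp add: sum.delta)
      finally show ?thesis .
    qed
    show "rho (u * y) (coroot s) i = (\<Sum>r\<in>F. c' r * coroot r i)" for i
    proof -
      have "rho (u * y) (coroot s) i = rho y (coroot s) i - k * coroot u i"
        using gen.hyps by (simp add: rho_gen_mult act_def k_def)
      then show ?thesis using e(1)[of F i] F sum'[of "\<lambda>r. coroot r i"] by simp
    qed
    show "rho (ginv (u * y)) f (s, True) = (\<Sum>r\<in>F. c' r * f (r, True))" for f
    proof -
      have "rho (ginv (u * y)) f (s, True) = rho (ginv y) (act u f) (s, True)"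
        using gen.hyps by (simp add: rho_mult rho_gen)
      also have "\<dots> = (\<Sum>r\<in>F. c r * act u f (r, True))" using e(2) F by simp
      also have "\<dots> = (\<Sum>r\<in>F. c r * f (r, True)) - f (u, True) * (\<Sum>r\<in>F. c r * coroot r (u, True))"
        by (simp add: act_def right_diff_distrib sum_subtractf sum_distrib_left coroot_sym[of u] mult.left_commute)
      also have "(\<Sum>r\<in>F. c r * coroot r (u, True)) = k" using e(1)[of F "(u, True)"] F by (simp add: k_def)
      finally show ?thesis using sum'[of "\<lambda>r. f (r, True)"] by simp
    qed
  qed
qed

text \<open>The \<open>False\<close> coordinates exist for this purpose: they read off the
  coefficients.\<close>

lemma root_expansion:
  assumes "is_root t v L" shows "\<exists>F0. expansion v L (\<lambda>r. v (r, False)) F0"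
proof -
  obtain w s where w: "w \<in> W" "s \<in> S" "v = rho w (coroot s)" "L = (\<lambda>f. rho (ginv w) f (s, True))"
    using assms by (auto simp: is_root_def)
  obtain c F0 where E: "expansion v L c F0" using expansion_exists[OF w(1,2)] w(3,4) by blast
  note c = expansionD(1,2)[OF E] and e = expansionD(3,4)[OF E]
  have "v (q, False) = c q" for q
  proof -
    have "v (q, False) = (\<Sum>r\<in>insert q F0. c r * of_bool (q = r))" using e(1)[of "insert q F0" "(q, False)"] c by auto
    also have "\<dots> = (\<Sum>r\<in>insert q F0. if r = q then c r else 0)" by (intro sum.cong) auto
    also have "\<dots> = c q" using c by (subst sum.delta) auto
    finally show ?thesis .
  qed
  then have "(\<lambda>r. v (r, False)) = c" by auto
  then show ?thesis using E by auto
qed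

lemma root_sym:
  assumes "is_root t1 v1 L1" "is_root t2 v2 L2" shows "L1 v2 = L2 v1"
proof -
  obtain F1 F2 where E: "expansion v1 L1 (\<lambda>r. v1 (r, False)) F1" "expansion v2 L2 (\<lambda>r. v2 (r, False)) F2"
    using root_expansion assms by blast
  note F1 = expansionD(1,4,3)[OF E(1)] and F2 = expansionD(1,4,3)[OF E(2)]
  let ?F = "F1 \<union> F2"
  have f: "finite ?F" using F1(1) F2(1) by simp
  have x: "v2 (r, True) = (\<Sum>q\<in>?F. v2 (q, False) * coroot q (r, True))" for r by (rule F2(3)[OF f]) simp
  have y: "v1 (r, True) = (\<Sum>q\<in>?F. v1 (q, False) * coroot q (r, True))" for r by (rule F1(3)[OF f]) simp
  have "L1 v2 = (\<Sum>r\<in>?F. v1 (r, False) * (\<Sum>q\<in>?F. v2 (q, False) * coroot q (r, True)))"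
    unfolding x[symmetric] by (rule F1(2)[OF f]) simp
  also have "\<dots> = (\<Sum>q\<in>?F. v2 (q, False) * (\<Sum>r\<in>?F. v1 (r, False) * coroot r (q, True)))"
    unfolding sum_distrib_left by (subst sum.swap) (simp add: coroot_sym mult.left_commute)
  also have "\<dots> = L2 v1" unfolding y[symmetric] by (rule F2(2)[OF f, symmetric]) simp
  finally show ?thesis .
qed

text \<open>A linear relation between root vectors holds for their coefficients, and these also
  determine the functionals.\<close>

lemma root_combination:
  assumes r: "is_root t1 v1 L1" "is_root t2 v2 L2" "is_root t3 v3 L3"
    and v: "\<And>i. v3 i = a * v1 i + b * v2 i"
  shows "L3 f = a * L1 f + b * L2 f"
proof -
  obtain F1 F2 F3 where E: "expansion v1 L1 (\<lambda>r. v1 (r, False)) F1" "expansion v2 L2 (\<lambda>r. v2 (r, False)) F2"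
    "expansion v3 L3 (\<lambda>r. v3 (r, False)) F3"
    using root_expansion[OF r(1)] root_expansion[OF r(2)] root_expansion[OF r(3)] by blast
  note F1 = expansionD(1,4)[OF E(1)] and F2 = expansionD(1,4)[OF E(2)] and F3 = expansionD(1,4)[OF E(3)]
  let ?F = "F1 \<union> F2 \<union> F3"
  have f: "finite ?F" using F1(1) F2(1) F3(1) by simp
  have "L3 f = (\<Sum>r\<in>?F. (a * v1 (r, False) + b * v2 (r, False)) * f (r, True))"
    unfolding v[symmetric] by (rule F3(2)[OF f]) auto
  also have "\<dots> = a * (\<Sum>r\<in>?F. v1 (r, False) * f (r, True)) + b * (\<Sum>r\<in>?F. v2 (r, False) * f (r, True))"
    by (simp add: distrib_right sum.distrib sum_distrib_left mult.assoc)
  also have "(\<Sum>r\<in>?F. v1 (r, False) * f (r, True)) = L1 f" by (rule F1(2)[OF f, symmetric]) auto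
  also have "(\<Sum>r\<in>?F. v2 (r, False) * f (r, True)) = L2 f" by (rule F2(2)[OF f, symmetric]) auto
  finally show ?thesis .
qed

text \<open>If the functionals were proportional, then crossing the wall of \<open>t\<^sub>1\<close> along a single edge would also cross the wall of \<open>t\<^sub>2\<close>.\<close>

lemma root_independent:
  assumes r: "is_root t1 v1 L1" "is_root t2 v2 L2" and ne: "t1 \<noteq> t2"
  shows "\<exists>f. L1 f = 1 \<and> L2 f = 0"
proof (rule ccontr)
  assume no: "\<nexists>f. L1 f = 1 \<and> L2 f = 0"
  have z: "L1 f = 0" if "L2 f = 0" for f
  proof (rule ccontr)
    assume "L1 f \<noteq> 0"
    then have "L1 (\<lambda>i. (1 / L1 f) * f i + 0 * f i) = 1 \<and> L2 (\<lambda>i. (1 / L1 f) * f i + 0 * f i) = 0"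
      using that unfolding root_linear[OF r(1)] root_linear[OF r(2)] by simp
    then show False using no by blast
  qed
  define c where "c = L1 v2 / 2"
  have scal: "L1 f = c * L2 f" for f
  proof -
    have "L2 (\<lambda>i. 1 * f i + (- L2 f / 2) * v2 i) = 0" unfolding root_linear[OF r(2)] using root_norm[OF r(2)] by simp
    from z[OF this] show ?thesis unfolding root_linear[OF r(1)] by (simp add: c_def)
  qed
  obtain w1 s1 where w1: "w1 \<in> W" "s1 \<in> S" "t1 = w1 * s1 * ginv w1" "L1 = (\<lambda>f. rho (ginv w1) f (s1, True))"
    using r(1) by (auto simp: is_root_def)
  obtain w2 s2 where w2: "w2 \<in> W" "s2 \<in> S" "t2 = w2 * s2 * ginv w2" "L2 = (\<lambda>f. rho (ginv w2) f (s2, True))"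
    using r(2) by (auto simp: is_root_def)
  define h where "h = ginv w2 * w1"
  have h: "h \<in> W" using w1 w2 by (simp add: h_def)
  have a: "L1 (rho w1 ones) = 1" "L1 (rho (w1 * s1) ones) = -1"
    using w1 by (simp_all add: rho_mult rho_gen act_def ones_def)
  have b: "L2 (rho w1 ones) = rho h ones (s2, True)" "L2 (rho (w1 * s1) ones) = rho (h * s1) ones (s2, True)"
    using w1 w2 by (simp_all add: rho_mult h_def)
  have "c * rho h ones (s2, True) = 1" "c * rho (h * s1) ones (s2, True) = -1"
    using a b scal by simp_all
  then have "rho h ones (s2, True) < 0 \<longleftrightarrow> \<not> rho (h * s1) ones (s2, True) < 0"
    by (smt (verit) mult_neg_neg mult_nonneg_nonneg mult_nonneg_nonpos mult_nonpos_nonneg)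
  then have opp: "dl s2 h \<longleftrightarrow> \<not> dl s2 (h * s1)" using dl_iff_sign[of h s2] dl_iff_sign[of "h * s1" s2] h w1 w2 by simp
  \<comment> \<open>The right \<open>s1\<close>-edge at \<open>h\<close> changes the descent
    \<open>s2\<close>. If it were different from the left \<open>s2\<close>-edge,
    \<open>arrow_gen_mult_right\<close> would carry the latter along it with unchanged
    direction.\<close>
  have "s2 * h = h * s1"
  proof (rule ccontr)
    assume ne: "s2 * h \<noteq> h * s1"
    have up: "arrow z (s2 * z) \<longleftrightarrow> \<not> dl s2 z" if "z \<in> W" for z
      using that w2 len_dl[of z s2] len_not_dl[of z s2] by (cases "dl s2 z") (auto simp: arrow_def)
    have ne': "h \<noteq> s2 * (h * s1)" using ne w2 by (metis sq_assoc)
    consider "arrow h (s2 * h)" | "arrow (s2 * h) h" using adj_arrow[of h "s2 * h"] h w2 by auto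
    then show False
    proof cases
      case 1
      then have "arrow (h * s1) (s2 * h * s1)" using arrow_gen_mult_right ne w1 by blast
      then show False using up[of h] up[of "h * s1"] 1 opp h w1 by (simp add: mult.assoc)
    next
      case 2
      have "h \<noteq> s2 * h * s1" using ne' by (simp add: mult.assoc)
      then have "arrow (s2 * h * s1) (h * s1)" using arrow_gen_mult_right[OF 2 w1(2)] by blast
      then have "dl s2 h" "dl s2 (h * s1)" using arrow_len[OF 2] by (auto simp: dl_def mult.assoc dest: arrow_len)
      then show False using opp by simp
    qed
  qed
  then have "w2 * (s2 * h) * ginv w1 = w2 * (h * s1) * ginv w1" by simp
  then have "t2 = t1" using w1 w2 unfolding h_def by (simp add: mult.assoc)
  then show False using ne by simp
qed

text \<open>Both sides of \<open>t1 * t2 = a1 * a2\<close> are evaluated on vectors dual to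
  \<open>L1\<close> and \<open>L2\<close>, supplied by \<open>root_independent\<close>; this solves
  for \<open>v1\<close> and then \<open>v2\<close>.\<close>

lemma root_in_span:
  assumes r: "is_root t1 v1 L1" "is_root t2 v2 L2" "is_root a1 u1 K1" "is_root a2 u2 K2"
    and ne: "t1 \<noteq> t2" and eq: "t1 * t2 = a1 * a2"
  shows "\<exists>a b. \<forall>i. v1 i = a * u1 i + b * u2 i" "\<exists>a b. \<forall>i. v2 i = a * u1 i + b * u2 i"
proof -
  note T = is_root_T[OF r(1)] is_root_T[OF r(2)] is_root_T[OF r(3)] is_root_T[OF r(4)]
  have rt: "rho (t1 * t2) f = (\<lambda>i. f i - L2 f * v2 i - (L1 f - L2 f * L1 v2) * v1 i)" for f
  proof -
    have "L1 (\<lambda>i. f i - L2 f * v2 i) = L1 f - L2 f * L1 v2"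
      using root_linear[OF r(1), of 1 f "- L2 f" v2] by simp
    then show ?thesis using T by (simp add: rho_mult rho_root[OF r(1)] rho_root[OF r(2)])
  qed
  have ra: "rho (a1 * a2) f = (\<lambda>i. f i - K2 f * u2 i - (K1 f - K2 f * K1 u2) * u1 i)" for f
  proof -
    have "K1 (\<lambda>i. f i - K2 f * u2 i) = K1 f - K2 f * K1 u2"
      using root_linear[OF r(3), of 1 f "- K2 f" u2] by simp
    then show ?thesis using T by (simp add: rho_mult rho_root[OF r(3)] rho_root[OF r(4)])
  qed
  have e: "L2 f * v2 i + (L1 f - L2 f * L1 v2) * v1 i = K2 f * u2 i + (K1 f - K2 f * K1 u2) * u1 i" for f i
  proof -
    have "rho (t1 * t2) f i = rho (a1 * a2) f i" using eq by simp
    then show ?thesis unfolding rt ra by simp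
  qed
  obtain f where f: "L1 f = 1" "L2 f = 0" using root_independent[OF r(1,2) ne] by blast
  have v1: "v1 i = (K1 f - K2 f * K1 u2) * u1 i + K2 f * u2 i" for i using e[of f i] f by simp
  then show "\<exists>a b. \<forall>i. v1 i = a * u1 i + b * u2 i" by blast
  obtain g where g: "L2 g = 1" "L1 g = 0" using root_independent[OF r(2,1)] ne by blast
  have "v2 i = (K1 g - K2 g * K1 u2 + L1 v2 * (K1 f - K2 f * K1 u2)) * u1 i + (K2 g + L1 v2 * K2 f) * u2 i" for i
    using e[of g i] g v1[of i] by (simp add: algebra_simps)
  then show "\<exists>a b. \<forall>i. v2 i = a * u1 i + b * u2 i" by blast
qed

definition plane :: "('g \<times> bool \<Rightarrow> real) \<Rightarrow> ('g \<times> bool \<Rightarrow> real) \<Rightarrow> ('g \<times> bool \<Rightarrow> real) set" where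
  "plane v1 v2 = {f. \<exists>a b. \<forall>i. f i = a * v1 i + b * v2 i}"

lemma planeI: "(\<And>i. f i = a * v1 i + b * v2 i) \<Longrightarrow> f \<in> plane v1 v2"
  unfolding plane_def by blast

lemma plane_combination:
  assumes "f \<in> plane v1 v2" "g \<in> plane v1 v2" shows "(\<lambda>i. a * f i + b * g i) \<in> plane v1 v2"
proof -
  obtain a1 b1 a2 b2 where "\<And>i. f i = a1 * v1 i + b1 * v2 i" "\<And>i. g i = a2 * v1 i + b2 * v2 i"
    using assms unfolding plane_def by blast
  then show ?thesis by (intro planeI[of _ "a * a1 + b * a2" _ "a * b1 + b * b2"]) (simp add: algebra_simps)
qed

lemma plane_gen [simp]: "v1 \<in> plane v1 v2" "v2 \<in> plane v1 v2"
  by (auto intro: planeI[of _ 1 _ 0] planeI[of _ 0 _ 1])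

lemma plane_mono: assumes "u1 \<in> plane v1 v2" "u2 \<in> plane v1 v2" "f \<in> plane u1 u2" shows "f \<in> plane v1 v2"
proof -
  obtain a b where "\<And>i. f i = a * u1 i + b * u2 i" using assms(3) unfolding plane_def by blast
  then have "f = (\<lambda>i. a * u1 i + b * u2 i)" by auto
  then show ?thesis using plane_combination assms by blast
qed

end

text \<open>\<open>k\<close> is the pairing of the two spanning roots, and the hypotheses normalise
  the roots with coefficients \<open>(a, b)\<close> and \<open>(c, d)\<close>. \<open>R\<close> is
  the effect of a reflection on the two pairings of a vector, \<open>D\<close> the coefficients of
  what it subtracts; the first root is \<open>(1, 0)\<close>.\<close>

lemma three_coplanar_reflections:
  fixes k x y a b c d p q :: real
  assumes "a^2 + b^2 + k * a * b = 1" "c^2 + d^2 + k * c * d = 1"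
  defines "R \<equiv> \<lambda>\<alpha> \<beta> (x, y). (x - (\<alpha> * x + \<beta> * y) * (2 * \<alpha> + k * \<beta>), y - (\<alpha> * x + \<beta> * y) * (k * \<alpha> + 2 * \<beta>))"
    and "D \<equiv> \<lambda>\<alpha> \<beta> (x, y). ((\<alpha> * x + \<beta> * y) * \<alpha>, (\<alpha> * x + \<beta> * y) * \<beta>)"
  shows "fst (D 1 0 (x, y)) + fst (D a b (R 1 0 (x, y))) + fst (D c d (R a b (R 1 0 (x, y)))) =
     fst (D c d (x, y)) + fst (D a b (R c d (x, y))) + fst (D 1 0 (R a b (R c d (x, y))))"
    "snd (D 1 0 (x, y)) + snd (D a b (R 1 0 (x, y))) + snd (D c d (R a b (R 1 0 (x, y)))) =
     snd (D c d (x, y)) + snd (D a b (R c d (x, y))) + snd (D 1 0 (R a b (R c d (x, y))))"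
proof -
  show "fst (D 1 0 (x, y)) + fst (D a b (R 1 0 (x, y))) + fst (D c d (R a b (R 1 0 (x, y)))) =
     fst (D c d (x, y)) + fst (D a b (R c d (x, y))) + fst (D 1 0 (R a b (R c d (x, y))))"
    unfolding R_def D_def prod.case fst_conv using assms(1,2) by algebra
  show "snd (D 1 0 (x, y)) + snd (D a b (R 1 0 (x, y))) + snd (D c d (R a b (R 1 0 (x, y)))) =
     snd (D c d (x, y)) + snd (D a b (R c d (x, y))) + snd (D 1 0 (R a b (R c d (x, y))))"
    unfolding R_def D_def prod.case snd_conv using assms(1,2) by algebra
qed

text \<open>The identity matrix of size three does not factor through dimension two.\<close>

lemma no_three_independent:
  fixes a b c d e f x1 x2 x3 y1 y2 y3 :: real
  assumes "a * x1 + b * y1 = 1" "a * x2 + b * y2 = 0" "a * x3 + b * y3 = 0"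
    "c * x1 + d * y1 = 0" "c * x2 + d * y2 = 1" "c * x3 + d * y3 = 0"
    "e * x1 + f * y1 = 0" "e * x2 + f * y2 = 0" "e * x3 + f * y3 = 1"
  shows False
  using assms by algebra

context right_angled_coxeter
begin

text \<open>A product of three reflections of a plane is its own inverse. The computation uses only
  the pairings with \<open>v1\<close> and \<open>v2\<close>, so it covers a degenerate form on the
  plane as well, and \<open>rho_faithful\<close> returns to the group.\<close>

lemma coplanar_reflections_commute:
  assumes r: "is_root t1 v1 L1" "is_root t2 v2 L2" "is_root a va La" "is_root c vc Lc"
    and pl: "va \<in> plane v1 v2" "vc \<in> plane v1 v2"
  shows "c * a * t1 = t1 * a * c"
proof -
  note T = is_root_T[OF r(1)] is_root_T[OF r(2)] is_root_T[OF r(3)] is_root_T[OF r(4)]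
  define k where "k = L1 v2"
  have n: "L1 v1 = 2" "L2 v2 = 2" "L1 v2 = k" "L2 v1 = k"
    using root_norm[OF r(1)] root_norm[OF r(2)] root_sym[OF r(1,2)] by (simp_all add: k_def)
  define R where "R = (\<lambda>\<alpha> \<beta> (x, y). (x - (\<alpha> * x + \<beta> * y) * (2 * \<alpha> + k * \<beta>), y - (\<alpha> * x + \<beta> * y) * (k * \<alpha> + 2 * \<beta>)))"
  define D where "D = (\<lambda>(\<alpha>::real) \<beta> (x, y). ((\<alpha> * x + \<beta> * y) * \<alpha>, (\<alpha> * x + \<beta> * y) * \<beta>))"
  define co where "co f = (L1 f, L2 f)" for f
  have coords: "rho u f i = f i - (fst (D \<alpha> \<beta> (co f)) * v1 i + snd (D \<alpha> \<beta> (co f)) * v2 i)"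
    "co (rho u f) = R \<alpha> \<beta> (co f)" "\<alpha>^2 + \<beta>^2 + k * \<alpha> * \<beta> = 1"
    if u: "is_root u w K" "\<And>i. w i = \<alpha> * v1 i + \<beta> * v2 i" for u w K f i \<alpha> \<beta>
  proof -
    have K: "K g = \<alpha> * L1 g + \<beta> * L2 g" for g using root_combination[OF r(1,2) u(1) u(2)] .
    have weq: "w = (\<lambda>i. \<alpha> * v1 i + \<beta> * v2 i)" using u(2) by auto
    have Lw: "L1 w = 2 * \<alpha> + k * \<beta>" "L2 w = k * \<alpha> + 2 * \<beta>"
      unfolding weq root_linear[OF r(1)] root_linear[OF r(2)] n by simp_all
    have rf: "rho u f = (\<lambda>i. f i - (\<alpha> * L1 f + \<beta> * L2 f) * w i)" unfolding rho_root[OF u(1)] K ..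
    show "rho u f i = f i - (fst (D \<alpha> \<beta> (co f)) * v1 i + snd (D \<alpha> \<beta> (co f)) * v2 i)"
      unfolding rf u(2) by (simp add: D_def co_def algebra_simps)
    have lin: "L1 (\<lambda>i. f i - z * w i) = L1 f - z * L1 w" "L2 (\<lambda>i. f i - z * w i) = L2 f - z * L2 w" for z
      using root_linear[OF r(1), of 1 f "-z" w] root_linear[OF r(2), of 1 f "-z" w] by simp_all
    show "co (rho u f) = R \<alpha> \<beta> (co f)"
      unfolding rf by (simp add: co_def R_def lin Lw)
    have "K w = 2" using root_norm[OF u(1)] .
    then show "\<alpha>^2 + \<beta>^2 + k * \<alpha> * \<beta> = 1" unfolding K Lw by (simp add: algebra_simps power2_eq_square)
  qed
  obtain \<alpha> \<beta> where va: "\<And>i. va i = \<alpha> * v1 i + \<beta> * v2 i" using pl(1) unfolding plane_def by blast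
  obtain \<gamma> \<delta> where vc: "\<And>i. vc i = \<gamma> * v1 i + \<delta> * v2 i" using pl(2) unfolding plane_def by blast
  have v1: "v1 i = 1 * v1 i + 0 * v2 i" for i by simp
  note ct = coords[OF r(1) v1] and ca = coords[OF r(3) va] and cc = coords[OF r(4) vc]
  have "rho (c * a * t1) f i = rho (t1 * a * c) f i" for f i
  proof -
    have "rho (c * a * t1) f i = f i
        - ((fst (D 1 0 (co f)) + fst (D \<alpha> \<beta> (R 1 0 (co f))) + fst (D \<gamma> \<delta> (R \<alpha> \<beta> (R 1 0 (co f))))) * v1 i
         + (snd (D 1 0 (co f)) + snd (D \<alpha> \<beta> (R 1 0 (co f))) + snd (D \<gamma> \<delta> (R \<alpha> \<beta> (R 1 0 (co f))))) * v2 i)"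
      using T by (simp add: rho_mult ct(1,2) ca(1,2) cc(1,2) distrib_right)
    also have "\<dots> = f i
        - ((fst (D \<gamma> \<delta> (co f)) + fst (D \<alpha> \<beta> (R \<gamma> \<delta> (co f))) + fst (D 1 0 (R \<alpha> \<beta> (R \<gamma> \<delta> (co f))))) * v1 i
         + (snd (D \<gamma> \<delta> (co f)) + snd (D \<alpha> \<beta> (R \<gamma> \<delta> (co f))) + snd (D 1 0 (R \<alpha> \<beta> (R \<gamma> \<delta> (co f))))) * v2 i)"
      using three_coplanar_reflections[OF ca(3) cc(3), of "L1 f" "L2 f"] by (simp only: co_def R_def D_def)
    also have "\<dots> = rho (t1 * a * c) f i"
      using T by (simp add: rho_mult ct(1,2) ca(1,2) cc(1,2) distrib_right)
    finally show ?thesis .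
  qed
  then show ?thesis using T by (intro rho_faithful) auto
qed

text \<open>A left descent \<open>t\<close> of \<open>y\<close> is also one of \<open>e * y\<close>,
  together with \<open>e\<close>, so \<open>t\<close> and \<open>e\<close> commute. The induction
  can therefore strip \<open>t\<close>, which differs from \<open>e\<close> and so fixes the
  indicator.\<close>

lemma fixed_coordinate:
  assumes "y \<in> W" "e \<in> S" "\<not> dl e y" "e * y = y * e"
  shows "rho y (\<lambda>i. of_bool (i = (e, True))) = (\<lambda>i. of_bool (i = (e, True)))"
  using assms(1,3,4)
proof (induction "len y" arbitrary: y rule: less_induct)
  case less
  show ?case
  proof (cases "y = 1")
    case False
    then obtain t where t: "t \<in> S" "dl t y" using ex_dl less.prems by blast
    have te: "t \<noteq> e" using t less.prems by auto
    have y': "t * y \<in> W" "len (t * y) < len y" using t less.prems len_dl[of y t] by auto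
    have "len (t * (y * e)) \<le> len (t * y) + len e" using len_mult_le[OF y'(1), of e] assms(2) by (simp add: mult.assoc)
    also have "\<dots> = len y" using t less.prems len_dl[of y t] assms(2) by simp
    also have "\<dots> < len (e * y)" using len_not_dl[of y e] less.prems assms(2) by simp
    finally have "dl t (e * y)" using less.prems by (simp add: dl_def)
    moreover have "dl e (e * y)" using dl_gen_mult[of y e] less.prems(1,2) assms(2) by blast
    ultimately have c: "t * e = e * t" using dl_commutes[of "e * y" t e] t less.prems assms(2) by simp
    have "e * (t * y) = (t * y) * e" using c less.prems by (metis mult.assoc)
    moreover have "\<not> dl e (t * y)" using dl_commute[of e t y] c te t less.prems assms(2) by auto
    ultimately have IH: "rho (t * y) (\<lambda>i. of_bool (i = (e, True))) = (\<lambda>i. of_bool (i = (e, True)))"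
      using less.hyps y' by blast
    have "rho y f = act t (rho (t * y) f)" for f using rho_gen_mult[OF t(1) y'(1), of f] t by simp
    then show ?thesis using IH te by (simp add: act_def)
  qed simp
qed

text \<open>\<open>e * y\<close> fixes the indicator of \<open>(e, True)\<close>, so
  \<open>y\<close> moves it by exactly \<open>- coroot e\<close>.\<close>

lemma coroot_in_plane:
  assumes y: "y \<in> W" "e \<in> S" "dl e y" "e * y = y * e"
    and pl: "\<And>f. (\<lambda>i. rho y f i - f i) \<in> plane v1 v2"
  shows "coroot e \<in> plane v1 v2"
proof -
  let ?f = "\<lambda>i. of_bool (i = (e, True)) :: real"
  have "e * (e * y) = (e * y) * e" by (metis mult.assoc y(4))
  then have "rho (e * y) ?f = ?f"
    by (intro fixed_coordinate[of "e * y" e]) (use y(1-3) in simp_all)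
  moreover have "rho y ?f = act e (rho (e * y) ?f)" using rho_gen_mult[of e "e * y" ?f] y(1-3) by simp
  ultimately have "rho y ?f i - ?f i = - coroot e i" for i by (simp add: act_def)
  then have eq: "coroot e = (\<lambda>i. (-1) * (rho y ?f i - ?f i) + 0 * (rho y ?f i - ?f i))" by auto
  show ?thesis by (subst eq) (rule plane_combination[OF pl pl])
qed

lemma plane_no_three:
  assumes "coroot s \<in> plane v1 v2" "coroot t \<in> plane v1 v2" "coroot r \<in> plane v1 v2"
    "s \<noteq> t" "s \<noteq> r" "t \<noteq> r"
  shows False
proof -
  obtain a b where 1: "\<And>i. coroot s i = a * v1 i + b * v2 i" using assms(1) unfolding plane_def by blast
  obtain c d where 2: "\<And>i. coroot t i = c * v1 i + d * v2 i" using assms(2) unfolding plane_def by blast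
  obtain e f where 3: "\<And>i. coroot r i = e * v1 i + f * v2 i" using assms(3) unfolding plane_def by blast
  show False
    by (rule no_three_independent[of a "v1 (s, False)" b "v2 (s, False)" "v1 (t, False)" "v2 (t, False)"
          "v1 (r, False)" "v2 (r, False)" c d e f])
      (use assms(4-6) in \<open>simp_all add: 1[symmetric] 2[symmetric] 3[symmetric]\<close>)
qed

text \<open>An involution is conjugate to a product of pairwise commuting generators; the plane leaves room for at most two of them.\<close>

lemma odd_planar_involution:
  assumes "y \<in> W" "y * y = 1" "odd (len y)" "\<And>f. (\<lambda>i. rho y f i - f i) \<in> plane v1 v2"
  shows "y \<in> T"
  using assms
proof (induction "len y" arbitrary: y v1 v2 rule: less_induct)
  case less
  note y = less.prems
  have yi: "ginv y = y" using y(2) by (rule ginv_unique)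
  have "y \<noteq> 1" using y by auto
  then obtain s where s: "s \<in> S" "dl s y" using ex_dl y(1) by blast
  show ?case
  proof (cases "\<forall>e\<in>S. dl e y \<longrightarrow> e * y = y * e")
    case False
    \<comment> \<open>Conjugation by a descent that does not commute with \<open>y\<close> shortens
      the involution and carries the plane along by \<open>rho e\<close>.\<close>
    then obtain e where e: "e \<in> S" "dl e y" "e * y \<noteq> y * e" by blast
    have up: "arrow (e * y) y" using e y len_dl[of y e] by (intro arrowI) auto
    have "y \<noteq> e * y * e" using e by (metis mult.assoc sq_assoc)
    then have "arrow (e * y * e) (y * e)" using arrow_gen_mult_right[OF up e(1)] by simp
    moreover have "dr e y" using e y dl_ginv[of y e] yi by simp
    ultimately have l: "len (e * y * e) < len y" using arrow_len by (fastforce simp: dr_def)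
    have W: "e * y * e \<in> W" using e y by simp
    have "e * y * e * (e * y * e) = 1" using e y by (simp add: mult.assoc) (simp flip: mult.assoc)
    moreover have "odd (len (e * y * e))" using e y by (simp add: even_len_mult)
    moreover have "(\<lambda>i. rho (e * y * e) f i - f i) \<in> plane (rho e v1) (rho e v2)" for f
    proof -
      obtain a b where ab: "\<And>i. rho y (rho e f) i - rho e f i = a * v1 i + b * v2 i"
        using y(4)[of "rho e f"] unfolding plane_def by blast
      then have "rho y (rho e f) = (\<lambda>i. 1 * rho e f i + 1 * (a * v1 i + b * v2 i))" by (auto simp: fun_eq_iff algebra_simps)
      then have "rho (e * y * e) f = rho e (\<lambda>i. 1 * rho e f i + 1 * (a * v1 i + b * v2 i))"
        using e y by (simp add: rho_mult)
      also have "\<dots> = (\<lambda>i. rho e (rho e f) i + (a * rho e v1 i + b * rho e v2 i))"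
        using e by (subst rho_linear) (auto simp: rho_linear)
      also have "rho e (rho e f) = f" using e by (simp add: rho_gen act_act)
      finally show ?thesis by (intro planeI[of _ a _ b]) simp
    qed
    ultimately have "e * y * e \<in> T" using less.hyps[OF l W] by blast
    from T_conj[OF this, of e] show ?thesis using e by (simp add: mult.assoc)
  next
    case True
    have cs: "s * y = y * s" using True s by blast
    have y1: "s * y \<in> W" "len y = Suc (len (s * y))" "\<not> dl s (s * y)" using s y len_dl by auto
    show ?thesis
    proof (cases "s * y = 1")
      case True
      then have "s * (s * y) = s" by simp
      then show ?thesis using s by simp
    next
      case False
      then obtain t where t: "t \<in> S" "dl t (s * y)" using ex_dl y1 by blast
      have "t * y = t * (s * y) * s" using cs s by (simp add: mult.assoc)
      then have "len (t * y) \<le> len (t * (s * y)) + 1" using len_mult_le[of "t * (s * y)" s] t s y by simp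
      then have dt: "dl t y" using len_dl[OF y1(1) t] y1 by (simp add: dl_def)
      have ts: "t \<noteq> s" "s * t = t * s" using t y1 dl_commutes[OF y(1) s(1) t(1) s(2) dt] by auto
      have ct: "t * y = y * t" using True t dt \<open>\<forall>e\<in>S. dl e y \<longrightarrow> e * y = y * e\<close> by blast
      have y2: "t * (s * y) \<in> W" "len (s * y) = Suc (len (t * (s * y)))" using t y1 len_dl by auto
      \<comment> \<open>The length has dropped by two and is still odd, so a third commuting descent
        exists.\<close>
      have "t * (s * y) \<noteq> 1" using y2 y1 y(3) by auto
      then obtain r where r: "r \<in> S" "dl r (t * (s * y))" using ex_dl y2 by blast
      have "\<not> dl t (t * (s * y))" using t y1 by simp
      moreover have "\<not> dl s (t * (s * y))" using dl_commute[of s t "s * y"] ts s t y1 by auto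
      ultimately have rne: "r \<noteq> s" "r \<noteq> t" using r by auto
      have "y * s * t = s * (y * t)" by (simp add: cs[symmetric] mult.assoc)
      also have "\<dots> = s * (t * y)" by (simp add: ct)
      also have "\<dots> = t * (s * y)" using arg_cong[OF ts(2), of "\<lambda>a. a * y"] by (simp add: mult.assoc)
      finally have yst: "y * s * t = t * (s * y)" .
      have "r * y = r * (y * s * t) * (t * s)" using s t by (simp add: mult.assoc)
      then have "r * y = (r * (t * (s * y))) * (t * s)" unfolding yst .
      then have "len (r * y) \<le> len (r * (t * (s * y))) + len (t * s)"
        using len_mult_le[of "r * (t * (s * y))" "t * s"] r s t y by simp
      also have "len (t * s) \<le> 2" using len_mult_le[of t s] s t by simp
      finally have dr: "dl r y" using len_dl[OF y2(1) r] y1 y2 by (simp add: dl_def)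
      have "r * y = y * r" using r dr \<open>\<forall>e\<in>S. dl e y \<longrightarrow> e * y = y * e\<close> by blast
      then have "coroot s \<in> plane v1 v2" "coroot t \<in> plane v1 v2" "coroot r \<in> plane v1 v2"
        using coroot_in_plane[OF y(1) _ _ _ y(4)] s t r cs ct dt dr by blast+
      then show ?thesis using plane_no_three ts rne by metis
    qed
  qed
qed

text \<open>The squares on \<open>x\<close>, \<open>z1\<close>, \<open>z2\<close>, \<open>w1\<close>
  and \<open>w2\<close> put the roots of \<open>a1\<close> and \<open>b1\<close> into the plane of
  \<open>t1\<close>, \<open>t2\<close>, and then that of \<open>c1\<close>. So
  \<open>g = c1 * a1 * t1\<close>, which sends \<open>x\<close> to \<open>y\<close>, is an
  involution of odd length that moves vectors only along this plane.\<close>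

lemma right_angled_K33:
  assumes x: "x \<in> W" and d: "z1 \<noteq> z2" "w1 \<noteq> w2" "x \<noteq> w1" "x \<noteq> w2"
    and e: "adj x z1" "adj x z2" "adj z1 w1" "adj z1 w2" "adj z2 w1" "adj z2 w2" "adj w1 y" "adj w2 y"
  shows "adj x y"
proof -
  obtain t1 where t1: "t1 \<in> T" "z1 = t1 * x" using e by (auto simp: adj_def)
  obtain t2 where t2: "t2 \<in> T" "z2 = t2 * x" using e by (auto simp: adj_def)
  obtain a1 where a1: "a1 \<in> T" "w1 = a1 * z1" using e by (auto simp: adj_def)
  obtain a2 where a2: "a2 \<in> T" "w1 = a2 * z2" using e by (auto simp: adj_def)
  obtain b1 where b1: "b1 \<in> T" "w2 = b1 * z1" using e by (auto simp: adj_def)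
  obtain b2 where b2: "b2 \<in> T" "w2 = b2 * z2" using e by (auto simp: adj_def)
  obtain c1 where c1: "c1 \<in> T" "y = c1 * w1" using e by (auto simp: adj_def)
  obtain c2 where c2: "c2 \<in> T" "y = c2 * w2" using e by (auto simp: adj_def)
  have ea: "a2 * a1 = t2 * t1"
  proof -
    have "a1 * t1 * x = a2 * t2 * x" using a1 a2 t1 t2 by (simp add: mult.assoc)
    then have "a1 * t1 = a2 * t2" by simp
    then have "a2 * (a1 * t1) * t1 = a2 * (a2 * t2) * t1" by simp
    then show ?thesis using a2 t1 by (simp add: mult.assoc)
  qed
  have eb: "b2 * b1 = t2 * t1"
  proof -
    have "b1 * t1 * x = b2 * t2 * x" using b1 b2 t1 t2 by (simp add: mult.assoc)
    then have "b1 * t1 = b2 * t2" by simp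
    then have "b2 * (b1 * t1) * t1 = b2 * (b2 * t2) * t1" by simp
    then show ?thesis using b2 t1 by (simp add: mult.assoc)
  qed
  have ec: "c2 * c1 = b1 * a1"
  proof -
    have "c1 * a1 * z1 = c2 * b1 * z1" using c1 c2 a1 b1 by (simp add: mult.assoc)
    then have "c1 * a1 = c2 * b1" by simp
    then have "c2 * (c1 * a1) * a1 = c2 * (c2 * b1) * a1" by simp
    then show ?thesis using c2 a1 by (simp add: mult.assoc)
  qed
  have ne: "t2 \<noteq> t1" "b1 \<noteq> a1" using d t1 t2 a1 b1 by auto
  have ne': "a2 \<noteq> a1" "b2 \<noteq> b1" "c2 \<noteq> c1"
  proof -
    show "a2 \<noteq> a1"
    proof
      assume "a2 = a1"
      then have "t2 * t1 = 1" using ea a1 by simp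
      then have "t2 * (t2 * t1) = t2" by simp
      then show False using ne t2 by simp
    qed
    show "b2 \<noteq> b1"
    proof
      assume "b2 = b1"
      then have "t2 * t1 = 1" using eb b1 by simp
      then have "t2 * (t2 * t1) = t2" by simp
      then show False using ne t2 by simp
    qed
    show "c2 \<noteq> c1"
    proof
      assume "c2 = c1"
      then have "b1 * a1 = 1" using ec c1 by simp
      then have "b1 * (b1 * a1) = b1" by simp
      then show False using ne b1 by simp
    qed
  qed
  obtain v1 L1 where r1: "is_root t1 v1 L1" using is_root_exists t1 by blast
  obtain v2 L2 where r2: "is_root t2 v2 L2" using is_root_exists t2 by blast
  obtain va La where ra: "is_root a1 va La" using is_root_exists a1 by blast
  obtain va' La' where ra': "is_root a2 va' La'" using is_root_exists a2 by blast
  obtain vb Lb where rb: "is_root b1 vb Lb" using is_root_exists b1 by blast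
  obtain vb' Lb' where rb': "is_root b2 vb' Lb'" using is_root_exists b2 by blast
  obtain vc Lc where rc: "is_root c1 vc Lc" using is_root_exists c1 by blast
  obtain vc' Lc' where rc': "is_root c2 vc' Lc'" using is_root_exists c2 by blast
  have pa: "va \<in> plane v2 v1" using root_in_span(2)[OF ra' ra r2 r1 ne'(1) ea] by (simp add: plane_def)
  have pb: "vb \<in> plane v2 v1" using root_in_span(2)[OF rb' rb r2 r1 ne'(2) eb] by (simp add: plane_def)
  have pc: "vc \<in> plane vb va" using root_in_span(2)[OF rc' rc rb ra ne'(3) ec] by (simp add: plane_def)
  have sw: "f \<in> plane v1 v2" if "f \<in> plane v2 v1" for f by (rule plane_mono[OF _ _ that]) auto
  have P: "va \<in> plane v1 v2" "vc \<in> plane v1 v2" using sw pa pb plane_mono[OF _ _ pc] by blast+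
  define g where "g = c1 * a1 * t1"
  have gr: "g = t1 * a1 * c1" unfolding g_def using coplanar_reflections_commute[OF r1 r2 ra rc P] .
  have "g * g = (t1 * a1 * c1) * (c1 * a1 * t1)" using gr g_def by simp
  also have "\<dots> = 1" using t1 a1 c1 by (simp add: mult.assoc)
  finally have gg: "g * g = 1" .
  have gW: "g \<in> W" using t1 a1 c1 by (simp add: g_def)
  have "odd (len g)" using t1 a1 c1 odd_len_T by (simp add: g_def even_len_mult)
  moreover have "(\<lambda>i. rho g f i - f i) \<in> plane v1 v2" for f
  proof -
    have step: "(\<lambda>i. rho u h i - f i) \<in> plane v1 v2"
      if "is_root u w K" "w \<in> plane v1 v2" "(\<lambda>i. h i - f i) \<in> plane v1 v2" for u w K h
    proof -
      have "(\<lambda>i. rho u h i - f i) = (\<lambda>i. 1 * (h i - f i) + (- K h) * w i)"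
        unfolding rho_root[OF that(1)] by auto
      then show ?thesis using plane_combination[OF that(3,2)] by metis
    qed
    have "(\<lambda>i. f i - f i) \<in> plane v1 v2" by (rule planeI[of _ 0 _ 0]) simp
    from step[OF rc P(2) step[OF ra P(1) step[OF r1 _ this]]] show ?thesis
      using t1 a1 c1 by (simp add: g_def rho_mult)
  qed
  ultimately have "g \<in> T" using odd_planar_involution[OF gW gg] by blast
  moreover have "y = g * x" using c1 a1 t1 by (simp add: g_def mult.assoc)
  ultimately show ?thesis by (auto simp: adj_def)
qed

section \<open>Reflections in a dihedral parabolic subgroup\<close>

definition dih :: "'g \<Rightarrow> 'g \<Rightarrow> 'g set" where "dih p q = prod_list ` lists {p, q}"

text \<open>The letters \<open>p\<close>, \<open>q\<close> leave every other \<open>False\<close>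
  coordinate alone. Vectors dual to the two functionals separate the two roots, so neither has such
  a coordinate, and \<open>rho_support\<close> applies.\<close>

lemma reflections_in_dih:
  assumes pq: "p \<in> S" "q \<in> S" and T: "r \<in> T" "r' \<in> T" "r \<noteq> r'" and D: "r * r' \<in> dih p q"
  shows "r \<in> dih p q" "r' \<in> dih p q"
proof -
  obtain w where w: "w \<in> lists {p, q}" "prod_list w = r * r'" using D unfolding dih_def by (metis imageE)
  have fixw: "foldr act w f (c, False) = f (c, False)" if "c \<notin> {p, q}" for c f
    using w(1) that by (induction w) (auto simp: act_def)
  have wS: "w \<in> lists S" using w(1) pq by auto
  obtain v L where 1: "is_root r v L" using is_root_exists T by blast
  obtain v' L' where 2: "is_root r' v' L'" using is_root_exists T by blast
  have rr: "rho (r * r') f = (\<lambda>i. f i - L' f * v' i - (L f - L' f * L v') * v i)" for f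
  proof -
    have "L (\<lambda>i. f i - L' f * v' i) = L f - L' f * L v'" using root_linear[OF 1, of 1 f "- L' f" v'] by simp
    then show ?thesis using T by (simp add: rho_mult rho_root[OF 1] rho_root[OF 2])
  qed
  have z: "L' f * v' (c, False) + (L f - L' f * L v') * v (c, False) = 0" if "c \<notin> {p, q}" for c f
  proof -
    have "rho (r * r') f (c, False) = f (c, False)" using rho_word[OF wS, of f] w(2) fixw[OF that] by simp
    then show ?thesis unfolding rr by simp
  qed
  obtain f where "L f = 1" "L' f = 0" using root_independent[OF 1 2 T(3)] by blast
  then have v: "v (c, False) = 0" if "c \<notin> {p, q}" for c using z[OF that, of f] by simp
  obtain g where "L' g = 1" "L g = 0" using root_independent[OF 2 1] T(3) by blast
  then have v': "v' (c, False) = 0" if "c \<notin> {p, q}" for c using z[OF that, of g] v[OF that] by simp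
  have "rho r ones (c, False) = 0" "rho r' ones (c, False) = 0" if "c \<notin> {p, q}" for c
    using v[OF that] v'[OF that] by (simp_all add: rho_root[OF 1] rho_root[OF 2] ones_def)
  then show "r \<in> dih p q" "r' \<in> dih p q"
    unfolding dih_def using rho_support[of r "{p, q}"] rho_support[of r' "{p, q}"] T pq by blast+
qed

end

section \<open>Right-angled groups: dihedral cosets\<close>

context right_angled_coxeter
begin

text \<open>The coordinate at \<open>c\<close> of the image in the abelianization, a vector space
  over the field with two elements.\<close>

definition ty :: "'g \<Rightarrow> 'g \<Rightarrow> bool" where
  "ty c x \<longleftrightarrow> (\<exists>w\<in>lists S. prod_list w = x \<and> odd (count_list w c))"

lemma relator_even: "r \<in> coxeter_relators S m \<Longrightarrow> even (count_list r c)"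
proof (erule relator_cases)
  fix s t k assume "r = concat (replicate (2 * k) [s, t])"
  moreover have "even (count_list (concat (replicate (2 * k) [s, t])) c)" by (induction k) auto
  ultimately show ?thesis by simp
qed auto

lemma ty_word: assumes "w \<in> lists S" shows "ty c (prod_list w) \<longleftrightarrow> odd (count_list w c)"
proof -
  have "odd (count_list a c) = odd (count_list b c)" if "a \<in> lists S" "b \<in> lists S" "prod_list a = prod_list b" for a b
    by (rule word_invariant[where F = "\<lambda>w. odd (count_list w c)", OF _ that]) (simp add: relator_even)
  then show ?thesis using assms unfolding ty_def by blast
qed

lemma ty_mult [simp]: "x \<in> W \<Longrightarrow> y \<in> W \<Longrightarrow> ty c (x * y) \<longleftrightarrow> ty c x \<noteq> ty c y"
proof (elim W_cases)
  fix a b assume "a \<in> lists S" "b \<in> lists S" "prod_list a = x" "prod_list b = y"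
  then show ?thesis using ty_word[of "a @ b" c] ty_word[of a c] ty_word[of b c] by auto
qed

lemma ty_one [simp]: "\<not> ty c 1" using ty_word[of "[]" c] by simp

lemma ty_gen [simp]: "s \<in> S \<Longrightarrow> ty c s \<longleftrightarrow> c = s" using ty_word[of "[s]" c] by auto

lemma ty_ginv [simp]: "x \<in> W \<Longrightarrow> ty c (ginv x) \<longleftrightarrow> ty c x"
  using ty_mult[of x "ginv x" c] by simp

text \<open>In a right-angled group the only obstruction to a reduced product is a cancelling letter
  at the junction. Moving a right descent \<open>s\<close> of \<open>x\<close> over to
  \<open>y\<close> creates no new one: a new clash \<open>c\<close> would commute with
  \<open>s\<close> and so have been present before.\<close>

lemma len_mult_additive:
  assumes "x \<in> W" "y \<in> W" "\<And>c. c \<in> S \<Longrightarrow> dr c x \<Longrightarrow> \<not> dl c y"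
  shows "len (x * y) = len x + len y"
  using assms
proof (induction "len x" arbitrary: x y)
  case 0 then show ?case by simp
next
  case (Suc n)
  then have "x \<noteq> 1" by auto
  then obtain s where s: "s \<in> S" "dr s x" using ex_dr Suc.prems by blast
  have x': "x * s \<in> W" "len x = Suc (len (x * s))" "\<not> dr s (x * s)" using s Suc.prems len_dr by auto
  have ns: "\<not> dl s y" using Suc.prems s by blast
  have y': "s * y \<in> W" "len (s * y) = Suc (len y)" "dl s (s * y)" using s ns Suc.prems len_not_dl by auto
  have "\<not> dl c (s * y)" if c: "c \<in> S" "dr c (x * s)" for c
  proof
    assume d: "dl c (s * y)"
    have "c \<noteq> s" using c x' by auto
    moreover have com: "c * s = s * c" using dl_commutes[OF y'(1) c(1) s(1) d y'(3)] .
    ultimately have "dl c y" using d dl_commute[of c s y] c s Suc.prems by simp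
    moreover have "dr c x"
    proof -
      have "dl c (ginv (x * s))" using dl_ginv[OF x'(1) c(1)] c by blast
      then have "dl c (s * ginv x)" using s by simp
      then have "dl c (ginv x)" using dl_commute[of c s "ginv x"] \<open>c \<noteq> s\<close> com c s Suc.prems by simp
      then show ?thesis using c Suc.prems by simp
    qed
    ultimately show False using Suc.prems c by blast
  qed
  then have "len ((x * s) * (s * y)) = len (x * s) + len (s * y)" using Suc.hyps(1)[of "x * s" "s * y"] Suc.hyps(2) x' y' by simp
  then show ?case using x' y' s by (simp add: mult.assoc)
qed

lemma additive_disjoint:
  assumes "x \<in> W" "y \<in> W" "len (x * y) = len x + len y" "c \<in> S" "dr c x"
  shows "\<not> dl c y"
proof
  assume d: "dl c y"
  have "len ((x * c) * (c * y)) \<le> len (x * c) + len (c * y)" using assms by (intro len_mult_le) auto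
  then show False using assms len_dr[of x c] len_dl[of y c] d by (simp add: mult.assoc)
qed

section \<open>Alternating words and the elements of \<open>dih\<close>\<close>

primrec alt :: "nat \<Rightarrow> 'g \<Rightarrow> 'g \<Rightarrow> 'g" where
  "alt 0 = (\<lambda>p q. 1)"
| "alt (Suc n) = (\<lambda>p q. p * alt n q p)"

definition nc :: "'g \<Rightarrow> 'g \<Rightarrow> bool" where
  "nc p q \<longleftrightarrow> p \<in> S \<and> q \<in> S \<and> p * q \<noteq> q * p"

lemma nc_sym: "nc p q \<Longrightarrow> nc q p" by (auto simp: nc_def)
lemma nc_S: "nc p q \<Longrightarrow> p \<in> S" "nc p q \<Longrightarrow> q \<in> S" by (auto simp: nc_def)
lemma nc_neq: "nc p q \<Longrightarrow> p \<noteq> q" by (auto simp: nc_def)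

lemma nc_dl: "nc p q \<Longrightarrow> x \<in> W \<Longrightarrow> dl p x \<Longrightarrow> \<not> dl q x"
  using dl_commutes[of x p q] by (auto simp: nc_def)

lemma alt_W [simp]: "p \<in> S \<Longrightarrow> q \<in> S \<Longrightarrow> alt n p q \<in> W"
  by (induction n arbitrary: p q) auto

lemma alt_append: "alt n p q * (if even n then p else q) = alt (Suc n) p q"
proof (induction n arbitrary: p q)
  case (Suc n)
  show ?case using Suc[of q p] by (cases "even n") (simp_all add: mult.assoc)
qed simp

lemma alt_mult_len:
  assumes "nc p q" "b \<in> W" "\<not> dl p b" "\<not> dl q b"
  shows "len (alt n p q * b) = n + len b \<and> (n > 0 \<longrightarrow> dl p (alt n p q * b))"
  using assms
proof (induction n arbitrary: p q)
  case (Suc n)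
  note S = nc_S[OF Suc.prems(1)]
  have W: "alt n q p * b \<in> W" using S Suc.prems by simp
  have IH: "len (alt n q p * b) = n + len b" "n > 0 \<longrightarrow> dl q (alt n q p * b)"
    using Suc.IH[OF nc_sym[OF Suc.prems(1)]] Suc.prems by auto
  have "\<not> dl p (alt n q p * b)"
  proof (cases "n = 0")
    case False
    then show ?thesis using IH(2) nc_dl[OF nc_sym[OF Suc.prems(1)] W] by blast
  qed (use Suc.prems in simp)
  then show ?case using len_not_dl[OF W S(1)] dl_gen_mult[OF W S(1)] IH by (simp add: mult.assoc)
qed simp

lemma alt_len: assumes "nc p q" shows "len (alt n p q) = n"
  using alt_mult_len[OF assms, of 1 n] by simp

lemma alt_dl: assumes "nc p q" "n > 0" shows "dl p (alt n p q)" "\<not> dl q (alt n p q)"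
  using alt_mult_len[OF assms(1), of 1 n] nc_dl[OF assms(1)] nc_S[OF assms(1)] assms by auto

lemma alt_neq: assumes "nc p q" "n > 0" shows "alt n p q \<noteq> alt n q p"
  using alt_dl[OF assms] alt_dl[OF nc_sym[OF assms(1)] assms(2)] by metis

text \<open>A descent other than \<open>p\<close> comes from \<open>b\<close> and commutes with
  every letter it passes. A prefix of length one contains only \<open>p\<close>, which is why
  \<open>q\<close> is mentioned for \<open>n > 1\<close> alone.\<close>

lemma alt_mult_dl:
  assumes "nc p q" "b \<in> W" "\<not> dl p b" "\<not> dl q b" "c \<in> S" "dl c (alt n p q * b)" "n > 0"
  shows "c = p \<or> c \<noteq> p \<and> c \<noteq> q \<and> c * p = p * c \<and> dl c b \<and> (n > 1 \<longrightarrow> c * q = q * c)"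
  using assms
proof (induction n arbitrary: p q)
  case (Suc n)
  note S = nc_S[OF Suc.prems(1)]
  show ?case
  proof (cases "c = p")
    case False
    have W: "alt n q p * b \<in> W" using S Suc.prems by simp
    have dp: "dl p (alt (Suc n) p q * b)" using alt_mult_len[OF Suc.prems(1-4)] by blast
    have cp: "c * p = p * c" using dl_commutes[OF _ Suc.prems(5) S(1) Suc.prems(6) dp] S Suc.prems by auto
    have cq: "c \<noteq> q" using cp Suc.prems(1) by (auto simp: nc_def)
    have "dl c (p * (alt n q p * b))" using Suc.prems(6) by (simp add: mult.assoc)
    then have d: "dl c (alt n q p * b)" using dl_commute[OF Suc.prems(5) S(1) False cp W] by simp
    show ?thesis
    proof (cases "n = 0")
      case True then show ?thesis using d False cq cp by simp
    next
      case n: False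
      then show ?thesis using Suc.IH[OF nc_sym[OF Suc.prems(1)]] Suc.prems d False cq cp by auto
    qed
  qed simp
qed simp

lemma alt_dl_eq: "nc p q \<Longrightarrow> c \<in> S \<Longrightarrow> dl c (alt n p q) \<Longrightarrow> c = p"
  using alt_mult_dl[of p q 1 c n] by (cases "n = 0") auto

lemma dih_gens [simp, intro]: "p \<in> dih p q" "q \<in> dih p q" "1 \<in> dih p q"
  unfolding dih_def by (auto intro: image_eqI[of _ _ "[p]"] image_eqI[of _ _ "[q]"] image_eqI[of _ _ "[]"])

lemma dih_mult [intro]: "x \<in> dih p q \<Longrightarrow> y \<in> dih p q \<Longrightarrow> x * y \<in> dih p q"
proof -
  assume "x \<in> dih p q" "y \<in> dih p q"
  then obtain a b where "a \<in> lists {p, q}" "b \<in> lists {p, q}" "x = prod_list a" "y = prod_list b"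
    unfolding dih_def by (metis imageE)
  then have "a @ b \<in> lists {p, q}" "x * y = prod_list (a @ b)" by auto
  then show ?thesis unfolding dih_def by blast
qed

lemma dih_W: "nc p q \<Longrightarrow> x \<in> dih p q \<Longrightarrow> x \<in> W"
proof -
  assume "nc p q" "x \<in> dih p q"
  then obtain a where "a \<in> lists {p, q}" "x = prod_list a" unfolding dih_def by (metis imageE)
  moreover from this have "a \<in> lists S" using nc_S[OF \<open>nc p q\<close>] by auto
  ultimately show ?thesis by simp
qed

lemma dih_ginv [intro]: "nc p q \<Longrightarrow> x \<in> dih p q \<Longrightarrow> ginv x \<in> dih p q"
proof -
  assume nc: "nc p q" and "x \<in> dih p q"
  then obtain a where a: "a \<in> lists {p, q}" "x = prod_list a" unfolding dih_def by (metis imageE)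
  moreover from a have "a \<in> lists S" using nc_S[OF nc] by auto
  ultimately have "ginv x = prod_list (rev a)" "rev a \<in> lists {p, q}" by (auto simp: prod_list_rev)
  then show ?thesis unfolding dih_def by blast
qed

lemma dih_swap: "dih p q = dih q p"
  by (simp add: dih_def insert_commute)

lemma alt_dih [simp, intro]: "alt n p q \<in> dih p q" "alt n p q \<in> dih q p"
proof -
  have "alt n p q \<in> dih p q \<and> alt n p q \<in> dih q p"
  proof (induction n arbitrary: p q)
    case (Suc n)
    then have "alt n q p \<in> dih p q" by blast
    then have "p * alt n q p \<in> dih p q" by blast
    then show ?case by (simp add: dih_swap[of q p])
  qed simp
  then show "alt n p q \<in> dih p q" "alt n p q \<in> dih q p" by auto
qed

lemma dih_cases:
  assumes "nc p q" "x \<in> dih p q"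
  shows "x = alt (len x) p q \<or> x = alt (len x) q p"
proof -
  obtain a where "a \<in> lists {p, q}" "x = prod_list a" using assms(2) unfolding dih_def by (metis imageE)
  then have "\<exists>n. x = alt n p q \<or> x = alt n q p"
  proof (induction a arbitrary: x)
    case Nil then show ?case by (intro exI[of _ 0]) simp
  next
    case (Cons s a)
    then obtain n where n: "prod_list a = alt n p q \<or> prod_list a = alt n q p" by auto
    have up: "\<exists>k. u * alt n v u = alt k u v" for u v by (intro exI[of _ "Suc n"]) simp
    have down: "\<exists>k. u * alt n u v = alt k u v \<or> u * alt n u v = alt k v u" if "u \<in> S" for u v
    proof (cases n)
      case 0 then show ?thesis by (intro exI[of _ 1]) simp
    next
      case (Suc k) then show ?thesis using that by (intro exI[of _ k]) simp
    qed
    have "s = p \<or> s = q" using Cons.hyps by simp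
    moreover have "x = s * prod_list a" using Cons.prems by simp
    ultimately show ?case using n up[of p q] up[of q p] down[of p q] down[of q p] nc_S[OF assms(1)] by metis
  qed
  then show ?thesis using alt_len[OF assms(1)] alt_len[OF nc_sym[OF assms(1)]] by metis
qed

lemma dih_len_eq:
  assumes "nc p q" "x \<in> dih p q" "y \<in> dih p q" "z \<in> dih p q" "len x = len y" "x \<noteq> y" "len z = len x"
  shows "z = x \<or> z = y"
  using dih_cases[OF assms(1,2)] dih_cases[OF assms(1,3)] dih_cases[OF assms(1,4)] assms(5-7) by metis

lemma dih_dl: "nc p q \<Longrightarrow> x \<in> dih p q \<Longrightarrow> c \<in> S \<Longrightarrow> dl c x \<Longrightarrow> c = p \<or> c = q"
  using dih_cases[of p q x] alt_dl_eq[of p q c] alt_dl_eq[of q p c] nc_sym by metis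

lemma dih_odd_T:
  assumes "nc p q" "x \<in> dih p q" "odd (len x)"
  shows "x \<in> T"
proof -
  have "alt (Suc (2 * k)) p q \<in> T" if "nc p q" for k p q
    using that
  proof (induction k arbitrary: p q)
    case 0 then show ?case using nc_S by simp
  next
    case (Suc k)
    have "alt (Suc (2 * Suc k)) p q = p * (alt (Suc (2 * k)) q p * p)"
      using alt_append[of "Suc (2 * k)" q p] by simp
    moreover have "p * alt (Suc (2 * k)) q p * ginv p \<in> T"
      using Suc.IH[OF nc_sym[OF Suc.prems]] nc_S[OF Suc.prems] by (intro T_conj) auto
    ultimately show ?case using nc_S[OF Suc.prems] by (simp add: mult.assoc)
  qed
  moreover obtain k where "len x = Suc (2 * k)" using assms(3) by (elim oddE) simp
  ultimately show ?thesis using dih_cases[OF assms(1,2)] nc_sym[OF assms(1)] assms(1) by metis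
qed

lemma dih_adj:
  assumes "nc p q" "x \<in> dih p q" "y \<in> dih p q" "odd (len x + len y)"
  shows "adj x y"
proof -
  have W: "x \<in> W" "y \<in> W" using assms dih_W by auto
  have "y * ginv x \<in> dih p q" using assms by blast
  moreover have "odd (len (y * ginv x))" using W assms by (simp add: even_len_mult)
  ultimately show ?thesis using dih_odd_T assms by (simp add: adj_iff)
qed

section \<open>Translates of \<open>dih\<close> by minimal coset representatives\<close>

definition lmin_coset :: "'g \<Rightarrow> 'g \<Rightarrow> 'g \<Rightarrow> bool" where
  "lmin_coset p q b \<longleftrightarrow> b \<in> W \<and> \<not> dl p b \<and> \<not> dl q b"

definition rmin_coset :: "'g \<Rightarrow> 'g \<Rightarrow> 'g \<Rightarrow> bool" where
  "rmin_coset p q a \<longleftrightarrow> a \<in> W \<and> \<not> dr p a \<and> \<not> dr q a"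

lemma lmin_len: "nc p q \<Longrightarrow> lmin_coset p q b \<Longrightarrow> x \<in> dih p q \<Longrightarrow> len (x * b) = len x + len b"
  using dih_cases[of p q x] alt_mult_len[of p q b "len x"] alt_mult_len[of q p b "len x"] nc_sym[of p q]
  by (metis lmin_coset_def)

lemma rmin_len: "nc p q \<Longrightarrow> rmin_coset p q a \<Longrightarrow> x \<in> dih p q \<Longrightarrow> len (a * x) = len a + len x"
proof -
  assume *: "nc p q" "rmin_coset p q a" "x \<in> dih p q"
  then have "\<not> dl c x" if "c \<in> S" "dr c a" for c
    using dih_dl[of p q x c] that by (auto simp: rmin_coset_def)
  then show ?thesis using len_mult_additive[of a x] * dih_W by (auto simp: rmin_coset_def)
qed

text \<open>The product \<open>a w b\<close> need not be reduced.\<close>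

lemma coset_arrow:
  assumes nc: "nc p q" and ab: "rmin_coset p q a" "lmin_coset p q b"
    and w: "w \<in> dih p q" "w' \<in> dih p q" "len w < len w'" "odd (len w + len w')"
  shows "arrow (a * w * b) (a * w' * b)"
proof -
  have W: "a \<in> W" "b \<in> W" "w \<in> W" "w' \<in> W" using ab w dih_W[OF nc] by (auto simp: lmin_coset_def rmin_coset_def)
  define t where "t = w' * ginv w"
  have tD: "t \<in> dih p q" using w nc unfolding t_def by blast
  have "odd (len t)" using W w by (simp add: t_def even_len_mult)
  then have t: "t \<in> T" using dih_odd_T nc tD by blast
  have w': "w' = t * w" by (simp add: t_def mult.assoc)
  \<comment> \<open>The cocycle splits the inversion test at \<open>a\<close>. Each part involves
    only one minimal representative, where lengths do add, so both answers are negative.\<close>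
  have "nn (a * (w * b)) (a * t * ginv a) = (nn a (a * t * ginv a) \<noteq> nn (w * b) t)"
    using nn_mult[of a "w * b" "a * t * ginv a"] W by (simp add: mult.assoc)
  moreover have "\<not> nn a (a * t * ginv a)"
  proof -
    have "nn a (a * t * ginv a) \<longleftrightarrow> len (a * t) < len a"
      using less_iff_nn[OF W(1) T_conj[OF t W(1)]] by (simp add: mult.assoc)
    then show ?thesis using rmin_len[OF nc ab(1) tD] by simp
  qed
  moreover have "\<not> nn (w * b) t"
  proof -
    have "nn (w * b) t \<longleftrightarrow> len (w' * b) < len (w * b)"
      using less_iff_nn[of "w * b" t] W t w' by (simp add: mult.assoc)
    then show ?thesis using lmin_len[OF nc ab(2)] w by simp
  qed
  ultimately have "\<not> nn (a * w * b) (a * t * ginv a)" by (simp add: mult.assoc)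
  then have "\<not> len (a * w' * b) < len (a * w * b)"
    using less_iff_nn[OF _ T_conj[OF t W(1)], of "a * w * b"] W w' by (simp add: mult.assoc)
  moreover have "adj (a * w * b) (a * w' * b)" using dih_adj[OF nc w(1,2,4)] W by simp
  ultimately show ?thesis using adj_arrow[of "a * w * b" "a * w' * b"] W arrow_len by auto
qed

lemma rmin_decomposition:
  assumes "x \<in> W" "nc p q"
  obtains a d where "rmin_coset p q a" "d \<in> dih p q" "x = a * d"
proof -
  have "\<exists>a d. rmin_coset p q a \<and> d \<in> dih p q \<and> x = a * d" using assms(1)
  proof (induction "len x" arbitrary: x rule: less_induct)
    case less
    have step: ?case if s: "s \<in> S" "dr s x" "s \<in> dih p q" for s
    proof -
      obtain a d where "rmin_coset p q a" "d \<in> dih p q" "x * s = a * d"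
        using less.hyps[of "x * s"] less.prems s len_dr[of x s] by auto
      moreover from this have "x = a * (d * s)" using s by (metis mult.assoc mult_1_right sq)
      ultimately show ?thesis using s by blast
    qed
    show ?case
    proof (cases "dr p x \<or> dr q x")
      case True
      then show ?thesis using step[of p] step[of q] nc_S[OF assms(2)] by blast
    next
      case False
      then show ?thesis using less.prems by (intro exI[of _ x] exI[of _ 1]) (auto simp: rmin_coset_def)
    qed
  qed
  then show ?thesis using that by blast
qed

lemma lmin_decomposition:
  assumes "x \<in> W" "nc p q"
  obtains b d where "lmin_coset p q b" "d \<in> dih p q" "x = d * b"
proof -
  obtain a d where *: "rmin_coset p q a" "d \<in> dih p q" "ginv x = a * d"
    using rmin_decomposition[of "ginv x" p q] assms by auto
  then have "x = ginv d * ginv a" by (metis ginv_ginv ginv_mult)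
  moreover have "lmin_coset p q (ginv a)" using *(1) nc_S[OF assms(2)] by (auto simp: lmin_coset_def rmin_coset_def)
  ultimately show ?thesis using that * assms(2) by blast
qed

text \<open>By exchange \<open>y = A * (d * B)\<close> is reduced and \<open>x = A * B\<close>. If
  \<open>x\<close> is shorter by more than one, a letter \<open>e\<close> cancels between
  \<open>A\<close> and \<open>B\<close>, and it cannot commute with \<open>d\<close>. Both elements
  then lie in one translate of \<open>dih d e\<close> with ranks at least three apart, and the next
  two ranks above \<open>x\<close> supply the squares.\<close>

lemma right_angled_long_arrow:
  assumes xy: "arrow x y" and long: "len y \<noteq> Suc (len x)"
  shows "\<exists>z1 z2 w1 w2. z1 \<noteq> z2 \<and> w1 \<noteq> w2 \<and> arrow x z1 \<and> arrow x z2 \<and>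
    arrow z1 w1 \<and> arrow z1 w2 \<and> arrow z2 w1 \<and> arrow z2 w2 \<and> arrow w1 y \<and> arrow w2 y"
proof -
  have W: "x \<in> W" "y \<in> W" using arrow_W[OF xy] by auto
  obtain t where t: "t \<in> T" "x = t * y" using adj_sym[OF arrow_adj[OF xy]] by (auto simp: adj_def)
  obtain w where w: "w \<in> lists S" "prod_list w = y" "length w = len y" using reduced_word[OF W(2)] .
  have "nn (prod_list w) t" using less_iff_nn[OF W(2) t(1)] arrow_len[OF xy] t w by simp
  from exchange[OF w(1) this] obtain u d v where "w = u @ d # v" "t * prod_list w = prod_list (u @ v)" by blast
  then have uv: "w = u @ d # v" "x = prod_list u * prod_list v" using t w by simp_all
  define A B where "A = prod_list u" and "B = prod_list v"
  have uvS: "u \<in> lists S" "d \<in> S" "v \<in> lists S" using w uv by auto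
  have AB: "A \<in> W" "B \<in> W" "x = A * B" "y = A * (d * B)" using uv uvS w by (auto simp: A_def B_def)
  have ly: "len y = length u + Suc (length v)" using w uv by simp
  have lA: "len A = length u" "len B = length v" and ldB: "len (d * B) = Suc (len B)"
  proof -
    have b: "len A \<le> length u" "len B \<le> length v" using len_le uvS by (auto simp: A_def B_def)
    have "len (d * B) \<le> Suc (len B)" using len_mult_le[of d B] AB uvS by simp
    moreover have "len y \<le> len A + len (d * B)" using len_mult_le[of A "d * B"] AB uvS by simp
    ultimately show "len A = length u" "len B = length v" "len (d * B) = Suc (len B)" using b ly by linarith+
  qed
  have "len x \<noteq> len A + len B" using long ly lA by simp
  then obtain e where e: "e \<in> S" "dr e A" "dl e B" using len_mult_additive[OF AB(1,2)] AB(3) by blast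
  have yadd: "len (A * (d * B)) = len A + len (d * B)" using AB lA ldB ly by simp
  have ed: "e \<noteq> d" using additive_disjoint[OF AB(1) _ yadd e(1,2)] e ldB uvS AB by (auto simp: dl_def)
  have nc: "nc d e"
  proof (rule ccontr)
    assume "\<not> nc d e"
    then have "e * d = d * e" using uvS e by (auto simp: nc_def)
    then have "dl e (d * B)" using dl_commute[of e d B] ed e uvS AB by simp
    then show False using additive_disjoint[OF AB(1) _ yadd e(1,2)] uvS AB by simp
  qed
  obtain a \<delta> where a: "rmin_coset d e a" "\<delta> \<in> dih d e" "A = a * \<delta>" using rmin_decomposition[OF AB(1) nc] .
  obtain b \<epsilon> where b: "lmin_coset d e b" "\<epsilon> \<in> dih d e" "B = \<epsilon> * b" using lmin_decomposition[OF AB(2) nc] .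
  define w1 w2 where "w1 = \<delta> * \<epsilon>" and "w2 = \<delta> * d * \<epsilon>"
  have D: "w1 \<in> dih d e" "w2 \<in> dih d e" using a b by (auto simp: w1_def w2_def)
  have xy': "x = a * w1 * b" "y = a * w2 * b" using AB a b by (simp_all add: w1_def w2_def mult.assoc)
  have DW: "\<delta> \<in> W" "\<epsilon> \<in> W" "a \<in> W" "b \<in> W" "w1 \<in> W" "w2 \<in> W"
    using a b dih_W[OF nc] D by (auto simp: lmin_coset_def rmin_coset_def)
  have la: "len A = len a + len \<delta>" "len B = len \<epsilon> + len b" using rmin_len[OF nc a(1,2)] lmin_len[OF nc b(1,2)] a b by auto
  have "len y \<le> len a + len w2 + len b"
    using len_mult_le[of "a * w2" b] len_mult_le[of a w2] DW xy' by fastforce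
  then have l2: "len \<delta> + len \<epsilon> + 1 \<le> len w2" using la ly lA by linarith
  have de: "dr e \<delta>"
  proof (rule ccontr)
    assume "\<not> dr e \<delta>"
    then have "len (\<delta> * e) = Suc (len \<delta>)" using len_not_dr DW e by blast
    moreover have "len (a * (\<delta> * e)) = len a + len (\<delta> * e)" using rmin_len[OF nc a(1)] a by blast
    ultimately show False using len_dr[OF AB(1) e(1,2)] la a by (simp add: mult.assoc)
  qed
  have ee: "dl e \<epsilon>"
  proof (rule ccontr)
    assume "\<not> dl e \<epsilon>"
    then have "len (e * \<epsilon>) = Suc (len \<epsilon>)" using len_not_dl DW e by blast
    moreover have "len ((e * \<epsilon>) * b) = len (e * \<epsilon>) + len b" using lmin_len[OF nc b(1)] b by blast
    ultimately show False using len_dl[OF AB(2) e(1,3)] la b by (simp add: mult.assoc)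
  qed
  have "w1 = (\<delta> * e) * (e * \<epsilon>)" using e by (simp add: w1_def mult.assoc)
  then have "len w1 \<le> len (\<delta> * e) + len (e * \<epsilon>)" using len_mult_le[of "\<delta> * e" "e * \<epsilon>"] DW e by simp
  then have l1: "len w1 + 2 \<le> len \<delta> + len \<epsilon>" using len_dr[of \<delta> e] len_dl[of \<epsilon> e] DW e de ee by simp
  have par: "odd (len w1 + len w2)" using DW uvS by (simp add: w1_def w2_def even_len_mult)
  define k where "k = len w1"
  have k: "k + 3 \<le> len w2" using l1 l2 by (simp add: k_def)
  have nc': "nc e d" using nc_sym[OF nc] .
  note L = alt_len[OF nc] alt_len[OF nc']
  have ar: "arrow (a * g * b) (a * h * b)" if "g \<in> dih d e" "h \<in> dih d e" "len g < len h" "odd (len g + len h)" for g h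
    using coset_arrow[OF nc a(1) b(1) that] .
  let ?z1 = "alt (Suc k) d e" and ?z2 = "alt (Suc k) e d" and ?w1 = "alt (k + 2) d e" and ?w2 = "alt (k + 2) e d"
  have odd: "odd (k + len w2)" using par by (simp add: k_def)
  have lz: "len ?z1 = Suc k" "len ?z2 = Suc k" "len ?w1 = k + 2" "len ?w2 = k + 2" by (simp_all only: L)
  have up: "arrow x (a * ?z1 * b)" "arrow x (a * ?z2 * b)"
    unfolding xy' by (rule ar; use D lz in \<open>simp add: k_def del: alt.simps\<close>)+
  have middle: "arrow (a * ?z1 * b) (a * ?w1 * b)" "arrow (a * ?z1 * b) (a * ?w2 * b)"
    "arrow (a * ?z2 * b) (a * ?w1 * b)" "arrow (a * ?z2 * b) (a * ?w2 * b)"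
    by (rule ar; use lz in \<open>simp del: alt.simps\<close>)+
  have down: "arrow (a * ?w1 * b) y" "arrow (a * ?w2 * b) y"
    unfolding xy' by (rule ar; use D lz k odd in \<open>simp del: alt.simps\<close>)+
  have "?z1 \<noteq> ?z2" "?w1 \<noteq> ?w2" by (rule alt_neq[OF nc]; simp)+
  then have "a * ?z1 * b \<noteq> a * ?z2 * b" "a * ?w1 * b \<noteq> a * ?w2 * b"
    by (simp_all del: alt.simps)
  then show ?thesis using up middle down by blast
qed

end

section \<open>Right-angled groups: butterflies of covers\<close>

context right_angled_coxeter
begin

text \<open>Only an inserted letter that does not commute with \<open>t\<close> can destroy the
  descent \<open>t\<close>. Descents of \<open>y\<close> commuting with \<open>t\<close> are
  stripped until one that does not commute is reached, which must be the inserted letter;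
  \<open>ty\<close> records it.\<close>

lemma noncommuting_edge:
  assumes "cov x y" "t \<in> S" "dl t x" "\<not> dl t y"
  shows "\<exists>f\<in>S. f * t \<noteq> t * f \<and> (\<forall>c. ty c y \<longleftrightarrow> (ty c x \<noteq> (c = f)))"
  using assms
proof (induction "len y" arbitrary: x y rule: less_induct)
  case less
  note W = cov_W[OF less.prems(1)]
  have "y \<noteq> 1" using cov_len[OF less.prems(1)] by auto
  then obtain f where f: "f \<in> S" "dl f y" using ex_dl W by blast
  have ft: "f \<noteq> t" using f less.prems by auto
  show ?case
  proof (cases "f * t = t * f")
    case True
    have c: "dl t (f * z) \<longleftrightarrow> dl t z" if "z \<in> W" for z using dl_commute[of t f z] that f ft less.prems True by simp
    have dx: "dl f x" using cov_dl_eq(1)[OF less.prems(1) f] c[OF W(2)] less.prems by auto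
    have cv: "cov (f * x) (f * y)" using cov_gen_mult[OF less.prems(1) f(1)] f dx by simp
    have "len (f * y) < len y" using len_dl[OF W(2) f] by simp
    then obtain e where "e \<in> S" "e * t \<noteq> t * e" "\<forall>c. ty c (f * y) \<longleftrightarrow> (ty c (f * x) \<noteq> (c = e))"
      using less.hyps[OF _ cv less.prems(2)] c W less.prems by blast
    then show ?thesis using f W by (intro bexI[of _ e]) auto
  next
    case False
    then have "nc t f" using f less.prems by (auto simp: nc_def)
    then have "\<not> dl f x" using nc_dl W less.prems by blast
    then have "y = f * x" using cov_dl_eq(2)[OF less.prems(1) f] by blast
    then show ?thesis using f W False by (intro bexI[of _ f]) auto
  qed
qed

text \<open>The same stripping shows that the deleted letter, and with it the lower element, is
  determined.\<close>

lemma noncommuting_edge_unique: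
  assumes "cov x1 y" "cov x2 y" "t \<in> S" "dl t x1" "dl t x2" "\<not> dl t y"
  shows "x1 = x2"
  using assms
proof (induction "len y" arbitrary: x1 x2 y rule: less_induct)
  case less
  note W = cov_W[OF less.prems(1)] cov_W[OF less.prems(2)]
  have "y \<noteq> 1" using cov_len[OF less.prems(1)] by auto
  then obtain f where f: "f \<in> S" "dl f y" using ex_dl W by blast
  have ft: "f \<noteq> t" using f less.prems by auto
  show ?case
  proof (cases "f * t = t * f")
    case True
    have c: "dl t (f * z) \<longleftrightarrow> dl t z" if "z \<in> W" for z using dl_commute[of t f z] that f ft less.prems True by simp
    have dx: "dl f x1" "dl f x2"
      using cov_dl_eq(1)[OF less.prems(1) f] cov_dl_eq(1)[OF less.prems(2) f] c[OF W(2)] less.prems by auto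
    have cv: "cov (f * x1) (f * y)" "cov (f * x2) (f * y)"
      using cov_gen_mult[OF less.prems(1) f(1)] cov_gen_mult[OF less.prems(2) f(1)] f dx by auto
    have "len (f * y) < len y" using len_dl[OF W(2) f] by simp
    then have "f * x1 = f * x2" using less.hyps[OF _ cv less.prems(3)] c W less.prems by blast
    then show ?thesis by simp
  next
    case False
    then have "nc t f" using f less.prems by (auto simp: nc_def)
    then have "\<not> dl f x1" "\<not> dl f x2" using nc_dl W less.prems by blast+
    then have "x1 = f * y" "x2 = f * y" using cov_dl_eq(1)[OF less.prems(1) f] cov_dl_eq(1)[OF less.prems(2) f] by blast+
    then show ?thesis by simp
  qed
qed

lemma no_common_lower:
  assumes c: "cov x1 y1" "cov x1 y2" "cov x2 y1" "cov x2 y2" "y1 \<noteq> y2"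
    and s: "s \<in> S" "x1 = s * y1" "dl s x2" "dl s y1" and t: "t \<in> S" "x1 = t * y2" "dl t x2" "dl t y2"
  shows False
proof -
  note W = cov_W[OF c(1)] cov_W[OF c(4)]
  have st: "s \<noteq> t" using s t c by auto
  have com: "s * t = t * s" using dl_commutes[OF W(3) s(1) t(1) s(3) t(3)] .
  have nd: "\<not> dl s x1" "\<not> dl t x1"
    using dl_gen_mult[OF W(2) s(1)] dl_gen_mult[OF W(4) t(1)] s(4) t(4) unfolding s(2)[symmetric] t(2)[symmetric] by blast+
  have "cov (s * x2) x1" using cov_gen_mult[OF c(3) s(1)] s by simp
  moreover have "dl t (s * x2)" using dl_commute[of t s x2] st com s t W by simp
  ultimately obtain f where f: "f \<in> S" "f * t \<noteq> t * f" "\<forall>c. ty c x1 \<longleftrightarrow> (ty c (s * x2) \<noteq> (c = f))"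
    using noncommuting_edge[of "s * x2" x1 t] t nd by blast
  have "cov (t * x2) x1" using cov_gen_mult[OF c(4) t(1)] t by simp
  moreover have "dl s (t * x2)" using dl_commute[of s t x2] st com s t W by simp
  ultimately obtain g where g: "g \<in> S" "g * s \<noteq> s * g" "\<forall>c. ty c x1 \<longleftrightarrow> (ty c (t * x2) \<noteq> (c = g))"
    using noncommuting_edge[of "t * x2" x1 s] s nd by blast
  \<comment> \<open>The types of \<open>s * x2\<close> and \<open>t * x2\<close> differ at
    \<open>s\<close>, so \<open>s\<close> is one of the inserted letters \<open>f\<close>,
    \<open>g\<close>. But \<open>f\<close> does not commute with \<open>t\<close>, nor
    \<open>g\<close> with \<open>s\<close>.\<close>
  have "(ty s (s * x2) \<noteq> (s = f)) = (ty s (t * x2) \<noteq> (s = g))" using f(3) g(3) by simp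
  then have "s = f \<or> s = g" using s t W st by auto
  then show False using f g com by auto
qed

lemma additive_imp_not_dr:
  assumes "nc p q" "a \<in> W" "b \<in> W" "n > 0" "len (a * alt n p q * b) = len a + n + len b"
  shows "\<not> dr p a"
proof
  assume d: "dr p a"
  note S = nc_S[OF assms(1)]
  obtain k where k: "n = Suc k" using assms(4) gr0_implies_Suc by blast
  have "a * alt n p q * b = (a * p) * alt k q p * b" using k by (simp add: mult.assoc)
  also have "len \<dots> \<le> len (a * p) + len (alt k q p) + len b"
    using len_mult_le[of "(a * p) * alt k q p" b] len_mult_le[of "a * p" "alt k q p"] assms S by fastforce
  also have "len (alt k q p) = k" using alt_len[OF nc_sym[OF assms(1)]] .
  finally show False using len_dr[OF assms(2) S(1) d] assms(5) k by simp
qed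

lemma rminI:
  assumes "nc p q" "a \<in> W" "b \<in> W" "n > 0" "len (a * alt n p q * b) = len a + n + len b"
    "len (a * alt n q p * b) = len a + n + len b"
  shows "rmin_coset p q a"
  using additive_imp_not_dr[OF assms(1-5)] additive_imp_not_dr[OF nc_sym[OF assms(1)] assms(2-4,6)] assms(2)
  by (simp add: rmin_coset_def)

text \<open>Ranks \<open>n\<close> and \<open>n + 1\<close> of a translate. The upper pair enters as
  a set because either of its members may be the one whose dihedral factor starts with
  \<open>p\<close>.\<close>

definition coset_butterfly :: "'g \<Rightarrow> 'g \<Rightarrow> nat \<Rightarrow> 'g \<Rightarrow> 'g \<Rightarrow> 'g \<Rightarrow> 'g \<Rightarrow> 'g \<Rightarrow> 'g \<Rightarrow> bool" where
  "coset_butterfly p q n a b x1 x2 y1 y2 \<longleftrightarrow> nc p q \<and> n > 0 \<and> rmin_coset p q a \<and> lmin_coset p q b \<and>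
    x1 = a * alt n p q * b \<and> x2 = a * alt n q p * b \<and>
    {y1, y2} = {a * alt (Suc n) p q * b, a * alt (Suc n) q p * b} \<and> len x1 = len a + n + len b"

lemma coset_butterfly_swap:
  assumes "coset_butterfly p q n a b x1 x2 y1 y2" "len x2 = len x1"
  shows "coset_butterfly q p n a b x2 x1 y1 y2"
  using assms nc_sym[of p q] by (auto simp: coset_butterfly_def rmin_coset_def lmin_coset_def insert_commute)

text \<open>Induction on length. A common left descent of \<open>y1\<close> and \<open>y2\<close> is
  stripped and later returned to \<open>a\<close>. Otherwise, up to exchanging \<open>x1\<close> and
  \<open>x2\<close>, \<open>y1 = s * x1\<close> and \<open>y2 = t * x2\<close>, where
  \<open>s\<close> is a descent of \<open>x2\<close> and \<open>t\<close> of \<open>x1\<close>.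
  Either \<open>t * x1 = s * x2\<close>, which starts a dihedral coset with \<open>n = 1\<close>, or
  these elements and \<open>x1\<close>, \<open>x2\<close> form a smaller butterfly that extends by
  one rank.\<close>

lemma butterfly_coset:
  assumes "cov x1 y1" "cov x1 y2" "cov x2 y1" "cov x2 y2" "x1 \<noteq> x2" "y1 \<noteq> y2"
  shows "\<exists>p q n a b. coset_butterfly p q n a b x1 x2 y1 y2"
  using assms
proof (induction "len y1" arbitrary: x1 x2 y1 y2 rule: less_induct)
  case less
  note c = less.prems
  note W = cov_W[OF c(1)] cov_W[OF c(4)]
  have lx: "len x2 = len x1" and ly: "len y2 = len y1" using c(1-4) cov_len by (metis Suc_inject, metis)
  show ?case
  proof (cases "\<exists>s\<in>S. dl s y1 \<and> dl s y2")
    case True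
    then obtain s where s: "s \<in> S" "dl s y1" "dl s y2" by blast
    have dx: "dl s x1" "dl s x2"
      using cov_dl_eq(2)[OF c(1) s(1,2)] cov_dl_eq(2)[OF c(2) s(1,3)] cov_dl_eq(2)[OF c(3) s(1,2)]
        cov_dl_eq(2)[OF c(4) s(1,3)] c(6) by metis+
    have "len (s * y1) < len y1" using len_dl[OF W(2) s(1,2)] by simp
    moreover have "cov (s * x1) (s * y1)" "cov (s * x1) (s * y2)" "cov (s * x2) (s * y1)" "cov (s * x2) (s * y2)"
      using c s dx by (simp_all add: cov_gen_mult)
    ultimately obtain p q n a b where cb: "coset_butterfly p q n a b (s * x1) (s * x2) (s * y1) (s * y2)"
      using less.hyps[of "s * y1" "s * x1" "s * y2" "s * x2"] c by auto
    have nc: "nc p q" and n: "n > 0" and ab: "rmin_coset p q a" "lmin_coset p q b"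
      and x: "s * x1 = a * alt n p q * b" "s * x2 = a * alt n q p * b"
      and y: "{s * y1, s * y2} = {a * alt (Suc n) p q * b, a * alt (Suc n) q p * b}" and l: "len (s * x1) = len a + n + len b"
      using cb unfolding coset_butterfly_def by blast+
    have abW: "a \<in> W" "b \<in> W" using ab by (auto simp: rmin_coset_def lmin_coset_def)
    note pq = nc_S[OF nc]
    have x': "x1 = (s * a) * alt n p q * b" "x2 = (s * a) * alt n q p * b"
      using arg_cong[OF x(1), of "\<lambda>z. s * z"] arg_cong[OF x(2), of "\<lambda>z. s * z"] s by (simp_all add: mult.assoc)
    have lx1: "len x1 = Suc (len a + n + len b)" using len_dl[OF W(1) s(1) dx(1)] l by simp
    have "len x1 \<le> len (s * a) + n + len b"
      using len_mult_le[of "(s * a) * alt n p q" b] len_mult_le[of "s * a" "alt n p q"] alt_len[OF nc, of n] abW s pq x' by fastforce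
    moreover have "len (s * a) \<le> Suc (len a)" using len_mult_le[of s a] abW s by simp
    ultimately have la: "len (s * a) = Suc (len a)" using lx1 by linarith
    have rm: "rmin_coset p q (s * a)"
      using rminI[OF nc _ abW(2) n, of "s * a"] x' la lx lx1 abW s by simp
    have "{y1, y2} = (\<lambda>z. s * z) ` {s * y1, s * y2}" using s by simp
    also have "\<dots> = {(s * a) * alt (Suc n) p q * b, (s * a) * alt (Suc n) q p * b}" unfolding y by (simp add: mult.assoc)
    finally have "coset_butterfly p q n (s * a) b x1 x2 y1 y2"
      unfolding coset_butterfly_def using nc n rm ab x' la lx1 by simp
    then show ?thesis by blast
  next
    case False
    have dich: "(x1 = s * y1 \<and> dl s x2) \<or> (x2 = s * y1 \<and> dl s x1)" if s: "s \<in> S" "dl s y1" for s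
    proof -
      have "\<not> dl s y2" using False s by blast
      then have "\<not> (dl s x1 \<and> dl s x2)" using noncommuting_edge_unique[OF c(2,4) s(1)] c(5) by blast
      then show ?thesis using cov_dl_eq(1)[OF c(1) s] cov_dl_eq(1)[OF c(3) s] c(5) by blast
    qed
    have dich2: "(x1 = s * y2 \<and> dl s x2) \<or> (x2 = s * y2 \<and> dl s x1)" if s: "s \<in> S" "dl s y2" for s
    proof -
      have "\<not> dl s y1" using False s by blast
      then have "\<not> (dl s x1 \<and> dl s x2)" using noncommuting_edge_unique[OF c(1,3) s(1)] c(5) by blast
      then show ?thesis using cov_dl_eq(1)[OF c(2) s] cov_dl_eq(1)[OF c(4) s] c(5) by blast
    qed
    have "y1 \<noteq> 1" "y2 \<noteq> 1" using cov_len[OF c(1)] cov_len[OF c(2)] by auto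
    then obtain s t where s: "s \<in> S" "dl s y1" and t: "t \<in> S" "dl t y2" using ex_dl W by metis
    have main: "\<exists>p q n a b. coset_butterfly p q n a b x1 x2 y1 y2"
      if c: "cov x1 y1" "cov x1 y2" "cov x2 y1" "cov x2 y2" "x1 \<noteq> x2"
      and dich: "\<And>s. s \<in> S \<Longrightarrow> dl s y1 \<Longrightarrow> (x1 = s * y1 \<and> dl s x2) \<or> (x2 = s * y1 \<and> dl s x1)"
      and dich2: "\<And>s. s \<in> S \<Longrightarrow> dl s y2 \<Longrightarrow> (x1 = s * y2 \<and> dl s x2) \<or> (x2 = s * y2 \<and> dl s x1)"
      and sx: "x1 = s * y1" "dl s x2" for x1 x2
    proof -
      note W = cov_W[OF c(1)] cov_W[OF c(4)]
      have lx: "len x2 = len x1" using c(1-4) cov_len by (metis Suc_inject)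
      have tx: "x2 = t * y2" "dl t x1"
        using dich2[OF t] no_common_lower[OF c(1-4) less.prems(6) s(1) sx s(2) t(1) _ _ t(2)] by blast+
      have only_s: "s' = s" if s': "s' \<in> S" "dl s' y1" for s'
        using dich[OF s'] no_common_lower[OF c(3,4,1,2) less.prems(6) s'(1) _ _ s'(2) t(1) tx t(2)] sx(1) by auto
      have only_t: "t' = t" if t': "t' \<in> S" "dl t' y2" for t'
        using dich2[OF t'] no_common_lower[OF c(1-4) less.prems(6) s(1) sx s(2) t'(1) _ _ t'(2)] tx(1) by auto
      have nd: "\<not> dl s x1" "\<not> dl t x2" using sx tx s t W by auto
      have y12: "y1 = s * x1" "y2 = t * x2" using sx tx s t by auto
      have st: "s \<noteq> t" using sx nd by auto
      have c': "cov (t * x1) x2" "cov (s * x2) x1"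
        using cov_gen_mult[OF c(2) t(1)] cov_gen_mult[OF c(3) s(1)] tx sx s t by auto
      have c'': "cov (t * x1) x1" "cov (s * x2) x2"
        using W s t tx(2) sx(2) len_dl[of x1 t] len_dl[of x2 s] by (auto intro!: covI)
      show ?thesis
      proof (cases "t * x1 = s * x2")
        case True
        define b where "b = t * x1"
        have b: "x1 = t * b" "b \<in> W" using t W by (simp_all add: b_def)
        have b': "x2 = s * b" unfolding b_def True using s by simp
        have nc: "nc t s"
        proof (rule ccontr)
          assume "\<not> nc t s"
          then have "t * s = s * t" using s t by (auto simp: nc_def)
          then have "y1 = y2" using y12 b b' by (metis mult.assoc)
          then show False using less.prems by simp
        qed
        have nb: "\<not> dl t b" "\<not> dl s b"
          using dl_gen_mult[OF b(2) t(1)] dl_gen_mult[OF b(2) s(1)] tx(2) sx(2) unfolding b(1)[symmetric] b'[symmetric] by blast+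
        have "coset_butterfly t s 1 1 b x1 x2 y1 y2"
          unfolding coset_butterfly_def using nc nb b b' y12 len_not_dl[of b t] t
          by (auto simp: rmin_coset_def lmin_coset_def mult.assoc)
        then show ?thesis by blast
      next
        case False
        have "len x1 < len y1" using cov_len[OF c(1)] by simp
        then obtain p q n a b where cb: "coset_butterfly p q n a b (t * x1) (s * x2) x1 x2"
          using less.hyps[OF _ c''(1) c'(1) c'(2) c''(2) False c(5)] by blast
        then have nc0: "nc p q" and ab0: "rmin_coset p q a" "lmin_coset p q b"
          and xs: "{x1, x2} = {a * alt (Suc n) p q * b, a * alt (Suc n) q p * b}" and l: "len (t * x1) = len a + n + len b" and n: "n > 0"
          unfolding coset_butterfly_def by blast+
        obtain p q where nc: "nc p q" and ab: "rmin_coset p q a" "lmin_coset p q b"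
          and x: "x1 = a * alt (Suc n) p q * b" "x2 = a * alt (Suc n) q p * b"
        proof (cases "x1 = a * alt (Suc n) p q * b")
          case True
          then show ?thesis using that[of p q] nc0 ab0 xs by (metis doubleton_eq_iff)
        next
          case False
          then have "x1 = a * alt (Suc n) q p * b" "x2 = a * alt (Suc n) p q * b" using xs by (metis doubleton_eq_iff)+
          then show ?thesis using that[of q p] nc_sym[OF nc0] ab0 by (simp add: rmin_coset_def lmin_coset_def)
        qed
        note pq = nc_S[OF nc]
        have abW: "a \<in> W" "b \<in> W" using ab by (auto simp: rmin_coset_def lmin_coset_def)
        have lx1: "len x1 = len a + Suc n + len b" using l len_dl[OF W(1) t(1) tx(2)] by simp
        have dla: "dl f (a * alt (Suc n) u v * b)" if "f \<in> S" "dl f a" "nc u v" "len (a * alt (Suc n) u v * b) = len a + Suc n + len b" for f u v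
        proof -
          have "f * (a * alt (Suc n) u v * b) = (f * a) * alt (Suc n) u v * b" by (simp add: mult.assoc)
          also have "len \<dots> \<le> len (f * a) + Suc n + len b"
            using len_mult_le[of "(f * a) * alt (Suc n) u v" b] len_mult_le[of "f * a" "alt (Suc n) u v"]
              alt_len[OF that(3), of "Suc n"] alt_W[OF nc_S[OF that(3)], of "Suc n"] abW that(1)
            by (fastforce simp del: alt.simps)
          finally show ?thesis using that(4) len_dl[OF abW(1) that(1,2)] by (simp add: dl_def del: alt.simps)
        qed
        \<comment> \<open>A left descent \<open>f\<close> of \<open>a\<close> would be one of
          \<open>x1\<close> and \<open>x2\<close>. As \<open>s\<close> is also a descent of
          \<open>x2\<close>, the two commute, and \<open>f\<close> becomes a second descent of
          \<open>y1\<close>.\<close>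
        have "a = 1"
        proof (rule ccontr)
          assume "a \<noteq> 1"
          then obtain f where f: "f \<in> S" "dl f a" using ex_dl abW by blast
          have fx: "dl f x1" "dl f x2" using dla[OF f nc] dla[OF f nc_sym[OF nc]] x lx1 lx by metis+
          have "f \<noteq> s" using fx nd by auto
          show False
          proof (cases "f * s = s * f")
            case True
            then have "dl f y1" using dl_commute[of f s x1] \<open>f \<noteq> s\<close> f s W fx y12 by simp
            then show False using only_s f \<open>f \<noteq> s\<close> by blast
          next
            case False
            then show False using dl_commutes[OF W(3) f(1) s(1) fx(2) sx(2)] by simp
          qed
        qed
        then have x': "x1 = alt (Suc n) p q * b" "x2 = alt (Suc n) q p * b" using x by simp_all
        have lb: "b \<in> W" "\<not> dl p b" "\<not> dl q b" using ab by (auto simp: lmin_coset_def)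
        have dp: "dl p x1" using alt_mult_len[OF nc lb, of "Suc n"] x' by simp
        have dq: "dl q x2" using alt_mult_len[OF nc_sym[OF nc] lb(1,3,2), of "Suc n"] x' by simp
        have "s = q"
        proof (rule ccontr)
          assume "s \<noteq> q"
          then have sp: "s * p = p * s"
            using alt_mult_dl[OF nc_sym[OF nc] lb(1,3,2) s(1), of "Suc n"] sx(2) x' n by auto
          have "p \<noteq> s" using dp nd by auto
          then have "dl p y1" using dl_commute[of p s x1] sp pq s W dp y12 by simp
          then show False using only_s pq \<open>p \<noteq> s\<close> by blast
        qed
        moreover have "t = p"
        proof (rule ccontr)
          assume "t \<noteq> p"
          then have tq: "t * q = q * t"
            using alt_mult_dl[OF nc lb t(1), of "Suc n"] tx(2) x' n by auto
          have "q \<noteq> t" using dq nd by auto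
          then have "dl q y2" using dl_commute[of q t x2] tq pq t W dq y12 by simp
          then show False using only_t pq \<open>q \<noteq> t\<close> by blast
        qed
        ultimately have "coset_butterfly p q (Suc n) a b x1 x2 y1 y2"
          unfolding coset_butterfly_def using nc ab x y12 lx1 \<open>a = 1\<close> by (auto simp: mult.assoc)
        then show ?thesis by blast
      qed
    qed
    show ?thesis
    proof (cases "x1 = s * y1 \<and> dl s x2")
      case True
      then show ?thesis using main[OF c(1-5) dich dich2] by blast
    next
      case F: False
      then have "x2 = s * y1" "dl s x1" using dich[OF s] by auto
      then have "\<exists>p q n a b. coset_butterfly p q n a b x2 x1 y1 y2"
        using main[OF c(3,4,1,2) c(5)[symmetric]] dich dich2 by blast
      then show ?thesis using coset_butterfly_swap lx by metis
    qed
  qed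
qed

section \<open>Adjacency and covers inside a dihedral translate\<close>

lemma not_in_dih: "nc p q \<Longrightarrow> c \<in> S \<Longrightarrow> c \<noteq> p \<Longrightarrow> c \<noteq> q \<Longrightarrow> c \<notin> dih p q"
  using dih_dl[of p q c c] dl_gen_mult[of 1 c] by auto

text \<open>After cancelling \<open>a\<close> and \<open>b\<close>, the two reflections leading from
  \<open>z\<close> have the product \<open>g1 * ginv g2\<close>, so
  \<open>reflections_in_dih\<close> puts both into \<open>dih p q\<close>.\<close>

lemma coset_closed:
  assumes nc: "nc p q" and W: "a \<in> W" "b \<in> W" "z \<in> W" and g: "g1 \<in> dih p q" "g2 \<in> dih p q" "g1 \<noteq> g2"
    and adj: "adj z (a * g1 * b)" "adj z (a * g2 * b)"
  shows "\<exists>g\<in>dih p q. z = a * g * b"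
proof -
  define z' where "z' = ginv a * z * ginv b"
  have z: "z = a * z' * b" by (simp add: z'_def mult.assoc)
  have z'W: "z' \<in> W" using W by (simp add: z'_def)
  have "adj (a * z' * b) (a * g1 * b)" "adj (a * z' * b) (a * g2 * b)" using adj z by simp_all
  then have "adj z' g1" "adj z' g2" using W by simp_all
  then have T: "g1 * ginv z' \<in> T" "g2 * ginv z' \<in> T" by (simp_all add: adj_iff)
  have "ginv (g2 * ginv z') = g2 * ginv z'" using T_ginv[OF T(2)] .
  then have "(g1 * ginv z') * (g2 * ginv z') = (g1 * ginv z') * ginv (g2 * ginv z')" by simp
  also have "\<dots> = g1 * ginv g2" by (simp add: mult.assoc)
  finally have "(g1 * ginv z') * (g2 * ginv z') \<in> dih p q" using g nc by auto
  moreover have "g1 * ginv z' \<noteq> g2 * ginv z'" using g by simp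
  ultimately have "g1 * ginv z' \<in> dih p q" using reflections_in_dih(1)[OF _ _ T] nc by (auto simp: nc_def)
  then have "ginv (g1 * ginv z') * g1 \<in> dih p q" using g nc by blast
  then have "z' \<in> dih p q" by (simp add: mult.assoc)
  then show ?thesis using z by blast
qed

text \<open>The rank difference is odd; a difference of three or more leaves room for two
  intermediate arrows, contradicting the cover.\<close>

lemma coset_cov_rank:
  assumes nc: "nc p q" and ab: "rmin_coset p q a" "lmin_coset p q b" and g: "g \<in> dih p q" "h \<in> dih p q"
    and c: "cov (a * g * b) (a * h * b)"
  shows "len h = Suc (len g)"
proof -
  have W: "a \<in> W" "b \<in> W" "g \<in> W" "h \<in> W" using ab g dih_W[OF nc] by (auto simp: lmin_coset_def rmin_coset_def)
  have "adj g h" using cov_adj[OF c] W by simp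
  then have odd: "odd (len g + len h)" using adj_parity W by auto
  have ar: "arrow (a * g * b) (a * h * b)" if "g \<in> dih p q" "h \<in> dih p q" "len g < len h" "odd (len g + len h)" for g h
    using coset_arrow[OF nc ab that] .
  have "\<not> len h < len g" using ar[OF g(2,1)] odd arrow_len[of "a * h * b" "a * g * b"] cov_len[OF c] by (auto simp: add.commute)
  moreover have False if l: "len h \<noteq> Suc (len g)" "len g < len h"
  proof -
    have l3: "len g + 3 \<le> len h" using l odd by presburger
    note L = alt_len[OF nc]
    have "arrow (a * g * b) (a * alt (len g + 1) p q * b)"
      "arrow (a * alt (len g + 1) p q * b) (a * alt (len g + 2) p q * b)"
      "arrow (a * alt (len g + 2) p q * b) (a * h * b)"
      by (rule ar; use g odd l3 in \<open>simp add: L del: alt.simps\<close>)+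
    from this[THEN arrow_len] show False using cov_len[OF c] by linarith
  qed
  ultimately have "len h = Suc (len g) \<or> len h = len g" by (meson linorder_neqE_nat)
  then show ?thesis using odd by auto
qed

text \<open>If \<open>a\<close> is matched downwards to \<open>z\<close> and \<open>x\<close> upwards to \<open>y\<close>, an edge-preserving matching makes \<open>z\<close> and \<open>y\<close> adjacent.\<close>

definition lower_square :: "'g \<Rightarrow> 'g \<Rightarrow> 'g \<Rightarrow> 'g \<Rightarrow> 'g \<Rightarrow> bool" where
  "lower_square z a x b y \<longleftrightarrow> cov z a \<and> adj z y \<and> cov a x \<and> cov x y \<and> cov a b \<and> cov b y \<and> x \<noteq> b"

lemma lower_square_gen:
  assumes s: "s \<in> S" and sq: "lower_square z (s * a) (s * x) (s * b) (s * y)"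
    and W: "a \<in> W" "x \<in> W" "b \<in> W" "y \<in> W" and d: "\<not> dl s a" "\<not> dl s x" "\<not> dl s b" "\<not> dl s y"
  shows "lower_square (s * z) a x b y"
proof -
  have q: "cov z (s * a)" "adj z (s * y)" "cov (s * a) (s * x)" "cov (s * x) (s * y)" "cov (s * a) (s * b)"
    "cov (s * b) (s * y)" "x \<noteq> b" using sq by (auto simp: lower_square_def)
  have dd: "dl s (s * a)" "dl s (s * x)" "dl s (s * b)" "dl s (s * y)" using d s W by simp_all
  have c: "cov a x" "cov x y" "cov a b" "cov b y"
    using cov_gen_mult[OF q(3) s] cov_gen_mult[OF q(4) s] cov_gen_mult[OF q(5) s] cov_gen_mult[OF q(6) s] dd s by simp_all
  have zW: "z \<in> W" using cov_W q by blast
  show ?thesis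
  proof (cases "dl s z")
    case True
    then have "cov (s * z) a" using cov_gen_mult[OF q(1) s] dd s by simp
    moreover have "adj (s * z) y" using q(2) adj_mult_left[of s z "s * y"] s by simp
    ultimately show ?thesis using c q(7) by (simp add: lower_square_def)
  next
    case False
    \<comment> \<open>In this case \<open>s * a\<close> would be a third midpoint between
      \<open>a\<close> and \<open>y\<close>.\<close>
    then have z: "z = a" using cov_dl_eq(1)[OF q(1) s dd(1)] s by simp
    have l: "len (s * y) = Suc (len y)" "len (s * a) = Suc (len a)" using len_not_dl s W d by auto
    have "arrow a (s * y)" using q(2) z W(1) l cov_len[OF c(1)] cov_len[OF c(2)] by (intro arrowI) auto
    moreover have "s * y \<noteq> s * a" using cov_len[OF c(1)] cov_len[OF c(2)] by auto
    ultimately have "arrow (s * a) y" using arrow_gen_mult[of a "s * y" s] s by simp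
    then have "cov (s * a) y" using l cov_len[OF c(1)] cov_len[OF c(2)] by (simp add: cov_def)
    moreover have "cov a (s * a)" using l W s by (intro covI) auto
    ultimately have "s * a = x \<or> s * a = b" using mid_unique[OF c q(7)] by blast
    then show ?thesis using dd d by auto
  qed
qed

lemma lower_square_left:
  assumes "g \<in> W" "lower_square z (g * a) (g * x) (g * b) (g * y)"
    and "a \<in> W" "x \<in> W" "b \<in> W" "y \<in> W"
    and "len (g * a) = len g + len a" "len (g * x) = len g + len x" "len (g * b) = len g + len b" "len (g * y) = len g + len y"
  shows "\<exists>z'. lower_square z' a x b y"
  using assms
proof (induction g arbitrary: z rule: W_left_induct)
  case one then show ?case by auto
next
  case (gen s g)
  have step: "len (g * e) = len g + len e \<and> \<not> dl s (g * e)" if "e \<in> W" "len (s * g * e) = len (s * g) + len e" for e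
  proof -
    have "len (s * g) = Suc (len g)" using len_not_dl gen.hyps by blast
    moreover have "len (g * e) \<le> len g + len e" using len_mult_le gen.hyps that by blast
    moreover have "len (s * (g * e)) \<le> Suc (len (g * e))" using len_mult_le[of s "g * e"] gen.hyps that by simp
    ultimately show ?thesis using that by (auto simp: mult.assoc dl_def)
  qed
  have "lower_square z (s * (g * a)) (s * (g * x)) (s * (g * b)) (s * (g * y))" using gen.prems by (simp add: mult.assoc)
  then have "lower_square (s * z) (g * a) (g * x) (g * b) (g * y)"
    using gen.prems gen.hyps step by (intro lower_square_gen) simp_all
  then show ?case using gen.IH gen.prems step by blast
qed

lemma lower_square_ginv: "lower_square z a x b y \<Longrightarrow> lower_square (ginv z) (ginv a) (ginv x) (ginv b) (ginv y)"
  unfolding lower_square_def using cov_W[of z a] cov_W[of a x] cov_W[of x y] cov_W[of a b]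
  by (auto dest: arg_cong[of "ginv x" "ginv b" ginv])

lemma lower_square_right:
  assumes "g \<in> W" "lower_square z (a * g) (x * g) (b * g) (y * g)"
    and "a \<in> W" "x \<in> W" "b \<in> W" "y \<in> W"
    and "len (a * g) = len a + len g" "len (x * g) = len x + len g" "len (b * g) = len b + len g" "len (y * g) = len y + len g"
  shows "\<exists>z'. lower_square z' a x b y"
proof -
  have l: "len (ginv g * ginv e) = len (ginv g) + len (ginv e)" if "e \<in> W" "len (e * g) = len e + len g" for e
    using len_ginv[of "e * g"] that assms(1) by simp
  obtain z' where "lower_square z' (ginv a) (ginv x) (ginv b) (ginv y)"
    using lower_square_left[of "ginv g" "ginv z" "ginv a" "ginv x" "ginv b" "ginv y"] lower_square_ginv[OF assms(2)] assms l by auto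
  then show ?thesis using lower_square_ginv[of z' "ginv a" "ginv x" "ginv b" "ginv y"] by auto
qed

lemma dih_not_ty: "nc p q \<Longrightarrow> x \<in> dih p q \<Longrightarrow> c \<noteq> p \<Longrightarrow> c \<noteq> q \<Longrightarrow> \<not> ty c x"
proof -
  assume *: "nc p q" "c \<noteq> p" "c \<noteq> q" "x \<in> dih p q"
  then obtain w where w: "w \<in> lists {p, q}" "x = prod_list w" unfolding dih_def by blast
  then have "c \<notin> set w" using * by auto
  then have "count_list w c = 0" by simp
  moreover have "w \<in> lists S" using w(1) nc_S[OF *(1)] by auto
  ultimately show ?thesis using w ty_word[of w c] by simp
qed

text \<open>As a deletion from \<open>R'\<close>, \<open>z\<close> contains \<open>q\<close> an even
  number of times. As a deletion from a word for \<open>R * q\<close> it either keeps the single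
  \<open>q\<close> or equals \<open>R\<close>, which is too long.\<close>

lemma no_lower_square_dih:
  assumes nc: "nc p c" and q: "q \<in> S" "q \<noteq> p" "q \<noteq> c" and R: "R' \<in> dih p c" "R \<in> dih p c"
  shows "\<not> lower_square z R' R (R' * q) (R * q)"
proof
  assume "lower_square z R' R (R' * q) (R * q)"
  then have s: "cov z R'" "adj z (R * q)" "cov R' R" "cov R (R * q)" by (auto simp: lower_square_def)
  have W: "z \<in> W" "R' \<in> W" "R \<in> W" using s cov_W by auto
  have del: "\<exists>u d v. w = u @ d # v \<and> z = prod_list (u @ v)"
    if w: "w \<in> lists S" "adj z (prod_list w)" "len z < len (prod_list w)" for w
  proof -
    obtain t where t: "t \<in> T" "z = t * prod_list w" using adj_sym[OF w(2)] by (auto simp: adj_def)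
    then have "nn (prod_list w) t" using less_iff_nn[of "prod_list w" t] w by simp
    from exchange[OF w(1) this] show ?thesis using t by blast
  qed
  have wS: "w \<in> lists S" if "w \<in> lists {p, c}" for w using that nc_S[OF nc] by auto
  obtain w' where w': "w' \<in> lists {p, c}" "R' = prod_list w'" using R unfolding dih_def by blast
  obtain w where w: "w \<in> lists {p, c}" "R = prod_list w" using R unfolding dih_def by blast
  obtain u d v where "w' = u @ d # v" "z = prod_list (u @ v)"
    using del[OF wS[OF w'(1)]] w' cov_adj[OF s(1)] cov_len[OF s(1)] by auto
  then have "z \<in> dih p c" using w' unfolding dih_def by (intro image_eqI[of _ _ "u @ v"]) auto
  then have nt: "\<not> ty q z" using dih_not_ty[OF nc] q by blast
  have "w @ [q] \<in> lists S" "R * q = prod_list (w @ [q])" using wS[OF w(1)] w q by auto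
  moreover have "len z < len (R * q)" using cov_len[OF s(1)] cov_len[OF s(3)] cov_len[OF s(4)] by simp
  ultimately obtain u d v where u: "w @ [q] = u @ d # v" "z = prod_list (u @ v)" using del[of "w @ [q]"] s(2) by auto
  show False
  proof (cases v rule: rev_cases)
    case Nil
    then have "z = R" using u w by simp
    then show False using cov_len[OF s(1)] cov_len[OF s(3)] by simp
  next
    case (snoc v' e)
    then have e: "e = q" "w = u @ d # v'" using u by auto
    then have "u @ v' \<in> lists {p, c}" using w by auto
    then have d: "prod_list (u @ v') \<in> dih p c" unfolding dih_def by blast
    have "z = prod_list (u @ v') * q" using u snoc e by (simp add: mult.assoc)
    then have "ty q z" using q d dih_not_ty[OF nc d] dih_W[OF nc d] by simp
    then show False using nt by blast
  qed
qed

text \<open>Without a lower square \<open>f\<close> is matched upwards, to a midpoint of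
  \<open>f\<close> and \<open>M x\<close>. There are two midpoints, and \<open>x\<close> is matched
  elsewhere.\<close>

lemma matching_forced:
  assumes hm: "hasse_matching I M" and ad: "preserves_adj I M" and I: "f \<in> I" "x \<in> I"
    and c: "cov f x" "cov x (M x)" "cov f H" "cov H (M x)" "H \<noteq> x" and n: "\<not> lower_square (M f) f x H (M x)"
  shows "M f = H"
proof -
  have a: "adj (M f) (M x)" using ad I cov_adj[OF c(1)] by (auto simp: preserves_adj_def)
  have nd: "\<not> cov (M f) f" using n a c by (auto simp: lower_square_def)
  then have up: "cov f (M f)" using hasse_matchingD(3)[OF hm I(1)] by blast
  then have "cov (M f) (M x)" using a cov_len[OF up] cov_len[OF c(1)] cov_len[OF c(2)] cov_W[OF up] by (intro covI) auto
  then have "M f = x \<or> M f = H" using mid_unique[OF c(1-4) c(5)[symmetric] up] by blast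
  moreover have "M f \<noteq> x"
  proof
    assume "M f = x"
    then have "M x = f" using hasse_matchingD(2)[OF hm I(1)] by simp
    then show False using cov_len[OF c(1)] cov_len[OF c(2)] by simp
  qed
  ultimately show ?thesis by blast
qed

lemma dr_commute:
  assumes "s \<in> S" "t \<in> S" "s \<noteq> t" "s * t = t * s" "x \<in> W"
  shows "dr s (x * t) \<longleftrightarrow> dr s x"
  using dl_commute[OF assms(1-4), of "ginv x"] dl_ginv[of "x * t" s] dl_ginv[of x s] assms by simp

text \<open>Requiring \<open>a X\<close> to be reduced makes the quotient \<open>X\<close> unique.\<close>

definition lquot :: "'g \<Rightarrow> 'g \<Rightarrow> 'g \<Rightarrow> bool" where
  "lquot a u X \<longleftrightarrow> X \<in> W \<and> len (a * X) = len a + len X \<and>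
    (\<forall>z\<in>W. len (a * z) = len a + len z \<longrightarrow> (ble u (a * z) \<longleftrightarrow> ble X z))"

lemma lquot_unique: "lquot a u X \<Longrightarrow> lquot a u Y \<Longrightarrow> X = Y"
  unfolding lquot_def by (metis ble_antisym ble_refl)

text \<open>Enlarging the divisor by a letter is the Galois connection \<open>ble_lmin_iff\<close>;
  reducedness ensures \<open>lmax c z = c * z\<close>.\<close>

lemma lquot_gen:
  assumes X: "lquot a u X" and a: "a \<in> W" and c: "c \<in> S" "\<not> dr c a"
  shows "lquot (a * c) u (lmin c X)"
  unfolding lquot_def
proof (intro conjI ballI impI)
  have XW: "X \<in> W" and aX: "len (a * X) = len a + len X" using X by (auto simp: lquot_def)
  have lac: "len (a * c) = Suc (len a)" using len_not_dr a c by blast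
  show "lmin c X \<in> W" using XW c by simp
  show "len (a * c * lmin c X) = len (a * c) + len (lmin c X)"
  proof (cases "dl c X")
    case True
    then show ?thesis using lac aX len_dl[OF XW c(1) True] c(1) by (simp add: lmin_def mult.assoc)
  next
    case False
    have "\<not> dl e X" if e: "e \<in> S" "dr e (a * c)" for e
    proof
      assume d: "dl e X"
      have "e \<noteq> c" using d False by blast
      moreover have "e * c = c * e" using dr_commutes[of "a * c" e c] e a c by simp
      ultimately have "dr e a" using e dr_commute[OF e(1) c(1) _ _ a] by blast
      then show False using additive_disjoint[OF a XW aX e(1)] d by blast
    qed
    then show ?thesis using len_mult_additive[of "a * c" X] a c XW False by (simp add: lmin_def)
  qed
  fix z assume z: "z \<in> W" "len (a * c * z) = len (a * c) + len z"
  have "len (a * (c * z)) \<le> len a + len (c * z)" using len_mult_le z a c by simp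
  moreover have "len (c * z) \<le> Suc (len z)" using len_mult_le[of c z] z c by simp
  ultimately have l: "len (c * z) = Suc (len z)" "len (a * (c * z)) = len a + len (c * z)"
    using z lac by (simp_all add: mult.assoc)
  then have "lmax c z = c * z" by (simp add: lmax_def dl_def)
  then have "ble (lmin c X) z \<longleftrightarrow> ble X (c * z)" using ble_lmin_iff[of X z c] XW c z by simp
  also have "\<dots> \<longleftrightarrow> ble u (a * (c * z))" using X c z l by (simp add: lquot_def)
  finally show "ble u (a * c * z) \<longleftrightarrow> ble (lmin c X) z" by (simp add: mult.assoc)
qed

lemma lquot_ex: assumes "u \<in> W" "a \<in> W" shows "\<exists>X. lquot a u X"
proof -
  have "\<exists>X. lquot (ginv y) u X" if "y \<in> W" for y
    using that
  proof (induction y rule: W_left_induct)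
    case one then show ?case using assms by (intro exI[of _ u]) (simp add: lquot_def)
  next
    case (gen s y)
    then obtain X where "lquot (ginv y) u X" by blast
    then have "lquot (ginv y * s) u (lmin s X)" using gen.hyps by (intro lquot_gen) auto
    then show ?case using gen.hyps by auto
  qed
  from this[of "ginv a"] show ?thesis using assms by simp
qed

lemma dr_dih:
  assumes "nc p q" "e \<in> S" "e * p = p * e" "e * q = q * e" "e \<noteq> p" "e \<noteq> q" "a \<in> W" "g \<in> dih p q"
  shows "dr e (a * g) \<longleftrightarrow> dr e a"
proof -
  obtain w where "w \<in> lists {p, q}" "g = prod_list w" using assms unfolding dih_def by blast
  moreover have "w \<in> lists {p, q} \<Longrightarrow> dr e (a * prod_list w) \<longleftrightarrow> dr e a" for w
    using assms(7)
  proof (induction w arbitrary: a)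
    case (Cons s w)
    then have s: "s \<in> S" "e \<noteq> s" "e * s = s * e" using assms nc_S[of p q] by auto
    then have "dr e (a * s * prod_list w) \<longleftrightarrow> dr e (a * s)" using Cons by auto
    then show ?case using dr_commute[OF assms(2) s(1,2,3) Cons.prems(2)] by (simp add: mult.assoc)
  qed simp
  ultimately show ?thesis by blast
qed

text \<open>A member \<open>z\<close> of the next lower rank is adjacent to \<open>x\<close> and
  \<open>M y\<close>, so \<open>M z\<close> is in the translate, and it lies below \<open>z\<close>
  because \<open>x\<close> and \<open>M y\<close> are already matched upwards. The other element
  \<open>z'\<close> of this rank is then also in the interval and matched downwards, and the cover
  from \<open>M z\<close> to \<open>z'\<close> is bad and shorter.\<close>

lemma lower_rank_empty:
  fixes u v
  defines "I \<equiv> interval u v"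
  assumes hm: "hasse_matching I M" and ad: "preserves_adj I M" and bad: "bad I M x y"
    and minimal: "\<And>x' y'. bad I M x' y' \<Longrightarrow> len x \<le> len x'"
    and nc: "nc p q" and ab: "rmin_coset p q a" "lmin_coset p q b"
    and D: "g \<in> dih p q" "g' \<in> dih p q" "h \<in> dih p q" "h' \<in> dih p q" "w \<in> dih p q"
    and eq: "x = a * g * b" "M y = a * g' * b" "y = a * h * b" "M x = a * h' * b"
    and l: "Suc (len w) = len g"
  shows "a * w * b \<notin> I"
proof
  assume wI: "a * w * b \<in> I"
  note P = bad_partner[OF hm ad bad]
  have B: "x \<in> I" "y \<in> I" "cov x y" "cov x (M x)" "cov (M y) y" using bad by (auto simp: bad_def)
  have W: "a \<in> W" "b \<in> W" using ab by (auto simp: lmin_coset_def rmin_coset_def)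
  have lh: "len h = Suc (len g)" "len h' = Suc (len g)" "len h = Suc (len g')"
    using coset_cov_rank[OF nc ab] B D eq by metis+
  have gg: "g \<noteq> g'" and hh: "h \<noteq> h'" using P eq by auto
  have key: "\<exists>g0\<in>dih p q. M (a * w * b) = a * g0 * b \<and> len w = Suc (len g0)"
    if w: "w \<in> dih p q" "Suc (len w) = len g" "a * w * b \<in> I" for w
  proof -
    let ?z = "a * w * b"
    have "odd (len w + len g)" "odd (len w + len g')" using w(2) lh by presburger+
    then have "adj w g" "adj w g'" using dih_adj[OF nc w(1)] D by blast+
    then have aw: "adj ?z x" "adj ?z (M y)" unfolding eq(1,2) using W by simp_all
    have Mz: "M ?z \<in> I" "M (M ?z) = ?z" "cov ?z (M ?z) \<or> cov (M ?z) ?z" using hasse_matchingD[OF hm w(3)] by auto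
    have "adj (M ?z) (M x)" "adj (M ?z) (M (M y))" using ad w(3) B(1) P(3) aw by (auto simp: preserves_adj_def)
    then have "adj (M ?z) (a * h' * b)" "adj (M ?z) (a * h * b)" using eq P(5) by auto
    then obtain g0 where g0: "g0 \<in> dih p q" "M ?z = a * g0 * b"
      using coset_closed[OF nc W _ D(4,3)] hh Mz(1) interval_W unfolding I_def by metis
    have "\<not> cov ?z (M ?z)"
    proof
      assume "cov ?z (M ?z)"
      then have "len g0 = len g" using coset_cov_rank[OF nc ab w(1) g0(1)] g0(2) w(2) by simp
      then have "g0 = g \<or> g0 = g'" using dih_len_eq[OF nc D(1,2) g0(1)] lh gg by simp
      then have "M ?z = x \<or> M ?z = M y" using g0 eq by auto
      then have "?z = M x \<or> ?z = y" using Mz(2) P(5) by metis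
      then have "w = h' \<or> w = h" using eq by auto
      then show False using lh w by auto
    qed
    then have "cov (a * g0 * b) ?z" using Mz(3) g0 by simp
    then have "len w = Suc (len g0)" using coset_cov_rank[OF nc ab g0(1) w(1)] by blast
    then show ?thesis using g0 by blast
  qed
  obtain g0 where g0: "g0 \<in> dih p q" "M (a * w * b) = a * g0 * b" "len w = Suc (len g0)"
    using key[OF D(5) l wI] by blast
  \<comment> \<open>The rank of \<open>w\<close> is positive because of \<open>g0\<close>, so there
    is a second element \<open>w'\<close> of this rank.\<close>
  have "w \<noteq> alt (len w) p q \<or> w \<noteq> alt (len w) q p" using alt_neq[OF nc, of "len w"] g0(3) by auto
  then obtain w' where w': "w' \<in> dih p q" "len w' = len w" "w' \<noteq> w"
    using alt_len[OF nc, of "len w"] alt_len[OF nc_sym[OF nc], of "len w"] alt_dih by metis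
  have Mz: "M (a * w * b) \<in> I" "M (M (a * w * b)) = a * w * b" "cov (M (a * w * b)) (a * w * b)"
    using hasse_matchingD[OF hm wI] coset_arrow[OF nc ab g0(1) D(5)] g0(2,3)
      arrow_len[of "a * g0 * b" "a * w * b"] cov_len[of "a * w * b" "a * g0 * b"] by auto
  have up: "arrow (M (a * w * b)) (a * w' * b)" unfolding g0(2) by (rule coset_arrow[OF nc ab g0(1) w'(1)]) (use w'(2) g0(3) in presburger)+
  have "arrow (a * w' * b) x" unfolding eq(1) by (rule coset_arrow[OF nc ab w'(1) D(1)]) (use w'(2) l in presburger)+
  then have w'I: "a * w' * b \<in> I" using interval_between Mz(1) B(1) up arrow_ble unfolding I_def by blast
  obtain g1 where g1: "g1 \<in> dih p q" "M (a * w' * b) = a * g1 * b" "len w' = Suc (len g1)"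
    using key[OF w'(1) _ w'I] w' l by auto
  have Mz': "M (M (a * w' * b)) = a * w' * b" "cov (M (a * w' * b)) (a * w' * b)"
    using hasse_matchingD[OF hm w'I] coset_arrow[OF nc ab g1(1) w'(1)] g1(2,3)
      arrow_len[of "a * g1 * b" "a * w' * b"] cov_len[of "a * w' * b" "a * g1 * b"] by auto
  have down: "arrow (M (a * w' * b)) (a * w * b)" unfolding g1(2) by (rule coset_arrow[OF nc ab g1(1) D(5)]) (use w'(2) g1(3) in presburger)+
  have "len (a * w' * b) = Suc (len (M (a * w * b)))"
    using arrow_len[OF up] arrow_len[OF down] cov_len[OF Mz(3)] cov_len[OF Mz'(2)] by linarith
  then have "cov (M (a * w * b)) (a * w' * b)" using up by (simp add: cov_def)
  moreover have "M (M (a * w * b)) \<noteq> a * w' * b" using Mz(2) w' by simp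
  ultimately have "bad I M (M (a * w * b)) (a * w' * b)" using Mz Mz' w'I by (simp add: bad_def)
  then have "len x \<le> len (M (a * w * b))" using minimal by blast
  moreover have "arrow (a * w * b) x" unfolding eq(1) by (rule coset_arrow[OF nc ab D(5,1)]) (use l in presburger)+
  ultimately show False using arrow_len[of "a * w * b" x] cov_len[OF Mz(3)] by simp
qed

end

section \<open>Right-angled groups: a minimal bad cover\<close>

text \<open>The alternative position, with \<open>M x\<close> and \<open>y\<close> interchanged, is carried to this one by inversion.\<close>

locale minimal_bad = right_angled_coxeter S m for S :: "'g::grp set" and m +
  fixes u v :: 'g and M :: "'g \<Rightarrow> 'g" and p q :: 'g and n :: nat and a b x y :: 'g
  assumes hm: "hasse_matching (interval u v) M" and ad: "preserves_adj (interval u v) M"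
    and bad: "bad (interval u v) M x y"
    and minimal: "\<And>x' y'. bad (interval u v) M x' y' \<Longrightarrow> len x \<le> len x'"
    and nc: "nc p q" and n: "n > 0" and rm: "rmin_coset p q a" and lm: "lmin_coset p q b"
    and x_eq: "x = a * (alt n p q * b)" and My_eq: "M y = a * (alt n q p * b)"
    and Mx_eq: "M x = a * (q * (alt n p q * b))" and y_eq: "y = a * (p * (alt n q p * b))"
    and len_x: "len x = len a + n + len b"
begin

lemmas partner = bad_partner[OF hm ad bad]

lemma bad_facts: "x \<in> interval u v" "y \<in> interval u v" "cov x y" "cov x (M x)" "cov (M y) y" "M x \<noteq> y"
  using bad by (auto simp: bad_def)

text \<open>The configuration is symmetric under exchanging \<open>x\<close> with
  \<open>M y\<close>, \<open>y\<close> with \<open>M x\<close> and \<open>p\<close> with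
  \<open>q\<close>. Later results are applied to both versions.\<close>

lemma swap: "minimal_bad S m u v M q p n a b (M y) (M x)"
proof unfold_locales
  show "bad (interval u v) M (M y) (M x)" using partner bad_facts by (auto simp: bad_def)
  have l: "len (M y) = len x" using cov_len[OF bad_facts(3)] cov_len[OF bad_facts(5)] by simp
  then show "\<And>x' y'. bad (interval u v) M x' y' \<Longrightarrow> len (M y) \<le> len x'" using minimal by simp
  show "len (M y) = len a + n + len b" using l len_x by simp
qed (use hm ad nc n rm lm x_eq My_eq Mx_eq y_eq partner in
    \<open>auto simp: nc_sym rmin_coset_def lmin_coset_def\<close>)

lemma mem [simp, intro]: "p \<in> S" "q \<in> S" "a \<in> W" "b \<in> W" "p \<noteq> q"
  using nc_S[OF nc] nc_neq[OF nc] rm lm by (auto simp: rmin_coset_def lmin_coset_def)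

lemma not_d: "\<not> dr p a" "\<not> dr q a" "\<not> dl p b" "\<not> dl q b"
  using rm lm by (auto simp: rmin_coset_def lmin_coset_def)

definition P where "P = alt n p q * b"
definition Q where "Q = alt n q p * b"

lemma PQ_W [simp, intro]: "P \<in> W" "Q \<in> W"
  unfolding P_def Q_def by (simp_all)

lemma len_PQ: "len P = n + len b" "len Q = n + len b"
  unfolding P_def Q_def using alt_mult_len[OF nc] alt_mult_len[OF nc_sym[OF nc]] not_d by auto

lemma dl_PQ: "dl p P" "\<not> dl q P" "dl q Q" "\<not> dl p Q"
proof -
  show "dl p P" "dl q Q" 
    unfolding P_def Q_def using alt_mult_len[OF nc] alt_mult_len[OF nc_sym[OF nc]] not_d n by auto
  then show "\<not> dl q P" "\<not> dl p Q" using nc_dl[OF nc] nc_dl[OF nc_sym[OF nc]] by auto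
qed

lemma eqs: "x = a * P" "M y = a * Q" "M x = a * (q * P)" "y = a * (p * Q)"
  using x_eq My_eq Mx_eq y_eq by (simp_all add: P_def Q_def)

lemma lens: "len (a * P) = len a + len P" "len (a * Q) = len a + len Q"
    "len (a * (q * P)) = len a + Suc (len P)" "len (a * (p * Q)) = len a + Suc (len Q)"
  using len_x len_PQ cov_len[OF bad_facts(3)] cov_len[OF bad_facts(4)] cov_len[OF bad_facts(5)]
  unfolding eqs(1)[symmetric] eqs(2-4)[symmetric] by linarith+

lemma not_dl_P: "e \<in> S \<Longrightarrow> dr e a \<Longrightarrow> \<not> dl e P"
  using additive_disjoint[OF _ _ lens(1)] by auto

lemma not_dl_Q: "e \<in> S \<Longrightarrow> dr e a \<Longrightarrow> \<not> dl e Q"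
  using additive_disjoint[OF _ _ lens(2)] by auto

lemma dl_P: "e \<in> S \<Longrightarrow> dl e P \<Longrightarrow> e = p \<or> e \<noteq> p \<and> e \<noteq> q \<and> e * p = p * e \<and> dl e b \<and> (n > 1 \<longrightarrow> e * q = q * e)"
  using alt_mult_dl[OF nc _ not_d(3,4) _ _ n, of e] unfolding P_def by auto

lemma dl_Q: "e \<in> S \<Longrightarrow> dl e Q \<Longrightarrow> e = q \<or> e \<noteq> q \<and> e \<noteq> p \<and> e * q = q * e \<and> dl e b \<and> (n > 1 \<longrightarrow> e * p = p * e)"
  using alt_mult_dl[OF nc_sym[OF nc] _ not_d(4,3) _ _ n, of e] unfolding Q_def by auto

text \<open>By \<open>low_not_in\<close> below, \<open>a w b\<close> of rank \<open>n - 1\<close> cannot be reduced although \<open>u\<close> divided by \<open>a\<close> lies below \<open>w b\<close>;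
\<open>c\<close> is the generator that cancels.\<close>

definition removable :: "'g \<Rightarrow> 'g \<Rightarrow> 'g \<Rightarrow> bool" where
  "removable c w X \<longleftrightarrow> c \<in> S \<and> dr c a \<and> dl c b \<and> lquot (a * c) u X \<and> ble X (w * b) \<and> c * w = w * c \<and>
    (n = 1 \<and> w = 1 \<or> n = 2 \<and> (w = p \<or> w = q))"

lemma low_not_in:
  assumes w: "w \<in> dih p q" "Suc (len w) = n"
  shows "a * w * b \<notin> interval u v"
proof (rule lower_rank_empty[OF hm ad bad minimal nc rm lm])
  show "x = a * alt n p q * b" "M y = a * alt n q p * b" using x_eq My_eq by (simp_all add: mult.assoc)
  show "M x = a * alt (Suc n) q p * b" "y = a * alt (Suc n) p q * b" using Mx_eq y_eq by (simp_all add: mult.assoc)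
  show "Suc (len w) = len (alt n p q)" using w alt_len[OF nc] by simp
qed (use w in \<open>auto simp del: alt.simps\<close>)

text \<open>The quotient of \<open>u\<close> by \<open>a\<close> lies below \<open>P\<close> and
  \<open>Q\<close> and cannot have both descents \<open>p\<close> and \<open>q\<close>, so it lies
  below some \<open>w * b\<close> of rank \<open>n - 1\<close>. Since \<open>a * w * b\<close> is
  not in the interval, a letter \<open>c\<close> must cancel. For \<open>n > 2\<close> it would
  commute with \<open>p\<close> and \<open>q\<close>, hence be a descent of \<open>P\<close>, and
  the product \<open>a * P\<close> would not be reduced.\<close>

lemma ex_removable: "\<exists>c w X. removable c w X"
proof -
  obtain k where k: "n = Suc k" using n gr0_implies_Suc by blast
  have uW: "u \<in> W" using bad_facts(1) by (auto simp: interval_def dest: ble_W)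
  obtain X where X: "lquot a u X" using lquot_ex[OF uW] by blast
  have XW: "X \<in> W" using X by (simp add: lquot_def)
  have "ble u (a * P)" "ble u (a * Q)"
    using bad_facts(1) partner(3) unfolding eqs(2) unfolding eqs(1) by (auto simp: interval_def)
  then have XP: "ble X P" "ble X Q" using X lens by (auto simp: lquot_def)
  have P': "p * P = alt k q p * b" "q * Q = alt k p q * b" unfolding P_def Q_def unfolding k by (simp_all add: mult.assoc)
  obtain p' q' where pq': "(p' = p \<and> q' = q) \<or> (p' = q \<and> q' = p)" and Xw: "ble X (alt k q' p' * b)"
  proof (cases "dl p X")
    case False
    have "ble (lmin p X) (lmin p P)" using ble_lmin_lmax(1)[OF XP(1)] by simp
    then have "ble X (alt k q p * b)" using False dl_PQ P' by (simp add: lmin_def)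
    then show ?thesis using that by blast
  next
    case True
    then have "\<not> dl q X" using nc_dl[OF nc XW] by blast
    moreover have "ble (lmin q X) (lmin q Q)" using ble_lmin_lmax(1)[OF XP(2)] by simp
    ultimately have "ble X (alt k p q * b)" using dl_PQ P' by (simp add: lmin_def)
    then show ?thesis using that by blast
  qed
  define w where "w = alt k q' p'"
  have nc': "nc q' p'" and b': "\<not> dl q' b" "\<not> dl p' b" and a': "\<not> dr q' a" using pq' nc nc_sym not_d by auto
  have w: "w \<in> dih p q" "len w = k" "w \<in> W" using pq' alt_len[OF nc'] nc_S[OF nc'] by (auto simp: w_def)
  have "\<not> ble u (a * w * b)"
  proof
    assume u: "ble u (a * w * b)"
    have "arrow (a * w * b) (a * alt n p q * b)"
      using w alt_len[OF nc, of n] k by (intro coset_arrow[OF nc rm lm]) (auto simp del: alt.simps)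
    then have "ble (a * w * b) v" using arrow_ble ble_trans bad_facts(1) x_eq by (fastforce simp: interval_def mult.assoc)
    then show False using low_not_in[OF w(1)] w(2) k u by (simp add: interval_def)
  qed
  then have "len (a * (w * b)) \<noteq> len a + len (w * b)"
    using X Xw w unfolding lquot_def w_def[symmetric] by (auto simp: mult.assoc)
  then obtain c where c: "c \<in> S" "dr c a" "dl c (w * b)" using len_mult_additive[of a "w * b"] w by auto
  have cpq: "c \<noteq> p" "c \<noteq> q" using c not_d by auto
  have props: "dl c b \<and> c * w = w * c \<and> (n = 1 \<and> w = 1 \<or> n = 2 \<and> (w = p \<or> w = q))"
  proof (cases "k = 0")
    case True
    then show ?thesis using c k by (simp add: w_def)
  next
    case False
    then have d: "c * q' = q' * c" "dl c b" "k > 1 \<longrightarrow> c * p' = p' * c"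
      using alt_mult_dl[OF nc' _ b' c(1), of k] c(3) a' c(2) unfolding w_def by auto
    have "k = 1"
    proof (rule ccontr)
      assume "k \<noteq> 1"
      then have "c * p = p * c" "c * q = q * c" using d False pq' by auto
      then have "dl c (g * b) \<longleftrightarrow> dl c b" if "g \<in> dih p q" for g
        using dr_dih[OF nc c(1) _ _ cpq, of "ginv b" "ginv g"] that dl_ginv[of "ginv (g * b)" c] dih_W[OF nc that] c(1)
          dih_ginv[OF nc that] dr_ginv[of b c] dr_ginv[of "g * b" c] by auto
      then have "dl c P" using d by (simp add: P_def)
      then show False using not_dl_P c by blast
    qed
    then show ?thesis using d k pq' by (auto simp: w_def)
  qed
  have acW: "a * c \<in> W" using c by auto
  \<comment> \<open>Division by the shorter \<open>a * c\<close>: its quotient \<open>Y\<close> has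
    \<open>lmin c Y\<close> equal to the old quotient, so \<open>Y\<close> lies below
    \<open>lmax c (w * b)\<close>, which is \<open>w * b\<close>.\<close>
  obtain Y where Y: "lquot (a * c) u Y" using lquot_ex[OF uW acW] by blast
  have "\<not> dr c (a * c)" using c by simp
  then have "lquot (a * c * c) u (lmin c Y)" using lquot_gen[OF Y acW c(1)] by blast
  then have Z: "lquot a u (lmin c Y)" using c by (simp add: mult.assoc)
  then have "lmin c Y = X" using lquot_unique[OF X] by simp
  then have "ble Y (lmax c (w * b))" using ble_lmin_iff[of Y "w * b" c] Y Xw c w by (simp add: lquot_def w_def)
  then have "ble Y (w * b)" using c by (simp add: lmax_def)
  then have "removable c w Y" using c Y props by (simp add: removable_def)
  then show ?thesis by blast
qed

end

context minimal_bad
begin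

context
  fixes c w X
  assumes rem: "removable c w X"
begin

lemma rem_facts: "c \<in> S" "dr c a" "dl c b" "lquot (a * c) u X" "ble X (w * b)" "c * w = w * c"
  "n = 1 \<and> w = 1 \<or> n = 2 \<and> (w = p \<or> w = q)"
  using rem by (auto simp: removable_def)

lemma c_neq: "c \<noteq> p" "c \<noteq> q" using rem_facts not_d by auto

lemma w_dih: "w \<in> dih p q" "Suc (len w) = n" "w \<in> W" using rem_facts(7) by auto

lemma ac [simp, intro]: "a * c \<in> W" "\<not> dr c (a * c)" "c \<in> S" "len a = Suc (len (a * c))"
  using rem_facts len_dr[of a c] by auto

lemma dr_a_of_dr_ac: assumes "e \<in> S" "e * c = c * e" "dr e (a * c)" shows "dr e a"
proof -
  have "e \<noteq> c" using assms by auto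
  then show ?thesis using assms dr_commute[of e c a] by simp
qed

lemma comm_b: "e \<in> S \<Longrightarrow> dl e b \<Longrightarrow> e * c = c * e"
  using dl_commutes[of b e c] rem_facts by auto

lemma not_dl_ac_P: assumes "e \<in> S" "dr e (a * c)" "dl e P" shows "e = p"
proof (rule ccontr)
  assume "e \<noteq> p"
  then have "dl e b" using dl_P assms by blast
  then show False using dr_a_of_dr_ac[OF assms(1) comm_b[OF assms(1)]] assms not_dl_P by blast
qed

lemma arrow_wb: "arrow (w * b) P" "arrow (w * b) Q"
proof -
  have o: "odd (len w + n)" using w_dih(2) by presburger
  have l: "len (w * b) < len P" "len (w * b) < len Q" using lmin_len[OF nc lm w_dih(1)] len_PQ w_dih(2) by auto
  have "adj (w * b) P" "adj (w * b) Q"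
    unfolding P_def Q_def using dih_adj[OF nc w_dih(1), of "alt n p q"] dih_adj[OF nc w_dih(1), of "alt n q p"]
      alt_len[OF nc] alt_len[OF nc_sym[OF nc]] o by auto
  then show "arrow (w * b) P" "arrow (w * b) Q" using l w_dih by (auto intro!: arrowI)
qed

lemma dl_qP: assumes "e \<in> S" "dl e (q * P)" "e \<noteq> q"
  shows "e \<noteq> p \<and> e * q = q * e \<and> e * p = p * e \<and> dl e b \<and> dl e P"
proof -
  have eq: "q * P = alt (Suc n) q p * b" by (simp add: P_def mult.assoc)
  have e: "e \<noteq> p" "e * q = q * e" "e * p = p * e" "dl e b"
    using alt_mult_dl[OF nc_sym[OF nc] _ not_d(4,3) assms(1), of "Suc n"] assms(2,3) n unfolding eq by auto
  then show ?thesis using dl_commute[OF assms(1) _ assms(3) e(2), of P] assms by auto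
qed

text \<open>Deleting \<open>c\<close> from \<open>a\<close> moves \<open>x\<close> and
  \<open>M x\<close> down one rank together, by \<open>matching_forced\<close>. A lower square there
  could be reduced by cancelling \<open>a * c\<close> on the left and \<open>P\<close> on the right,
  leaving an element below \<open>1\<close>.\<close>

lemma free_push:
  assumes rm0: "rmin_coset p q (a * c)"
  shows "a * c * P \<in> interval u v" "len x = Suc (len (a * c * P))" "M (a * c * P) = a * c * (q * P)"
    "len (a * c * (q * P)) = len x"
proof -
  have nd: "\<not> dr p (a * c)" "\<not> dr q (a * c)" using rm0 by (auto simp: rmin_coset_def)
  have "\<not> dl e P" if "e \<in> S" "dr e (a * c)" for e using not_dl_ac_P[OF that] nd that by auto
  then have l1: "len (a * c * P) = len (a * c) + len P" using len_mult_additive by blast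
  have "\<not> dl e (q * P)" if "e \<in> S" "dr e (a * c)" for e 
    using dl_qP[OF that(1)] not_dl_ac_P[OF that] nd that by metis
  moreover have lqP: "len (q * P) = Suc (len P)" using len_not_dl dl_PQ by blast
  ultimately have l2: "len (a * c * (q * P)) = len (a * c) + Suc (len P)" using len_mult_additive[of "a * c" "q * P"] by auto
  have lx: "len x = len a + len P" "len (M x) = len a + Suc (len P)" using eqs lens by auto
  show "len x = Suc (len (a * c * P))" "len (a * c * (q * P)) = len x" using l1 l2 lx ac(4) by linarith+
  have x': "x = a * c * (c * P)" "M x = a * c * (c * (q * P))" using eqs rem_facts(1) by (simp_all add: mult.assoc)
  have W: "a * c * P \<in> W" "a * c * (q * P) \<in> W" by auto
  have cx: "cov (a * c * P) x" unfolding x'(1)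
    using ac l1 lx rem_facts(1) x'(1) W by (intro covI) (auto simp del: mult.assoc)
  have cH: "cov (a * c * P) (a * c * (q * P))"
    using l1 l2 W by (intro covI) auto
  have "adj (a * c * (q * P)) (a * c * (c * (q * P)))" using rem_facts(1) by (subst adj_mult_left) auto
  then have cM: "cov (a * c * (q * P)) (M x)" unfolding x'(2)
    using lx l2 W ac x'(2) by (intro covI) auto
  have neq: "a * c * (q * P) \<noteq> x" unfolding x'(1) using c_neq by auto
  have "ble X P" using rem_facts(5) arrow_wb arrow_ble ble_trans by blast
  then have "ble u (a * c * P)" using rem_facts(4) l1 by (auto simp: lquot_def)
  then show fI: "a * c * P \<in> interval u v" using cov_ble[OF cx] bad_facts(1) ble_trans by (auto simp: interval_def)
  show "M (a * c * P) = a * c * (q * P)"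
  proof (rule matching_forced[OF hm ad fI bad_facts(1) cx bad_facts(4) cH cM neq])
    show "\<not> lower_square (M (a * c * P)) (a * c * P) x (a * c * (q * P)) (M x)"
    proof
      assume "lower_square (M (a * c * P)) (a * c * P) x (a * c * (q * P)) (M x)"
      then have sq: "lower_square (M (a * c * P)) (a * c * P) (a * c * (c * P)) (a * c * (q * P)) (a * c * (c * (q * P)))"
        using x' by simp
      have lc: "len (c * P) = Suc (len P)" using len_not_dl[OF _ rem_facts(1) not_dl_P[OF rem_facts(1,2)]] by simp
      have "len (c * (q * P)) \<le> Suc (Suc (len P))" using len_mult_le[of c "q * P"] lqP rem_facts(1) by simp
      moreover have "len (a * c * (c * (q * P))) \<le> len (a * c) + len (c * (q * P))"
        using len_mult_le[of "a * c" "c * (q * P)"] ac(1) rem_facts(1) by simp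
      ultimately have lcq: "len (c * (q * P)) = Suc (Suc (len P))" "len (a * c * (c * (q * P))) = len (a * c) + len (c * (q * P))"
        using lx x' ac(4) by simp_all
      have lcx: "len (a * c * (c * P)) = len (a * c) + len (c * P)" using lx x' ac(4) lc by simp
      obtain z where "lower_square z P (c * P) (q * P) (c * (q * P))"
        using lower_square_left[OF ac(1) sq] l1 l2 lcx lcq lqP by auto
      then have "lower_square z (1 * P) (c * P) (q * P) ((c * q) * P)" by (simp add: mult.assoc)
      moreover have "len (c * q) = 2"
        using lcq(1) len_mult_le[of "c * q" P] len_mult_le[of c q] rem_facts(1) by (simp add: mult.assoc)
      ultimately obtain z' where "lower_square z' 1 c q (c * q)"
        using lower_square_right[of P z 1 c q "c * q"] lc lqP lcq by (auto simp: mult.assoc)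
      then show False using cov_len[of z' 1] by (simp add: lower_square_def)
    qed
  qed
qed

end

lemma swap_PQ: "minimal_bad.P q p n b = Q" "minimal_bad.Q q p n b = P"
proof -
  interpret sw: minimal_bad S m u v M q p n a b "M y" "M x" by (rule swap)
  show "sw.P = Q" "sw.Q = P" by (simp_all add: sw.P_def sw.Q_def P_def Q_def)
qed

lemma swap_removable: "removable c w X \<Longrightarrow> minimal_bad.removable S u q p n a b c w X"
proof -
  interpret sw: minimal_bad S m u v M q p n a b "M y" "M x" by (rule swap)
  show "removable c w X \<Longrightarrow> sw.removable c w X" unfolding removable_def sw.removable_def by blast
qed

text \<open>Pushing down both halves of the configuration produces a bad cover one rank
  lower.\<close>

lemma not_free:
  assumes rem: "removable c w X" 
  shows "\<not> rmin_coset p q (a * c)"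
proof
  assume rm0: "rmin_coset p q (a * c)"
  interpret sw: minimal_bad S m u v M q p n a b "M y" "M x" by (rule swap)
  note F = free_push[OF rem rm0]
  have "rmin_coset q p (a * c)" using rm0 by (auto simp: rmin_coset_def)
  note G = sw.free_push[OF swap_removable[OF rem] this, unfolded swap_PQ]
  have acW: "a * c \<in> W" using ac[OF rem] by blast
  have l: "len (M y) = len x" using lens len_PQ eqs by simp
  have eq: "a * c * (p * Q) = a * c * (alt (Suc n) p q * b)" "a * c * (q * P) = a * c * (alt (Suc n) q p * b)"
    by (simp_all add: P_def Q_def mult.assoc)
  have "alt (Suc n) p q \<noteq> alt (Suc n) q p" using alt_neq[OF nc] by blast
  then have neq: "a * c * (q * P) \<noteq> a * c * (p * Q)" unfolding eq by (simp del: alt.simps)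
  have "M (a * c * (p * Q)) = a * c * Q" using G(1,3) hasse_matchingD(2)[OF hm] by metis
  moreover have "a * c * (p * Q) \<in> interval u v" using G(1,3) hasse_matchingD(1)[OF hm] by metis
  moreover have "cov (a * c * P) (a * c * (q * P))" "cov (a * c * Q) (a * c * (p * Q))"
    using F(2,4) G(2,4) l acW by (intro covI; simp)+
  moreover have "cov (a * c * P) (a * c * (p * Q))"
  proof (rule covI)
    have "adj (alt n p q) (alt (Suc n) p q)" using alt_len[OF nc, of n] alt_len[OF nc, of "Suc n"]
      by (intro dih_adj[OF nc]) (auto simp del: alt.simps)
    then show "adj (a * c * P) (a * c * (p * Q))" unfolding eq using acW by (simp add: P_def del: alt.simps)
    show "len (a * c * (p * Q)) = Suc (len (a * c * P))" using F(2) G(4) l by simp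
  qed (use acW in simp)
  ultimately have "bad (interval u v) M (a * c * P) (a * c * (p * Q))" using F(1,3) neq by (simp add: bad_def)
  then show False using minimal F(2) by fastforce
qed

end

section \<open>The case where deleting \<open>c\<close> uncovers \<open>p\<close>\<close>

context right_angled_coxeter
begin

text \<open>Alternating words seen from the right: for positive \<open>k\<close> the last letter is
  \<open>p\<close>.\<close>

definition ralt :: "nat \<Rightarrow> 'g \<Rightarrow> 'g \<Rightarrow> 'g" where
  "ralt k p q = ginv (alt k p q)"

lemma ralt_0 [simp]: "ralt 0 p q = 1" by (simp add: ralt_def)

lemma ralt_Suc: "p \<in> S \<Longrightarrow> ralt (Suc k) p q = ralt k q p * p"
  by (simp add: ralt_def)

lemma ralt_dih: "nc p q \<Longrightarrow> ralt k p q \<in> dih p q" "nc p q \<Longrightarrow> ralt k p q \<in> dih q p"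
  unfolding ralt_def using dih_ginv[of p q] dih_ginv[of q p] nc_sym[of p q] by blast+

lemma ralt_len: "nc p q \<Longrightarrow> len (ralt k p q) = k"
  unfolding ralt_def using alt_len nc_S[of p q] by simp

lemma ralt_neq: "nc p q \<Longrightarrow> k > 0 \<Longrightarrow> ralt k p q \<noteq> ralt k q p"
  unfolding ralt_def using alt_neq by simp

lemma ralt_cases: "nc p q \<Longrightarrow> x \<in> dih p q \<Longrightarrow> x = ralt (len x) p q \<or> x = ralt (len x) q p"
  unfolding ralt_def using dih_cases[of p q "ginv x"] dih_W[of p q x] dih_ginv[of p q x] by (metis ginv_ginv len_ginv)

lemma dr_ralt:
  assumes "nc p q" "rmin_coset p q a"
  shows "dr p (a * ralt (Suc k) p q)" 
proof -
  have "a * ralt (Suc k) p q * p = a * ralt k q p" using nc_S[OF assms(1)] by (simp add: ralt_Suc mult.assoc)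
  moreover have "len (a * ralt k q p) = len a + k" "len (a * ralt (Suc k) p q) = len a + Suc k"
    using rmin_len[OF assms] ralt_dih ralt_len assms(1) nc_sym[OF assms(1)] by auto
  ultimately show ?thesis by (simp add: dr_def)
qed

lemma additive_assoc:
  assumes "x \<in> W" "y \<in> W" "z \<in> W" "len (x * (y * z)) = len x + len y + len z"
  shows "len (y * z) = len y + len z" "len (x * y) = len x + len y" "len (x * (y * z)) = len x + len (y * z)"
proof -
  have "len (x * (y * z)) \<le> len x + len (y * z)" "len (y * z) \<le> len y + len z"
    "len ((x * y) * z) \<le> len (x * y) + len z" "len (x * y) \<le> len x + len y"
    by (rule len_mult_le; use assms in simp)+
  then show "len (y * z) = len y + len z" "len (x * y) = len x + len y" "len (x * (y * z)) = len x + len (y * z)"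
    using assms(4) by (simp_all add: mult.assoc)
qed

end

context minimal_bad
begin

text \<open>If \<open>p\<close> and \<open>c\<close> commuted, \<open>p\<close> would be a right
  descent of \<open>a\<close>. As \<open>a\<close> ends in \<open>c\<close> but not in
  \<open>p\<close>, while \<open>a * c\<close> ends in \<open>p\<close>, the alternating tail of
  \<open>a\<close> has at least two letters.\<close>

lemma descent_shape:
  assumes rem: "removable c w X" and dp: "dr p (a * c)"
  shows "\<exists>a' k. nc p c \<and> rmin_coset p c a' \<and> a = a' * ralt (Suc (Suc k)) c p"
proof -
  note R = rem_facts[OF rem]
  have pc: "nc p c"
  proof (rule ccontr)
    assume "\<not> nc p c"
    then have "p * c = c * p" using R by (auto simp: nc_def)
    then have "dr p a" using dp dr_commute[of p c a] R c_neq[OF rem] by auto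
    then show False using not_d by blast
  qed
  note cp = nc_sym[OF pc]
  obtain a' g where a': "rmin_coset p c a'" "g \<in> dih p c" "a = a' * g" using rmin_decomposition[OF _ pc, of a] by auto
  have a'c: "rmin_coset c p a'" using a' by (auto simp: rmin_coset_def)
  have "g = ralt (len g) p c \<or> g = ralt (len g) c p" using ralt_cases[OF pc a'(2)] .
  moreover have "len g \<noteq> 0"
  proof
    assume "len g = 0"
    then have "a = a'" using a' dih_W[OF pc a'(2)] by simp
    then show False using a' R by (simp add: rmin_coset_def)
  qed
  then obtain j where j: "len g = Suc j" using not0_implies_Suc by blast
  moreover have "g \<noteq> ralt (Suc j) p c" using dr_ralt[OF pc a'(1), of j] not_d a' by auto
  ultimately have g: "g = ralt (Suc j) c p" by auto
  have "a * c = a' * ralt j p c" using a' g R by (simp add: ralt_Suc mult.assoc)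
  then have "j \<noteq> 0" using dp a'(1) unfolding rmin_coset_def by (metis mult_1_right ralt_0)
  then obtain k where "j = Suc k" using not0_implies_Suc by blast
  then show ?thesis using pc a' g by blast
qed

context
  fixes c w X a4 k
  assumes rem: "removable c w X" and pc: "nc p c" and rm4: "rmin_coset p c a4"
    and a_eq: "a = a4 * ralt (Suc (Suc k)) c p"
begin

abbreviation "A j \<equiv> ralt j c p"
abbreviation "B j \<equiv> ralt j p c"

lemmas R = rem_facts[OF rem]

lemma cp: "nc c p" using nc_sym[OF pc] .
lemma rm4': "rmin_coset c p a4" using rm4 by (simp add: rmin_coset_def)
lemma a4W [simp, intro]: "a4 \<in> W" using rm4 by (simp add: rmin_coset_def)
lemma cS [simp, intro]: "c \<in> S" using R by blast
lemma wW [simp, intro]: "w \<in> W" using w_dih[OF rem] by blast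
lemma AB_W [simp, intro]: "A j \<in> W" "B j \<in> W" using ralt_dih[OF pc] ralt_dih[OF cp] dih_W[OF pc] by blast+
lemma AB_dih [simp, intro]: "A j \<in> dih p c" "B j \<in> dih p c" using ralt_dih[OF pc] ralt_dih[OF cp] by blast+
lemma AB_len [simp]: "len (A j) = j" "len (B j) = j" using ralt_len[OF pc] ralt_len[OF cp] by blast+
lemma AB_Suc: "A (Suc j) = B j * c" "B (Suc j) = A j * p" by (simp_all add: ralt_Suc)
lemma a4_len: "len (a4 * A j) = len a4 + j" "len (a4 * B j) = len a4 + j"
  using rmin_len[OF pc rm4, of "A j"] rmin_len[OF pc rm4, of "B j"] by auto
lemma dr_AB: "dr c (a4 * A (Suc j))" "dr p (a4 * B (Suc j))" using dr_ralt[OF cp rm4'] dr_ralt[OF pc rm4] by blast+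

lemma w_cases: "n = 1 \<and> w = 1 \<or> n = 2 \<and> w = q"
  using R(6,7) pc by (auto simp: nc_def)

lemma P_eq: "P = p * (w * b)"
proof -
  consider "n = 1" "w = 1" | "n = 2" "w = q" using w_cases by blast
  then have "alt n p q = p * w" by cases (simp_all add: numeral_2_eq_2)
  then show ?thesis by (simp add: P_def mult.assoc)
qed

lemma len_a: "len a = len a4 + Suc (Suc k)" using a4_len a_eq by simp
lemma ac_eq: "a * c = a4 * B (Suc k)" by (simp add: a_eq AB_Suc(1)[of "Suc k"] mult.assoc)
lemma len_ac: "len (a * c) = len a4 + Suc k" using a4_len ac_eq by simp
lemma len_wb: "len P = Suc (len (w * b))" "len Q = Suc (len (w * b))"
  using len_PQ lmin_len[OF nc lm w_dih(1)[OF rem]] w_dih(2)[OF rem] by auto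

lemma dl_c_wb: "dl c (w * b)"
  using w_cases dl_commute[of c q b] R c_neq[OF rem] by auto

lemma not_dl_p_wb: "\<not> dl p (w * b)"
  using nc_dl[OF cp _ dl_c_wb] by auto

lemma dr_a: "e \<in> S \<Longrightarrow> e * p = p * e \<Longrightarrow> e * c = c * e \<Longrightarrow> g \<in> dih p c \<Longrightarrow> dr e (a4 * g) \<Longrightarrow> dr e a"
proof -
  assume e: "e \<in> S" "e * p = p * e" "e * c = c * e" "g \<in> dih p c" "dr e (a4 * g)"
  then have "e \<noteq> p" "e \<noteq> c" using pc by (auto simp: nc_def)
  then show ?thesis using dr_dih[OF pc e(1-3), of a4] e a_eq by auto
qed

lemma not_dl_wb: assumes "e \<in> S" "dr e (a4 * B (Suc j))" shows "\<not> dl e (w * b)"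
proof
  assume d: "dl e (w * b)"
  then have "e \<noteq> p" using not_dl_p_wb by blast
  have ep: "e * p = p * e" using dr_commutes[OF _ assms(1) _ assms(2) dr_AB(2)] by auto
  have ec: "e * c = c * e" using dl_commutes[OF _ assms(1) _ d dl_c_wb] by auto
  have "dl e P" unfolding P_eq using dl_commute[OF assms(1) _ \<open>e \<noteq> p\<close> ep, of "w * b"] d by auto
  then show False using not_dl_P dr_a[OF assms(1) ep ec AB_dih(2) assms(2)] assms(1) by blast
qed

lemma not_dl_Q': assumes "e \<in> S" "dr e (a4 * B (Suc j))" shows "\<not> dl e Q"
proof
  assume d: "dl e Q"
  have ep: "e * p = p * e" using dr_commutes[OF _ assms(1) _ assms(2) dr_AB(2)] by auto
  have "e \<noteq> q" using ep nc by (auto simp: nc_def)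
  then have "e * c = c * e" using dl_Q[OF assms(1) d] comm_b[OF rem assms(1)] by blast
  then show False using not_dl_Q dr_a[OF assms(1) ep _ AB_dih(2) assms(2)] assms(1) d by blast
qed

lemma add_wb: "len (a4 * B (Suc j) * (w * b)) = len a4 + Suc j + len (w * b)"
  using len_mult_additive[of "a4 * B (Suc j)" "w * b"] not_dl_wb a4_len by simp

lemma add_Q: "len (a4 * B (Suc j) * Q) = len a4 + Suc j + len Q"
  using len_mult_additive[of "a4 * B (Suc j)" Q] not_dl_Q' a4_len by simp

text \<open>\<open>a2\<close>, \<open>h1\<close>, \<open>M y\<close> and \<open>y\<close> lie in the coset \<open>a4 \<langle>p, c\<rangle> Q\<close>, while \<open>f\<close> is covered by both \<open>x\<close> and \<open>h1\<close>.\<close>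

definition "f = a4 * B (Suc (Suc k)) * (w * b)"
definition "h1 = a4 * B (Suc (Suc k)) * Q"
definition "a2 = a4 * B (Suc k) * Q"

lemma fhW [simp, intro]: "f \<in> W" "h1 \<in> W" "a2 \<in> W" by (auto simp: f_def h1_def a2_def)

lemma f_eq: "f = a4 * A (Suc k) * P" by (simp add: f_def P_eq AB_Suc(2)[of "Suc k"] mult.assoc)
lemma x_eq': "x = a4 * A (Suc (Suc k)) * P" using eqs a_eq by simp
lemma My_eq': "M y = a4 * A (Suc (Suc k)) * Q" using eqs a_eq by simp
lemma y_eq': "y = a4 * B (Suc (Suc (Suc k))) * Q" using eqs a_eq by (simp add: AB_Suc(2)[of "Suc (Suc k)"] mult.assoc)

lemma len_fh: "len x = Suc (len f)" "len h1 = Suc (len f)" "len y = Suc (len h1)" "len (M y) = Suc (len a2)"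
  using add_wb[of "Suc k"] add_Q[of "Suc k"] add_Q[of k] lens len_wb len_a eqs unfolding f_def h1_def a2_def by auto

lemma adj_AB: "odd (len g + len h) \<Longrightarrow> g \<in> dih p c \<Longrightarrow> h \<in> dih p c \<Longrightarrow> adj (a4 * g * z) (a4 * h * z)"
  using dih_adj[OF pc, of g h] by simp

lemma covs: "cov f x" "cov f h1" "cov h1 y" "cov a2 (M y)"
proof -
  show "cov f x" using len_fh adj_AB[of "A (Suc k)" "A (Suc (Suc k))" P] unfolding f_eq x_eq' by (intro covI) auto
  have "adj (w * b) Q" using arrow_wb[OF rem] arrow_adj by blast
  then show "cov f h1" using len_fh by (intro covI) (auto simp: f_def h1_def)
  show "cov h1 y" using len_fh adj_AB[of "B (Suc (Suc k))" "B (Suc (Suc (Suc k)))" Q] unfolding h1_def y_eq' by (intro covI) auto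
  have "adj a2 (M y)" unfolding a2_def My_eq' using adj_AB[of "B (Suc k)" "A (Suc (Suc k))" Q] by auto
  then show "cov a2 (M y)" using len_fh(4) by (intro covI) auto
qed

lemma members: "f \<in> interval u v" "h1 \<in> interval u v" "a2 \<in> interval u v"
proof -
  have X: "ble X (w * b)" "ble X Q" using R(5) arrow_wb[OF rem] arrow_ble ble_trans by blast+
  have "ble u (a * c * (w * b))" using R(4) X(1) add_wb[of k] len_ac unfolding lquot_def ac_eq by auto
  moreover have "arrow (a * c * (w * b)) f"
    unfolding f_def ac_eq using adj_AB[of "B (Suc k)" "B (Suc (Suc k))" "w * b"] add_wb[of k] add_wb[of "Suc k"]
    by (intro arrowI) auto
  ultimately have "ble u f" using arrow_ble ble_trans by blast
  then show f: "f \<in> interval u v" using cov_ble[OF covs(1)] bad_facts(1) ble_trans by (auto simp: interval_def)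
  then show "h1 \<in> interval u v" using interval_between bad_facts(2) cov_ble covs by blast
  have "ble u a2" using R(4) X(2) add_Q[of k] len_ac unfolding lquot_def a2_def ac_eq[symmetric] by auto
  then show "a2 \<in> interval u v" using cov_ble[OF covs(4)] partner(3) ble_trans by (auto simp: interval_def)
qed

lemma lmQ: "lmin_coset p c Q"
  using dl_PQ not_dl_Q R by (auto simp: lmin_coset_def)

text \<open>The neighbours \<open>h1\<close> and \<open>M y\<close> keep \<open>M h1\<close> in the
  translate of \<open>dih p c\<close>. If it lay above \<open>h1\<close>, the cover from
  \<open>h1\<close> to \<open>y\<close> would be bad and, \<open>h1\<close> being as long as
  \<open>x\<close>, also minimal; \<open>lower_rank_empty\<close> for \<open>p\<close>,
  \<open>c\<close> would then exclude \<open>a2\<close> from the interval.\<close>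

lemma Mh1: "cov (M h1) h1" "M h1 = a4 * A (Suc k) * Q \<or> M h1 = a2"
proof -
  have D: "M h1 \<in> interval u v" "cov h1 (M h1) \<or> cov (M h1) h1" using hasse_matchingD[OF hm members(2)] by auto
  have "adj (M h1) (M y)" using ad members(2) bad_facts(2) cov_adj[OF covs(3)] by (auto simp: preserves_adj_def)
  then have "adj (M h1) (a4 * A (Suc (Suc k)) * Q)" unfolding My_eq' .
  moreover have "adj (M h1) (a4 * B (Suc (Suc k)) * Q)"
    unfolding h1_def[symmetric] using D(2) cov_adj adj_sym[OF cov_adj] by blast
  moreover have ABneq: "A (Suc (Suc k)) \<noteq> B (Suc (Suc k))" by (rule ralt_neq[OF cp]) simp
  ultimately obtain g where g: "g \<in> dih p c" "M h1 = a4 * g * Q"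
    using coset_closed[OF pc a4W PQ_W(2) interval_W[OF D(1)] AB_dih(1) AB_dih(2)] by blast
  have "h1 \<noteq> M y" unfolding h1_def My_eq' using ABneq by auto
  then have Mh1y: "M h1 \<noteq> y" using hasse_matchingD(2)[OF hm members(2)] by metis
  show down: "cov (M h1) h1"
  proof (rule ccontr)
    assume "\<not> cov (M h1) h1"
    then have "cov h1 (M h1)" using D by blast
    then have bad': "bad (interval u v) M h1 y" using members bad_facts covs Mh1y by (simp add: bad_def)
    have "a4 * B (Suc k) * Q \<notin> interval u v"
    proof (rule lower_rank_empty[OF hm ad bad' _ pc rm4 lmQ _ _ _ _ _ h1_def My_eq' y_eq' g(2)])
      show "len h1 \<le> len x'" if "bad (interval u v) M x' y'" for x' y' using minimal[OF that] len_fh by simp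
    qed (use g in auto)
    then show False using members(3) by (simp add: a2_def)
  qed
  have "len (B (Suc (Suc k))) = Suc (len g)"
    using coset_cov_rank[OF pc rm4 lmQ g(1) AB_dih(2), of "Suc (Suc k)"] down g h1_def by simp
  then have "len g = Suc k" by simp
  then show "M h1 = a4 * A (Suc k) * Q \<or> M h1 = a2"
    using ralt_cases[OF pc g(1)] unfolding a2_def g(2) by auto
qed

text \<open>Otherwise the cover from \<open>f\<close> to \<open>h1\<close> is bad and shorter,
  unless \<open>M f = h1\<close>, which would put a word starting with \<open>q\<close> into
  \<open>dih p c\<close>.\<close>

lemma Mf: "cov (M f) f"
proof (rule ccontr)
  assume "\<not> cov (M f) f"
  then have up: "cov f (M f)" using hasse_matchingD(3)[OF hm members(1)] by blast
  have "M f \<noteq> h1"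
  proof
    assume "M f = h1"
    then have "M h1 = f" using hasse_matchingD(2)[OF hm members(1)] by simp
    then obtain g where g: "g \<in> dih p c" "a4 * g * Q = f" using Mh1(2) unfolding a2_def by auto
    then have "g * alt n q p * b = B (Suc (Suc k)) * w * b" unfolding f_def Q_def by (simp add: mult.assoc)
    then have "g * alt n q p = B (Suc (Suc k)) * w" by simp
    then have "ginv g * (g * alt n q p * ginv w) = ginv g * (B (Suc (Suc k)) * w * ginv w)" by simp
    then have "alt n q p * ginv w = ginv g * B (Suc (Suc k))" by (simp add: mult.assoc)
    moreover have "ginv g * B (Suc (Suc k)) \<in> dih p c" using g dih_ginv[OF pc] by blast
    \<comment> \<open>For \<open>n = 1\<close> the product is \<open>q\<close>, for
      \<open>n = 2\<close> it is \<open>q p q\<close>; \<open>2 * n - 2\<close> covers both.\<close>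
    moreover have "\<exists>j. alt n q p * ginv w = alt (Suc j) q p"
      using w_cases by (elim disjE conjE; intro exI[of _ "2 * n - 2"]) (simp_all add: mult.assoc numeral_2_eq_2)
    ultimately obtain j where "alt (Suc j) q p \<in> dih p c" by metis
    then show False using dih_dl[OF pc _ mem(2)] alt_dl(1)[OF nc_sym[OF nc], of "Suc j"] c_neq[OF rem] mem(5) by blast
  qed
  then have "bad (interval u v) M f h1" using members covs up Mh1(1) by (simp add: bad_def)
  then show False using minimal len_fh by fastforce
qed

lemma adj_Mf: "adj (M f) (M x)" "adj (M f) (M h1)"
  using ad members bad_facts(1) cov_adj covs unfolding preserves_adj_def by blast+

lemma Mx_eq': "M x = a4 * A (Suc (Suc k)) * (q * P)" using eqs a_eq by simp

text \<open>If \<open>q\<close> could be appended to \<open>a4 * A (Suc k)\<close> without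
  cancellation, then \<open>a4 * A (Suc k) * (q * P)\<close> would complete a lower square on
  \<open>M f\<close>, \<open>f\<close>, \<open>x\<close> and \<open>M x\<close>. Cancelling
  \<open>a4\<close> and \<open>P\<close> leaves one that \<open>no_lower_square_dih\<close>
  forbids.\<close>

lemma special_descent: "dr q (a4 * A (Suc k))"
proof (rule ccontr)
  assume nd: "\<not> dr q (a4 * A (Suc k))"
  have "\<not> dl e (q * P)" if e: "e \<in> S" "dr e (a4 * A (Suc k))" for e
  proof
    assume d: "dl e (q * P)"
    have "e \<noteq> q" using nd e by blast
    note E = dl_qP[OF rem e(1) d this]
    then have "e * c = c * e" using comm_b[OF rem e(1)] by blast
    then show False using dr_a[OF e(1) _ _ AB_dih(1) e(2)] E not_dl_P e by blast
  qed
  moreover have lqP: "len (q * P) = Suc (len P)" using len_not_dl dl_PQ by blast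
  ultimately have lh: "len (a4 * A (Suc k) * (q * P)) = len a4 + Suc k + Suc (len P)"
    using len_mult_additive[of "a4 * A (Suc k)" "q * P"] a4_len by auto
  have lx: "len x = len a4 + Suc (Suc k) + len P" "len f = len a4 + Suc k + len P"
    "len (M x) = len a4 + Suc (Suc k) + Suc (len P)"
    using len_fh eqs lens len_a by auto
  have h2W: "a4 * A (Suc k) * (q * P) \<in> W" by auto
  have "cov f (a4 * A (Suc k) * (q * P))" using lh lx h2W unfolding f_eq by (intro covI) auto
  moreover have "cov (a4 * A (Suc k) * (q * P)) (M x)"
    using lh lx h2W adj_AB[of "A (Suc k)" "A (Suc (Suc k))" "q * P"] unfolding Mx_eq' by (intro covI) auto
  moreover have "x \<noteq> a4 * A (Suc k) * (q * P)"
  proof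
    assume "x = a4 * A (Suc k) * (q * P)"
    then have "A (Suc (Suc k)) * P = A (Suc k) * q * P" unfolding x_eq' by (simp add: mult.assoc)
    then have "ginv (A (Suc k)) * A (Suc (Suc k)) = ginv (A (Suc k)) * (A (Suc k) * q)" by simp
    then have "q = ginv (A (Suc k)) * A (Suc (Suc k))" by simp
    moreover have "ginv (A (Suc k)) * A (Suc (Suc k)) \<in> dih p c" using dih_ginv[OF pc] by blast
    ultimately show False using not_in_dih[OF pc mem(2)] c_neq[OF rem] mem(5) by metis
  qed
  ultimately have "lower_square (M f) f x (a4 * A (Suc k) * (q * P)) (M x)"
    using Mf covs(1) bad_facts(4) adj_Mf(1) by (simp add: lower_square_def)
  then have sq: "lower_square (M f) (a4 * (A (Suc k) * P)) (a4 * (A (Suc (Suc k)) * P)) (a4 * (A (Suc k) * (q * P))) (a4 * (A (Suc (Suc k)) * (q * P)))"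
    unfolding f_eq x_eq' Mx_eq'[unfolded x_eq'] by (simp add: mult.assoc)
  have l: "len (a4 * (A (Suc k) * P)) = len a4 + len (A (Suc k)) + len P"
    "len (a4 * (A (Suc (Suc k)) * P)) = len a4 + len (A (Suc (Suc k))) + len P"
    "len (a4 * (A (Suc k) * (q * P))) = len a4 + len (A (Suc k)) + len (q * P)"
    "len (a4 * (A (Suc (Suc k)) * (q * P))) = len a4 + len (A (Suc (Suc k))) + len (q * P)"
    using lx lh lqP unfolding f_eq x_eq' Mx_eq'[unfolded x_eq'] by (simp_all add: mult.assoc)
  note ad1 = additive_assoc[OF a4W AB_W(1) PQ_W(1) l(1)] additive_assoc[OF a4W AB_W(1) PQ_W(1) l(2)]
    additive_assoc[OF a4W AB_W(1) _ l(3)] additive_assoc[OF a4W AB_W(1) _ l(4)]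
  have qPW: "q * P \<in> W" by auto
  obtain z where z: "lower_square z (A (Suc k) * P) (A (Suc (Suc k)) * P) (A (Suc k) * (q * P)) (A (Suc (Suc k)) * (q * P))"
    using lower_square_left[OF a4W sq] ad1 qPW by auto
  have l': "len (A j * q) = len (A j) + len q" "len ((A j * q) * P) = len (A j * q) + len P"
    if "len (A j * (q * P)) = len (A j) + len (q * P)" for j
    using additive_assoc[OF AB_W(1) _ PQ_W(1), of q j] that lqP by (auto simp: mult.assoc)
  have "lower_square z (A (Suc k) * P) (A (Suc (Suc k)) * P) ((A (Suc k) * q) * P) ((A (Suc (Suc k)) * q) * P)"
    using z by (simp add: mult.assoc)
  then obtain z' where "lower_square z' (A (Suc k)) (A (Suc (Suc k))) (A (Suc k) * q) (A (Suc (Suc k)) * q)"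
    using lower_square_right[OF PQ_W(1) _ AB_W(1) AB_W(1) W_mult[OF AB_W(1) W_gen[OF mem(2)]] W_mult[OF AB_W(1) W_gen[OF mem(2)]]
        ad1(1) ad1(4) l'(2)[OF ad1(7)] l'(2)[OF ad1(10)]] by blast
  then show False using no_lower_square_dih[OF pc mem(2)] c_neq[OF rem] mem(5) AB_dih by metis
qed

text \<open>\<open>q\<close> and \<open>c\<close> are right descents of one element, hence commute,
  and \<open>q\<close> passes to \<open>a4 * B k\<close>. For \<open>k > 0\<close> it would meet
  there the noncommuting descent \<open>p\<close>; for \<open>n = 1\<close> the letter
  \<open>c\<close> would be a left descent of \<open>Q\<close> and cancel against
  \<open>a\<close>.\<close>

lemma special_values: "k = 0" "dr q a4" "q * c = c * q" "n = 2" "w = q"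
proof -
  show qc: "q * c = c * q" using dr_commutes[OF _ mem(2) cS special_descent dr_AB(1)] by auto
  have "dr q (a4 * B k * c)" using special_descent by (simp add: AB_Suc mult.assoc)
  then have d: "dr q (a4 * B k)" using dr_commute[OF mem(2) cS _ qc] c_neq[OF rem] by auto
  show "k = 0"
  proof (rule ccontr)
    assume "k \<noteq> 0"
    then obtain j where "k = Suc j" using not0_implies_Suc by blast
    then have "q * p = p * q" using dr_commutes[OF _ mem(2,1) d] dr_AB(2) by auto
    then show False using nc by (auto simp: nc_def)
  qed
  then show "dr q a4" using d by simp
  have "n \<noteq> 1"
  proof
    assume "n = 1"
    then have "alt n q p = q" by simp
    then have "Q = q * b" by (simp add: Q_def)
    then have "dl c Q" using dl_commute[of c q b] qc R c_neq[OF rem] by auto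
    then show False using not_dl_Q R by blast
  qed
  then show "n = 2" "w = q" using w_cases by auto
qed

text \<open>A length comparison leaves \<open>M h1 = a2\<close>, and the neighbours
  \<open>f\<close>, \<open>M x\<close> place \<open>M f\<close> in the translate of
  \<open>dih p q\<close> between \<open>a4\<close> and \<open>c * P\<close>. The edge from
  \<open>M f\<close> to \<open>M h1\<close> then determines \<open>M f\<close> completely, and it
  comes out above \<open>f\<close>.\<close>

lemma descent_contradiction: False
proof -
  note V = special_values
  have PQ: "P = p * (q * b)" "Q = q * (p * b)"
    unfolding P_def Q_def using V(4) by (simp_all add: numeral_2_eq_2 mult.assoc)
  have AB: "A (Suc k) = c" "A (Suc (Suc k)) = p * c" "B (Suc k) = p" "B (Suc (Suc k)) = c * p"
    using V(1) by (simp_all add: AB_Suc)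
  have lb: "len Q = 2 + len b" using len_PQ V by simp
  have "M h1 \<noteq> a4 * A (Suc k) * Q"
  proof
    assume "M h1 = a4 * A (Suc k) * Q"
    also have "\<dots> = a4 * ((c * q) * (p * b))" by (simp add: AB PQ mult.assoc)
    also have "\<dots> = (a4 * q) * (c * (p * b))" using V(3) by (metis mult.assoc)
    also have "len \<dots> \<le> len (a4 * q) + len (c * (p * b))" by (intro len_mult_le) auto
    also have "len (c * (p * b)) \<le> Suc (Suc (len b))"
      using len_mult_le[of c "p * b"] len_mult_le[of p b] by simp
    finally have "len (M h1) \<le> len (a4 * q) + Suc (Suc (len b))" by simp
    then show False using cov_len[OF Mh1(1)] add_Q[of "Suc k"] lb len_dr[OF a4W mem(2) V(2)] unfolding h1_def by simp
  qed
  then have Mh: "M h1 = a4 * (p * Q)" using Mh1(2) by (simp add: a2_def AB mult.assoc)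
  have f': "f = a4 * 1 * (c * P)" by (simp add: f_eq AB mult.assoc)
  have "M x = a4 * (p * ((c * q) * P))" by (simp add: Mx_eq' AB mult.assoc)
  then have Mx': "M x = a4 * (p * q) * (c * P)" using V(3) by (metis mult.assoc)
  have MfI: "M f \<in> W" using hasse_matchingD(1)[OF hm members(1)] interval_W by blast
  have "adj (M f) (a4 * 1 * (c * P))" using cov_adj[OF Mf] f' by simp
  moreover have "adj (M f) (a4 * (p * q) * (c * P))" using adj_Mf(1) Mx' by simp
  moreover have "p * q \<noteq> 1"
  proof
    assume "p * q = 1"
    then have "p * (p * q) = p" by simp
    then show False using mem(5) by simp
  qed
  moreover have "p * q \<in> dih p q" by blast
  ultimately obtain g where g: "g \<in> dih p q" "M f = a4 * g * (c * P)"
    using coset_closed[OF nc a4W _ MfI dih_gens(3), of "c * P" "p * q"] by auto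
  \<comment> \<open>The five letters are the factor \<open>p q p\<close> of \<open>M h1\<close>
    followed by the inverse of the factor \<open>p q\<close> in \<open>M f\<close>.\<close>
  define h where "h = alt 5 p q"
  have h: "h = p * (q * (p * (q * p)))" by (simp add: h_def numeral_eq_Suc)
  have gW: "g \<in> W" "h \<in> W" "h \<in> dih p q" using dih_W[OF nc] g by (auto simp: h_def)
  have "adj (a4 * (g * (c * (p * q)) * b)) (a4 * (p * (q * p) * b))"
    using adj_Mf(2) unfolding Mh g(2) by (simp add: PQ mult.assoc)
  then have "adj (g * (c * (p * q))) (p * (q * p))" by simp
  then have "h * c * ginv g \<in> T" unfolding adj_iff h by (simp add: mult.assoc)
  then have "ginv g * (h * c * ginv g) * g \<in> T" using gW by blast
  then have T: "ginv g * h * c \<in> T" by (simp add: mult.assoc)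
  \<comment> \<open>This reflection times \<open>c\<close> is in \<open>dih p q\<close>. Were they
    distinct, \<open>reflections_in_dih\<close> would put \<open>c\<close> there too.\<close>
  have "ginv g * h * c = c"
  proof (rule ccontr)
    assume neq: "ginv g * h * c \<noteq> c"
    have "ginv g * h * c * c = ginv g * h" by (simp add: mult.assoc)
    moreover have "ginv g * h \<in> dih p q" using g gW dih_ginv[OF nc] by blast
    ultimately have "c \<in> dih p q" using reflections_in_dih(2)[OF mem(1,2) T _ neq] by simp
    then show False using not_in_dih[OF nc cS] c_neq[OF rem] by blast
  qed
  then have "ginv g * h * c = 1 * c" by simp
  then have "ginv g * h = 1" by (simp only: grp_cancel_right)
  then have gh: "g = h" by (metis ginv_unique ginv_ginv)
  \<comment> \<open>\<open>coset_arrow\<close> requires a minimal left factor. As \<open>p\<close>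
    is not a right descent of \<open>a4\<close>, a nontrivial \<open>\<gamma>\<close> ends in
    \<open>q\<close>, so \<open>\<gamma> * h\<close> stays alternating and gains five
    letters.\<close>
  obtain a6 \<gamma> where a6: "rmin_coset p q a6" "\<gamma> \<in> dih p q" "a4 = a6 * \<gamma>" using rmin_decomposition[OF a4W nc] .
  have ndp: "\<not> dr p a4" using rm4 by (simp add: rmin_coset_def)
  have \<gamma>: "\<gamma> = ralt (len \<gamma>) q p"
  proof (cases "len \<gamma>")
    case 0
    then show ?thesis using dih_W[OF nc a6(2)] by simp
  next
    case (Suc j)
    then have "\<gamma> \<noteq> ralt (len \<gamma>) p q" using dr_ralt[OF nc a6(1), of j] a6(3) ndp by metis
    then show ?thesis using ralt_cases[OF nc a6(2)] by blast
  qed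
  have "ginv (\<gamma> * h) = alt (len \<gamma> + 5) p q"
  proof -
    have "ginv (\<gamma> * h) = ginv h * alt (len \<gamma>) q p" by (subst \<gamma>) (simp add: ralt_def)
    also have "ginv h = h" by (simp add: h mult.assoc)
    finally show ?thesis by (simp add: h numeral_eq_Suc mult.assoc)
  qed
  then have l\<gamma>: "len (\<gamma> * h) = len \<gamma> + 5"
    using alt_len[OF nc] len_ginv[of "\<gamma> * h"] dih_W[OF nc a6(2)] gW by (metis W_mult)
  have lmc: "lmin_coset p q (c * P)"
  proof -
    have "dl c (c * P)" using not_dl_P R by auto
    then have "\<not> dl p (c * P)" using nc_dl[OF cp] by auto
    moreover have "\<not> dl q (c * P)" using dl_commute[OF mem(2) cS _ V(3), of P] c_neq[OF rem] dl_PQ by auto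
    ultimately show ?thesis by (auto simp: lmin_coset_def)
  qed
  have "arrow (a6 * \<gamma> * (c * P)) (a6 * (\<gamma> * h) * (c * P))"
    using l\<gamma> a6 gW by (intro coset_arrow[OF nc a6(1) lmc]) auto
  then have "arrow f (M f)" using f' g gh a6 by (simp add: mult.assoc)
  then show False using arrow_len[of f "M f"] cov_len[OF Mf] by simp
qed

end

end

context minimal_bad
begin

lemma contradiction: False
proof -
  interpret sw: minimal_bad S m u v M q p n a b "M y" "M x" by (rule swap)
  obtain c w X where rem: "removable c w X" using ex_removable by blast
  have "dr p (a * c) \<or> dr q (a * c)" using not_free[OF rem] ac(1)[OF rem] by (auto simp: rmin_coset_def)
  then show False
  proof
    assume "dr p (a * c)"
    then show False using descent_shape[OF rem] descent_contradiction[OF rem] by blast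
  next
    assume "dr q (a * c)"
    then show False using sw.descent_shape[OF swap_removable[OF rem]] sw.descent_contradiction[OF swap_removable[OF rem]] by blast
  qed
qed

end

context right_angled_coxeter
begin

lemma ginv_alt: "p \<in> S \<Longrightarrow> q \<in> S \<Longrightarrow> ginv (alt n p q) = (if odd n then alt n p q else alt n q p)"
proof (induction n arbitrary: p q)
  case (Suc n)
  have "ginv (alt (Suc n) p q) = ginv (alt n q p) * p" using Suc.prems by simp
  then show ?case using Suc alt_append[of n p q] alt_append[of n q p]
    by (cases "even n") (simp_all del: alt.simps)
qed simp

lemma interval_ginv:
  assumes "u \<in> W" "v \<in> W"
  shows "z \<in> interval (ginv u) (ginv v) \<longleftrightarrow> ginv z \<in> interval u v"
proof (cases "z \<in> W")
  case True
  then have "ble (ginv u) z \<longleftrightarrow> ble u (ginv z)" "ble z (ginv v) \<longleftrightarrow> ble (ginv z) v"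
    using ble_ginv[of u "ginv z"] ble_ginv[of "ginv z" v] assms by simp_all
  then show ?thesis by (simp add: interval_def)
next
  case False
  then have "ginv z \<notin> W" using W_ginv[of "ginv z"] by auto
  then show ?thesis using False interval_W by blast
qed

lemma right_angled_no_bad:
  assumes hm: "hasse_matching (interval u v) M" and ad: "preserves_adj (interval u v) M"
  shows "\<not> bad (interval u v) M x y"
proof
  assume bad0: "bad (interval u v) M x y"
  define Pr where "Pr = (\<lambda>x. \<exists>y. bad (interval u v) M x y)"
  have "Pr x" using bad0 by (auto simp: Pr_def)
  then obtain x where x: "Pr x" "\<And>x'. Pr x' \<Longrightarrow> len x \<le> len x'" using ex_has_least_nat[of Pr x len] by blast
  then obtain y where bad: "bad (interval u v) M x y" by (auto simp: Pr_def)
  have minimal: "len x \<le> len x'" if "bad (interval u v) M x' y'" for x' y' using x that by (auto simp: Pr_def)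
  note Pa = bad_partner[OF hm ad bad]
  have B: "x \<in> interval u v" "y \<in> interval u v" "cov x y" "cov x (M x)" "cov (M y) y"
    using bad by (auto simp: bad_def)
  obtain p q n a b where cb: "coset_butterfly p q n a b x (M y) y (M x)"
    using butterfly_coset[OF B(3,4,5) Pa(1) Pa(6) Pa(7)[symmetric]] by blast
  then have nc: "nc p q" and n: "n > 0" and rm: "rmin_coset p q a" and lm: "lmin_coset p q b"
    and xe: "x = a * alt n p q * b" and Mye: "M y = a * alt n q p * b"
    and ye: "{y, M x} = {a * alt (Suc n) p q * b, a * alt (Suc n) q p * b}"
    and lx: "len x = len a + n + len b"
    unfolding coset_butterfly_def by blast+
  note pq = nc_S[OF nc]
  have abW: "a \<in> W" "b \<in> W" using rm lm by (auto simp: rmin_coset_def lmin_coset_def)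
  have uv: "u \<in> W" "v \<in> W" using B(1) ble_W by (auto simp: interval_def)
  consider "y = a * alt (Suc n) p q * b" "M x = a * alt (Suc n) q p * b"
    | "y = a * alt (Suc n) q p * b" "M x = a * alt (Suc n) p q * b"
    using ye by (metis doubleton_eq_iff)
  then show False
  proof cases
    case 1
    have "minimal_bad S m u v M p q n a b x y"
    proof
      show "M x = a * (q * (alt n p q * b))" "y = a * (p * (alt n q p * b))" using 1 by (simp_all add: mult.assoc)
    qed (use hm ad bad minimal nc n rm lm xe Mye lx in \<open>simp_all add: mult.assoc\<close>)
    then show False by (rule minimal_bad.contradiction)
  next
    case 2
    define M' where "M' = (\<lambda>z. ginv (M (ginv z)))"
    \<comment> \<open>\<open>p'\<close> is the last letter of \<open>alt n p q\<close>, hence the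
      first letter of its inverse.\<close>
    define p' q' where "p' = (if odd n then p else q)" and "q' = (if odd n then q else p)"
    let ?I = "interval u v" and ?J = "interval (ginv u) (ginv v)"
    note IJ = interval_ginv[OF uv]
    have IW: "z \<in> W" if "z \<in> ?I" for z using interval_W[OF that] .
    have MW: "M z \<in> W" if "z \<in> ?I" for z using hasse_matchingD(1)[OF hm that] IW by blast
    have covJ: "cov z z' \<longleftrightarrow> cov (ginv z) (ginv z')" if "ginv z \<in> W" "ginv z' \<in> W" for z z'
      using cov_ginv[OF that] by simp
    have adjJ: "adj z z' \<longleftrightarrow> adj (ginv z) (ginv z')" if "ginv z \<in> W" "ginv z' \<in> W" for z z'
      using adj_ginv[OF that] by simp
    have hm': "hasse_matching ?J M'"
      unfolding hasse_matching_def
    proof (intro ballI)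
      fix z assume "z \<in> ?J"
      then have z: "ginv z \<in> ?I" using IJ by blast
      note D = hasse_matchingD[OF hm z]
      have "cov z (M' z) \<or> cov (M' z) z"
        using D(3) covJ[of z "M' z"] covJ[of "M' z" z] IW[OF z] MW[OF z] by (simp add: M'_def)
      then show "M' z \<in> ?J \<and> M' (M' z) = z \<and> (cov z (M' z) \<or> cov (M' z) z)"
        using D(1,2) IJ[of "M' z"] by (simp add: M'_def)
    qed
    have ad': "preserves_adj ?J M'"
      unfolding preserves_adj_def
    proof (intro ballI impI)
      fix z z' assume z: "z \<in> ?J" "z' \<in> ?J" "adj z z'"
      then have I: "ginv z \<in> ?I" "ginv z' \<in> ?I" using IJ by blast+
      have "adj (ginv z) (ginv z')" using adjJ[of z z'] I IW z(3) by blast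
      then have "adj (M (ginv z)) (M (ginv z'))" using ad I unfolding preserves_adj_def by blast
      then show "adj (M' z) (M' z')" using MW I by (simp add: M'_def)
    qed
    have badJ: "bad ?J M' z z' \<longleftrightarrow> bad ?I M (ginv z) (ginv z')" for z z'
    proof -
      have "M' z \<noteq> z' \<longleftrightarrow> M (ginv z) \<noteq> ginv z'" unfolding M'_def by (metis ginv_ginv)
      then show ?thesis
        unfolding bad_def IJ using covJ[of z z'] covJ[of z "M' z"] covJ[of "M' z'" z'] IW MW by (auto simp: M'_def)
    qed
    have "minimal_bad S m (ginv u) (ginv v) M' p' q' n (ginv b) (ginv a) (ginv x) (ginv y)"
    proof
      show "bad ?J M' (ginv x) (ginv y)" using badJ bad by simp
      show "len (ginv x) \<le> len x'" if "bad ?J M' x' y'" for x' y'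
      proof -
        have b: "bad ?I M (ginv x') (ginv y')" using badJ that by blast
        then have "ginv x' \<in> W" using IW by (simp add: bad_def)
        then have "len (ginv x') = len x'" by (metis ginv_ginv len_ginv)
        then show ?thesis using minimal[OF b] IW[OF B(1)] by simp
      qed
      show "nc p' q'" using nc nc_sym by (simp add: p'_def q'_def)
      show "rmin_coset p' q' (ginv b)" using lm abW pq by (auto simp: p'_def q'_def rmin_coset_def lmin_coset_def)
      show "lmin_coset p' q' (ginv a)" using rm abW pq by (auto simp: p'_def q'_def rmin_coset_def lmin_coset_def)
      show "ginv x = ginv b * (alt n p' q' * ginv a)" using pq by (simp add: xe ginv_alt p'_def q'_def)
      show "M' (ginv y) = ginv b * (alt n q' p' * ginv a)" using pq by (simp add: M'_def Mye ginv_alt p'_def q'_def)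
      have "M' (ginv x) = ginv b * (alt (Suc n) q' p' * ginv a)"
        unfolding M'_def ginv_ginv 2(2) using pq by (simp add: ginv_alt p'_def q'_def del: alt.simps)
      then show "M' (ginv x) = ginv b * (q' * (alt n p' q' * ginv a))" by (simp add: mult.assoc)
      have "ginv y = ginv b * (alt (Suc n) p' q' * ginv a)"
        unfolding 2(1) using pq by (simp add: ginv_alt p'_def q'_def del: alt.simps)
      then show "ginv y = ginv b * (p' * (alt n q' p' * ginv a))" by (simp add: mult.assoc)
      show "len (ginv x) = len (ginv b) + n + len (ginv a)" using lx abW IW[OF B(1)] by simp
    qed (use hm' ad' n in auto)
    then show False by (rule minimal_bad.contradiction)
  qed
qed

end

sublocale right_angled_coxeter \<subseteq> bruhat_axioms
  using right_angled_K33 right_angled_long_arrow right_angled_no_bad by unfold_locales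

section \<open>Transfer to the abstract group\<close>

lemma wprod_Nil [simp]: "wprod G [] = \<one>\<^bsub>G\<^esub>"
  and wprod_Cons [simp]: "wprod G (s # w) = s \<otimes>\<^bsub>G\<^esub> wprod G w"
  by (simp_all add: wprod_def)

lemma wprod_closed: "group G \<Longrightarrow> S \<subseteq> carrier G \<Longrightarrow> w \<in> lists S \<Longrightarrow> wprod G w \<in> carrier G"
proof -
  assume *: "group G" "S \<subseteq> carrier G" "w \<in> lists S"
  interpret group G by (rule *(1))
  show ?thesis using *(3,2) by (induction w) auto
qed

locale coxeter_embedding = coxeter S m for S :: "'g::grp set" and m +
  fixes G :: "('a, 'b) monoid_scheme" and S0 :: "'a set" and E :: "'a \<Rightarrow> 'g"
  assumes group: "group G" and gens: "S0 \<subseteq> carrier G" and generated: "carrier G = wprod G ` lists S0"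
    and E_inj: "inj_on E (carrier G)"
    and E_mult: "\<lbrakk>x \<in> carrier G; y \<in> carrier G\<rbrakk> \<Longrightarrow> E (x \<otimes>\<^bsub>G\<^esub> y) = E x * E y"
    and E_gens: "S = E ` S0"
begin

interpretation G: group G by (rule group)

lemma E_one: "E \<one>\<^bsub>G\<^esub> = 1"
  using E_mult[of "\<one>\<^bsub>G\<^esub>" "\<one>\<^bsub>G\<^esub>"] by (metis G.one_closed G.l_one grp_cancel_left mult_1_right)

lemma E_eq_iff: "x \<in> carrier G \<Longrightarrow> y \<in> carrier G \<Longrightarrow> E x = E y \<longleftrightarrow> x = y"
  using E_inj by (auto simp: inj_on_def)

lemma E_inv: "x \<in> carrier G \<Longrightarrow> E (inv\<^bsub>G\<^esub> x) = ginv (E x)"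
  using E_mult[of x "inv\<^bsub>G\<^esub> x"] E_one by (metis G.inv_closed G.r_inv ginv_unique)

lemma E_wprod: "w \<in> lists S0 \<Longrightarrow> E (wprod G w) = prod_list (map E w)"
proof (induction w)
  case (Cons s w)
  then show ?case using gens wprod_closed[OF group gens, of w] by (auto simp: E_mult subset_iff)
qed (simp add: E_one)

lemma lists_S: "lists S = map E ` lists S0"
  by (simp add: E_gens lists_image)

lemma W_eq: "W = E ` carrier G"
  unfolding W_def lists_S generated image_image by (rule image_cong) (simp_all add: E_wprod)

lemma E_W [simp]: "x \<in> carrier G \<Longrightarrow> E x \<in> W"
  by (simp add: W_eq)

lemma E_len: assumes "x \<in> carrier G" shows "len (E x) = coxeter_length G S0 x"
proof -
  have "(\<exists>w\<in>lists S. length w = n \<and> prod_list w = E x) \<longleftrightarrow> (\<exists>w\<in>lists S0. length w = n \<and> wprod G w = x)" for n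
    unfolding lists_S using E_wprod E_eq_iff[OF wprod_closed[OF group gens] assms] by auto
  then show ?thesis unfolding len_def coxeter_length_def by simp
qed

lemma reflections_carrier: "reflections G S0 \<subseteq> carrier G"
  using gens by (auto simp: reflections_def)

lemma T_eq: "T = E ` reflections G S0"
proof -
  have conj: "E (g \<otimes>\<^bsub>G\<^esub> s \<otimes>\<^bsub>G\<^esub> inv\<^bsub>G\<^esub> g) = E g * E s * ginv (E g)" if "g \<in> carrier G" "s \<in> S0" for g s
    using that gens by (simp add: E_mult E_inv subset_iff)
  show ?thesis
  proof (intro equalityI subsetI)
    fix t assume "t \<in> T"
    then obtain x r where x: "x \<in> W" "r \<in> S" "t = x * r * ginv x" by (rule T_cases)
    then obtain g where "g \<in> carrier G" "x = E g" using W_eq by blast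
    moreover obtain s where "s \<in> S0" "r = E s" using x(2) E_gens by blast
    ultimately have "g \<in> carrier G" "s \<in> S0" "t = E g * E s * ginv (E g)" using x(3) by simp_all
    then show "t \<in> E ` reflections G S0" using conj[of g s] unfolding reflections_def by force
  next
    fix t assume "t \<in> E ` reflections G S0"
    then obtain g s where "g \<in> carrier G" "s \<in> S0" "t = E (g \<otimes>\<^bsub>G\<^esub> s \<otimes>\<^bsub>G\<^esub> inv\<^bsub>G\<^esub> g)"
      unfolding reflections_def by blast
    moreover from this have "E s \<in> S" using E_gens by blast
    ultimately show "t \<in> T" using conj by simp
  qed
qed

lemma E_adj:
  assumes x: "x \<in> carrier G" and y: "y \<in> carrier G"
  shows "adj (E x) (E y) \<longleftrightarrow> (\<exists>t\<in>reflections G S0. y = x \<otimes>\<^bsub>G\<^esub> t)"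
proof
  assume "adj (E x) (E y)"
  \<comment> \<open>Conjugation by \<open>E x\<close> moves the reflection from the left to the
    right.\<close>
  then have "ginv (E x) * (E y * ginv (E x)) * E x \<in> T" unfolding adj_iff using x by (intro T_conj') auto
  then have "ginv (E x) * E y \<in> T" by (simp add: mult.assoc)
  then obtain t where t: "t \<in> reflections G S0" "ginv (E x) * E y = E t" unfolding T_eq by auto
  then have tc: "t \<in> carrier G" using reflections_carrier by auto
  have "E x * (ginv (E x) * E y) = E x * E t" using t by simp
  then have "E y = E (x \<otimes>\<^bsub>G\<^esub> t)" using x tc by (simp add: E_mult)
  then show "\<exists>t\<in>reflections G S0. y = x \<otimes>\<^bsub>G\<^esub> t" using x y t tc by (auto simp: E_eq_iff)
next
  assume "\<exists>t\<in>reflections G S0. y = x \<otimes>\<^bsub>G\<^esub> t"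
  then obtain t where t: "t \<in> reflections G S0" "y = x \<otimes>\<^bsub>G\<^esub> t" by blast
  then have "t \<in> carrier G" "E t \<in> T" using reflections_carrier T_eq by auto
  then show "adj (E x) (E y)" unfolding adj_iff t using x by (simp add: E_mult)
qed

lemma bruhat_step_iff: "bruhat_step G S0 x y \<longleftrightarrow> x \<in> carrier G \<and> y \<in> carrier G \<and> arrow (E x) (E y)"
proof -
  have "y \<in> carrier G" if "x \<in> carrier G" "t \<in> reflections G S0" "y = x \<otimes>\<^bsub>G\<^esub> t" for t
    using that reflections_carrier by auto
  then show ?thesis unfolding bruhat_step_def arrow_def using E_adj[of x y] E_len by auto
qed

lemma bruhat_le_iff: "bruhat_le G S0 x y \<longleftrightarrow> x \<in> carrier G \<and> y \<in> carrier G \<and> ble (E x) (E y)"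
proof -
  have 1: "(bruhat_step G S0)\<^sup>*\<^sup>* x y \<Longrightarrow> arrow\<^sup>*\<^sup>* (E x) (E y)" for x y
    by (induction rule: rtranclp_induct) (auto simp: bruhat_step_iff intro: rtranclp.rtrancl_into_rtrancl)
  have "arrow\<^sup>*\<^sup>* X Y \<Longrightarrow> X = E x \<Longrightarrow> x \<in> carrier G \<Longrightarrow> \<exists>y\<in>carrier G. Y = E y \<and> (bruhat_step G S0)\<^sup>*\<^sup>* x y" for X Y
  proof (induction rule: rtranclp_induct)
    case (step Y Z)
    then obtain y where y: "y \<in> carrier G" "Y = E y" "(bruhat_step G S0)\<^sup>*\<^sup>* x y" by blast
    obtain z where "z \<in> carrier G" "Z = E z" using arrow_W[OF step.hyps(2)] by (auto simp: W_eq)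
    then show ?case using y step.hyps(2) bruhat_step_iff[of y z] by (metis rtranclp.rtrancl_into_rtrancl)
  qed auto
  then have 2: "(bruhat_step G S0)\<^sup>*\<^sup>* x y" if "arrow\<^sup>*\<^sup>* (E x) (E y)" "x \<in> carrier G" "y \<in> carrier G"
    using that E_eq_iff by metis
  show ?thesis unfolding bruhat_le_def ble_def using 1 2 by auto
qed

lemma bruhat_interval_iff:
  assumes "u \<in> carrier G" "v \<in> carrier G"
  shows "x \<in> bruhat_interval G S0 u v \<longleftrightarrow> x \<in> carrier G \<and> E x \<in> interval (E u) (E v)"
  using assms by (auto simp: bruhat_interval_def interval_def bruhat_le_iff)

lemma interval_eq:
  assumes "u \<in> carrier G" "v \<in> carrier G"
  shows "interval (E u) (E v) = E ` bruhat_interval G S0 u v"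
proof (intro equalityI subsetI)
  fix z assume z: "z \<in> interval (E u) (E v)"
  then obtain x where "x \<in> carrier G" "z = E x" using interval_W[OF z] unfolding W_eq by auto
  then show "z \<in> E ` bruhat_interval G S0 u v" using z bruhat_interval_iff[OF assms] by auto
next
  fix z assume "z \<in> E ` bruhat_interval G S0 u v"
  then show "z \<in> interval (E u) (E v)" using bruhat_interval_iff[OF assms] by auto
qed

lemma gamma_edge_iff: "x \<in> carrier G \<Longrightarrow> y \<in> carrier G \<Longrightarrow> gamma_edge G S0 x y \<longleftrightarrow> adj (E x) (E y)"
  unfolding gamma_edge_def using E_adj[of x y] by auto

lemma special_matching_iff_graph_automorphism:
  assumes bruhat: "bruhat_axioms S m" and le: "bruhat_le G S0 u v"
    and hm: "hasse_perfect_matching G S0 (bruhat_interval G S0 u v) M"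
  shows "special_matching G S0 (bruhat_interval G S0 u v) M \<longleftrightarrow>
    graph_automorphism (bruhat_interval G S0 u v) (gamma_edge G S0) M"
proof -
  interpret bruhat_axioms S m by (rule bruhat)
  let ?P = "bruhat_interval G S0 u v" and ?I = "interval (E u) (E v)"
  have uv: "u \<in> carrier G" "v \<in> carrier G" using le by (auto simp: bruhat_le_iff)
  note I = interval_eq[OF uv]
  have PG: "x \<in> carrier G" if "x \<in> ?P" for x using that bruhat_interval_iff[OF uv] by blast
  have EI: "E x \<in> ?I" if "x \<in> ?P" for x using that I by blast
  have less: "bruhat_less G S0 x y \<longleftrightarrow> ble (E x) (E y) \<and> E x \<noteq> E y" if "x \<in> ?P" "y \<in> ?P" for x y
    using PG[OF that(1)] PG[OF that(2)] by (simp add: bruhat_less_def bruhat_le_iff E_eq_iff)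
  have cover: "bruhat_cover_in G S0 ?P x y \<longleftrightarrow> cov (E x) (E y)" if "x \<in> ?P" "y \<in> ?P" for x y
    unfolding bruhat_cover_in_def cov_iff_cover[OF EI[OF that(1)] EI[OF that(2)]] I using that less by auto
  have edge: "gamma_edge G S0 x y \<longleftrightarrow> adj (E x) (E y)" if "x \<in> ?P" "y \<in> ?P" for x y
    using gamma_edge_iff PG that by blast
  have M: "M x \<in> ?P" "M (M x) = x" "cov (E x) (E (M x)) \<or> cov (E (M x)) (E x)" if "x \<in> ?P" for x
    using hm cover that unfolding hasse_perfect_matching_def by blast+
  define N where "N = (\<lambda>z. E (M (inv_into (carrier G) E z)))"
  have N: "N (E x) = E (M x)" if "x \<in> ?P" for x
    using inv_into_f_f[OF E_inj PG[OF that]] by (simp add: N_def)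
  have "hasse_matching ?I N"
    unfolding hasse_matching_def I using M N by auto
  then have "special ?I N \<longleftrightarrow> preserves_adj ?I N" by (rule special_iff_preserves_adj)
  moreover have "special_matching G S0 ?P M \<longleftrightarrow> special ?I N"
  proof -
    have "M x = y \<longleftrightarrow> N (E x) = E y" if "x \<in> ?P" "y \<in> ?P" for x y
      using N that E_eq_iff PG M(1) by simp
    then show ?thesis unfolding special_matching_def special_def I using hm cover less M(1) N by auto
  qed
  moreover have "graph_automorphism ?P (gamma_edge G S0) M \<longleftrightarrow> preserves_adj ?I N"
  proof
    assume "graph_automorphism ?P (gamma_edge G S0) M"
    then show "preserves_adj ?I N" unfolding graph_automorphism_def preserves_adj_def I using edge M(1) N by auto
  next
    assume p: "preserves_adj ?I N"
    have adjM: "gamma_edge G S0 (M x) (M y)" if "x \<in> ?P" "y \<in> ?P" "gamma_edge G S0 x y" for x y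
      using p that edge[OF that(1,2)] edge[OF M(1)[OF that(1)] M(1)[OF that(2)]] N EI unfolding preserves_adj_def by metis
    have "bij_betw M ?P ?P" by (rule bij_betw_byWitness[where f' = M]) (use M in auto)
    moreover have "gamma_edge G S0 x y \<longleftrightarrow> gamma_edge G S0 (M x) (M y)" if "x \<in> ?P" "y \<in> ?P" for x y
      using adjM[OF that] adjM[OF M(1)[OF that(1)] M(1)[OF that(2)]] M(2) that by auto
    ultimately show "graph_automorphism ?P (gamma_edge G S0) M" by (simp add: graph_automorphism_def)
  qed
  ultimately show ?thesis by blast
qed

end

section \<open>The left regular representation\<close>

typedef 'a bijection = "{f :: 'a \<Rightarrow> 'a. bij f}" morphisms apply_bij Bijection
  by (rule exI[of _ id]) simp

instantiation bijection :: (type) grp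
begin

definition "f * g = Bijection (apply_bij f \<circ> apply_bij g)"
definition "1 = Bijection id"
definition "ginv f = Bijection (inv_into UNIV (apply_bij f))"

instance
proof
  fix f g h :: "'a bijection"
  have bij: "bij (apply_bij f)" for f :: "'a bijection" using apply_bij by simp
  have comp: "apply_bij (f * g) = apply_bij f \<circ> apply_bij g" for f g :: "'a bijection"
    unfolding times_bijection_def using bij bij_comp by (intro Bijection_inverse) auto
  have one: "apply_bij (1 :: 'a bijection) = id"
    unfolding one_bijection_def by (intro Bijection_inverse) simp
  have inv: "apply_bij (ginv f) = inv_into UNIV (apply_bij f)" for f :: "'a bijection"
    unfolding ginv_bijection_def using bij bij_imp_bij_inv by (intro Bijection_inverse) auto
  show "f * g * h = f * (g * h)" by (simp add: apply_bij_inject[symmetric] comp comp_assoc)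
  show "1 * f = f" "f * 1 = f" by (simp_all add: apply_bij_inject[symmetric] comp one)
  show "ginv f * f = 1" using bij[of f] by (simp add: apply_bij_inject[symmetric] comp one inv bij_is_inj)
qed

end

lemma apply_bij_mult [simp]: "apply_bij (f * g) = apply_bij f \<circ> apply_bij g"
  unfolding times_bijection_def using apply_bij[of f] apply_bij[of g] bij_comp by (intro Bijection_inverse) auto

text \<open>The identity outside the carrier, so that it is a bijection of the whole type.\<close>

definition left_mult :: "('a, 'b) monoid_scheme \<Rightarrow> 'a \<Rightarrow> 'a bijection" where
  "left_mult G g = Bijection (\<lambda>x. if x \<in> carrier G then g \<otimes>\<^bsub>G\<^esub> x else x)"

context group
begin

lemma apply_left_mult:
  assumes g: "g \<in> carrier G"
  shows "apply_bij (left_mult G g) = (\<lambda>x. if x \<in> carrier G then g \<otimes> x else x)"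
  unfolding left_mult_def
proof (rule Bijection_inverse)
  have "bij (\<lambda>x. if x \<in> carrier G then g \<otimes> x else x)"
    by (rule o_bij[where g = "\<lambda>x. if x \<in> carrier G then inv g \<otimes> x else x"])
      (use g in \<open>auto simp: fun_eq_iff m_assoc[symmetric]\<close>)
  then show "(\<lambda>x. if x \<in> carrier G then g \<otimes> x else x) \<in> {f. bij f}" by simp
qed

lemma left_mult_mult:
  "g \<in> carrier G \<Longrightarrow> h \<in> carrier G \<Longrightarrow> left_mult G (g \<otimes> h) = left_mult G g * left_mult G h"
  by (simp add: apply_bij_inject[symmetric] apply_left_mult fun_eq_iff m_assoc)

lemma inj_left_mult: "inj_on (left_mult G) (carrier G)"
proof (rule inj_onI)
  fix g h assume *: "g \<in> carrier G" "h \<in> carrier G" "left_mult G g = left_mult G h"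
  have "apply_bij (left_mult G x) \<one> = x" if "x \<in> carrier G" for x using that by (simp add: apply_left_mult)
  then show "g = h" using * by metis
qed

end

lemma equivclp_map:
  assumes "equivclp r a b" "\<And>a b. r a b \<Longrightarrow> r' (f a) (f b)"
  shows "equivclp r' (f a) (f b)"
  using assms(1)
proof (induction rule: equivclp_induct)
  case (step y z)
  then show ?case using assms(2) by (meson equivclp_into_equivclp)
qed simp

lemma coxeter_system_embedding:
  assumes "coxeter_system G S"
  shows "\<exists>m. coxeter_embedding (left_mult G ` S) m G S (left_mult G)"
proof -
  have "group G" using assms by (simp add: coxeter_system_def)
  then interpret group G .
  let ?E = "left_mult G"
  have S: "S \<subseteq> carrier G" and gen: "carrier G = wprod G ` lists S" using assms by (auto simp: coxeter_system_def)
  obtain m where m: "coxeter_matrix S m"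
    and pres: "\<And>a b. a \<in> lists S \<Longrightarrow> b \<in> lists S \<Longrightarrow>
      wprod G a = wprod G b \<longleftrightarrow> equivclp (relator_step (coxeter_relators S m)) a b"
    using assms unfolding coxeter_system_def by blast
  define m' where "m' = (\<lambda>s t. m (inv_into (carrier G) ?E s) (inv_into (carrier G) ?E t))"
  have inv: "inv_into (carrier G) ?E (?E s) = s" if "s \<in> S" for s using inv_into_f_f[OF inj_left_mult] that S by blast
  have m': "m' (?E s) (?E t) = m s t" if "s \<in> S" "t \<in> S" for s t using inv that by (simp add: m'_def)
  have inj: "?E s = ?E t \<longleftrightarrow> s = t" if "s \<in> S" "t \<in> S" for s t using inv that by metis
  have E1: "?E \<one>\<^bsub>G\<^esub> = 1"
    using left_mult_mult[of "\<one>\<^bsub>G\<^esub>" "\<one>\<^bsub>G\<^esub>"] by (metis grp_cancel_left l_one mult_1_right one_closed)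
  have prod: "?E (wprod G w) = prod_list (map ?E w)" if "w \<in> lists S" for w
    using that
  proof (induction w)
    case (Cons s w)
    then show ?case using S wprod_closed[OF group_axioms S, of w] by (auto simp: left_mult_mult subset_iff)
  qed (simp add: E1)
  have relS: "r \<in> lists S" if "r \<in> coxeter_relators S m" for r
    using that by (auto simp: coxeter_relators_def)
  have rel: "coxeter_relators (?E ` S) m' = map ?E ` coxeter_relators S m"
  proof -
    have e: "concat (replicate (m' (?E s) (?E t)) [?E s, ?E t]) = map ?E (concat (replicate (m s t) [s, t]))"
      if "s \<in> S" "t \<in> S" for s t using m'[OF that] by (simp add: map_concat)
    show ?thesis
    proof (intro equalityI subsetI)
      fix r assume "r \<in> coxeter_relators (?E ` S) m'"
      then obtain s t where "s \<in> S" "t \<in> S" "m s t > 0" "r = map ?E (concat (replicate (m s t) [s, t]))"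
        unfolding coxeter_relators_def using e m' by auto
      then show "r \<in> map ?E ` coxeter_relators S m" unfolding coxeter_relators_def by blast
    next
      fix r assume "r \<in> map ?E ` coxeter_relators S m"
      then obtain s t where st: "s \<in> S" "t \<in> S" "m s t > 0" "r = map ?E (concat (replicate (m s t) [s, t]))"
        unfolding coxeter_relators_def by blast
      then have "r = concat (replicate (m' (?E s) (?E t)) [?E s, ?E t])" "m' (?E s) (?E t) > 0" using e m' by auto
      then show "r \<in> coxeter_relators (?E ` S) m'" unfolding coxeter_relators_def using st by blast
    qed
  qed
  have step: "relator_step (coxeter_relators (?E ` S) m') (map ?E a) (map ?E b)"
    if ab: "relator_step (coxeter_relators S m) a b" for a b
  proof -
    obtain x y r where "r \<in> coxeter_relators S m" "a = x @ r @ y" "b = x @ y"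
      using ab unfolding relator_step_def by blast
    then show ?thesis unfolding relator_step_def rel
      by (intro exI[of _ "map ?E x"] exI[of _ "map ?E y"] exI[of _ "map ?E r"]) auto
  qed
  have "coxeter_embedding (?E ` S) m' G S ?E"
  proof
    have "m s s = 1" if "s \<in> S" for s using m that unfolding coxeter_matrix_def by blast
    moreover have "m s t = m t s" "s \<noteq> t \<Longrightarrow> m s t = 0 \<or> m s t \<ge> 2" if "s \<in> S" "t \<in> S" for s t
      using m that unfolding coxeter_matrix_def by blast+
    ultimately show "coxeter_matrix (?E ` S) m'" unfolding coxeter_matrix_def using m' inj by simp
    show "prod_list r = 1" if r: "r \<in> coxeter_relators (?E ` S) m'" for r
    proof -
      obtain r0 where r0: "r0 \<in> coxeter_relators S m" "r = map ?E r0" using r rel by blast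
      then have "relator_step (coxeter_relators S m) r0 []"
        unfolding relator_step_def by (intro exI[of _ "[]"] exI[of _ r0]) simp
      then have "wprod G r0 = wprod G []" using pres[OF relS[OF r0(1)], of "[]"] by auto
      then show ?thesis using prod[OF relS[OF r0(1)]] r0 E1 by simp
    qed
    show "equivclp (relator_step (coxeter_relators (?E ` S) m')) a b"
      if ab: "a \<in> lists (?E ` S)" "b \<in> lists (?E ` S)" "prod_list a = prod_list b" for a b
    proof -
      obtain a0 b0 where a0: "a0 \<in> lists S" "a = map ?E a0" and b0: "b0 \<in> lists S" "b = map ?E b0"
        using ab unfolding lists_image by blast
      then have "wprod G a0 = wprod G b0"
        using ab(3) prod inj_onD[OF inj_left_mult] wprod_closed[OF group_axioms S] by metis
      then have "equivclp (relator_step (coxeter_relators S m)) a0 b0" using pres a0 b0 by blast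
      then show ?thesis unfolding a0 b0 using step by (rule equivclp_map)
    qed
  qed (use S gen inj_left_mult left_mult_mult group_axioms in auto)
  then show ?thesis by blast
qed

context coxeter_embedding
begin

interpretation G: group G by (rule group)

lemma symmetric_coxeter:
  assumes "symmetric_type G S0"
  shows "\<exists>n \<sigma>. symmetric_coxeter S m n \<sigma>"
proof -
  obtain n \<phi> where iso: "\<phi> \<in> iso G (sym_group n)" and gen: "\<phi> ` S0 = {transpose i (Suc i) | i. 1 \<le> i \<and> i < n}"
    using assms by (auto simp: symmetric_type_def)
  define \<sigma> where "\<sigma> = (\<lambda>z. \<phi> (inv_into (carrier G) E z))"
  have \<sigma>: "\<sigma> (E x) = \<phi> x" if "x \<in> carrier G" for x using inv_into_f_f[OF E_inj that] by (simp add: \<sigma>_def)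
  have bij: "bij_betw \<phi> (carrier G) (carrier (sym_group n))" and hom: "\<phi> \<in> hom G (sym_group n)"
    using iso by (auto simp: iso_def)
  have "symmetric_coxeter S m n \<sigma>"
  proof
    show "\<sigma> (x * y) = \<sigma> x \<circ> \<sigma> y" if xy: "x \<in> W" "y \<in> W" for x y
    proof -
      obtain a b where "a \<in> carrier G" "x = E a" "b \<in> carrier G" "y = E b" using xy W_eq by blast
      then show ?thesis using hom_mult[OF hom, of a b] by (simp add: E_mult[symmetric] \<sigma> sym_group_mult)
    qed
    show "\<sigma> x permutes {1..n}" if x: "x \<in> W" for x
    proof -
      obtain a where "a \<in> carrier G" "x = E a" using x W_eq by blast
      then show ?thesis using bij_betwE[OF bij] by (simp add: \<sigma> sym_group_carrier)
    qed
    show "inj_on \<sigma> W"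
    proof (rule inj_onI)
      fix x y assume "x \<in> W" "y \<in> W" "\<sigma> x = \<sigma> y"
      moreover from this obtain a b where "a \<in> carrier G" "x = E a" "b \<in> carrier G" "y = E b" using W_eq by blast
      ultimately show "x = y" using bij_betw_imp_inj_on[OF bij] by (simp add: \<sigma> inj_on_eq_iff)
    qed
    show "\<exists>x\<in>W. \<sigma> x = p" if p: "p permutes {1..n}" for p
    proof -
      have "p \<in> carrier (sym_group n)" using p by (simp add: sym_group_carrier)
      then obtain a where "a \<in> carrier G" "\<phi> a = p"
        unfolding bij_betw_imp_surj_on[OF bij, symmetric] by (elim imageE) simp
      then show ?thesis using \<sigma>[of a] E_W[of a] by blast
    qed
    have "\<sigma> ` S = \<phi> ` S0" unfolding E_gens image_image by (rule image_cong) (use gens \<sigma> in blast)+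
    then show "\<sigma> ` S = {transpose i (Suc i) | i. 1 \<le> i \<and> i < n}" using gen by simp
  qed
  then show ?thesis by blast
qed

text \<open>\<open>right_angled\<close> speaks of the generated subgroup, the locale of the matrix
  entry. A positive entry bounds the order of \<open>r = s * t\<close>, and every element generated
  is a power of \<open>r\<close>, possibly times \<open>s\<close>.\<close>

lemma finite_generate:
  assumes st: "s0 \<in> S0" "t0 \<in> S0" and pos: "m (E s0) (E t0) > 0"
  shows "finite (generate G {s0, t0})"
proof -
  define s t k where "s = E s0" and "t = E t0" and "k = m s t"
  define r where "r = s * t"
  have S: "s \<in> S" "t \<in> S" using st E_gens by (auto simp: s_def t_def)
  have k: "k > 0" using pos by (simp add: k_def s_def t_def)
  have "prod_list (concat (replicate j [s, t])) = r ^ j" for j by (induction j) (simp_all add: r_def mult.assoc)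
  moreover have "concat (replicate k [s, t]) \<in> coxeter_relators S m"
    unfolding coxeter_relators_def using S k by (auto simp: k_def)
  ultimately have rk: "r ^ k = 1" using relator_one by metis
  \<comment> \<open>Only natural powers occur in \<open>D\<close>, so \<open>r ^ (k - 1)\<close>
    stands in for the inverse of \<open>r\<close>.\<close>
  have ginvr: "t * s = r ^ (k - 1)"
  proof -
    have "r * (t * s) = 1" using S by (simp add: r_def mult.assoc)
    moreover have "r * r ^ (k - 1) = 1" using k rk by (simp flip: power_Suc)
    ultimately show ?thesis by (metis grp_cancel_left)
  qed
  have sr: "s * r ^ j = (r ^ (k - 1)) ^ j * s" for j
  proof (induction j)
    case (Suc j)
    have "s * r ^ Suc j = (s * r) * r ^ j" by (simp add: mult.assoc)
    also have "s * r = r ^ (k - 1) * s" unfolding ginvr[symmetric] using S by (simp add: r_def mult.assoc)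
    finally show ?case using Suc by (simp add: mult.assoc)
  qed simp
  define D where "D = {r ^ j * x | j x. x \<in> {1, s}}"
  have "r ^ j = r ^ (j mod k)" for j
    using rk by (metis mod_mult_div_eq mult.commute mult_1_right power_add power_mult power_one)
  then have "D \<subseteq> (\<lambda>(j, x). r ^ j * x) ` ({..<k} \<times> {1, s})"
    unfolding D_def using k by (force intro!: image_eqI[of _ _ "(_ mod k, _)"])
  then have finD: "finite D" by (rule finite_subset) simp
  have Dmult: "x * y \<in> D" if xy: "x \<in> D" "y \<in> D" for x y
  proof -
    obtain i a where x: "x = r ^ i * a" "a \<in> {1, s}" using xy(1) unfolding D_def by blast
    obtain j b where y: "y = r ^ j * b" "b \<in> {1, s}" using xy(2) unfolding D_def by blast
    show ?thesis
    proof (cases "a = 1")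
      case True
      then have "x * y = r ^ (i + j) * b" using x y by (simp add: power_add mult.assoc)
      then show ?thesis using y unfolding D_def by blast
    next
      case False
      then have "x * y = r ^ i * (s * r ^ j) * b" using x y by (simp add: mult.assoc)
      also have "\<dots> = r ^ (i + (k - 1) * j) * (s * b)" unfolding sr by (simp add: power_add power_mult mult.assoc)
      finally have "x * y = r ^ (i + (k - 1) * j) * (s * b)" .
      moreover have "s * b \<in> {1, s}" using y S by auto
      ultimately show ?thesis unfolding D_def by blast
    qed
  qed
  have sD: "s \<in> D" unfolding D_def by (intro CollectI exI[of _ 0] exI[of _ s]) simp
  have oneD: "1 \<in> D" unfolding D_def by (intro CollectI exI[of _ 0] exI[of _ 1]) simp
  have "t = r ^ (k - 1) * s" unfolding ginvr[symmetric] using S by (simp add: mult.assoc)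
  then have tD: "t \<in> D" unfolding D_def by blast
  have st_c: "s0 \<in> carrier G" "t0 \<in> carrier G" using st gens by auto
  have gen_in: "h \<in> carrier G \<and> E h \<in> D" if "h \<in> generate G {s0, t0}" for h
    using that
  proof (induction rule: generate.induct)
    case one then show ?case using oneD E_one by simp
  next
    case (incl h) then show ?case using sD tD st_c by (auto simp: s_def t_def)
  next
    case (inv h) then show ?case using sD tD st_c S by (auto simp: E_inv s_def[symmetric] t_def[symmetric])
  next
    case (eng h1 h2) then show ?case using Dmult by (simp add: E_mult)
  qed
  have "E ` generate G {s0, t0} \<subseteq> D" using gen_in by blast
  then have "finite (E ` generate G {s0, t0})" using finD finite_subset by blast
  moreover have "inj_on E (generate G {s0, t0})" using E_inj gen_in by (meson inj_on_subset subsetI)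
  ultimately show ?thesis using finite_imageD by blast
qed

lemma right_angled_coxeter:
  assumes "right_angled G S0"
  shows "right_angled_coxeter S m"
proof
  fix s t assume st: "s \<in> S" "t \<in> S" "s \<noteq> t" "s * t \<noteq> t * s"
  then obtain s0 t0 where o: "s0 \<in> S0" "t0 \<in> S0" "s = E s0" "t = E t0" using E_gens by blast
  then have "s0 \<in> carrier G" "t0 \<in> carrier G" using gens by auto
  then have nc: "s0 \<otimes>\<^bsub>G\<^esub> t0 \<noteq> t0 \<otimes>\<^bsub>G\<^esub> s0" using st o E_mult by metis
  then have "s0 \<noteq> t0" by blast
  then have "infinite (generate G {s0, t0})" using assms[unfolded right_angled_def, rule_format, OF o(1,2)] nc by blast
  then show "m s t = 0" using finite_generate[OF o(1,2)] unfolding o(3,4) by blast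
qed

end

theorem theorem1p5:
  fixes W :: "('a, 'b) monoid_scheme" and S :: "'a set" and u v :: 'a and M :: "'a \<Rightarrow> 'a"
  assumes "coxeter_system W S"
    and "right_angled W S \<or> symmetric_type W S"
    and "bruhat_le W S u v"
    and "hasse_perfect_matching W S (bruhat_interval W S u v) M"
  shows "special_matching W S (bruhat_interval W S u v) M \<longleftrightarrow>
         graph_automorphism (bruhat_interval W S u v) (gamma_edge W S) M"
proof -
  obtain m where "coxeter_embedding (left_mult W ` S) m W S (left_mult W)"
    using coxeter_system_embedding[OF assms(1)] by blast
  then interpret coxeter_embedding "left_mult W ` S" m W S "left_mult W" .
  have "bruhat_axioms (left_mult W ` S) m"
    using assms(2)
  proof
    assume "right_angled W S"
    then interpret R: right_angled_coxeter "left_mult W ` S" m by (rule right_angled_coxeter)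
    show ?thesis ..
  next
    assume "symmetric_type W S"
    then obtain n \<sigma> where "symmetric_coxeter (left_mult W ` S) m n \<sigma>" using symmetric_coxeter by blast
    then interpret Y: symmetric_coxeter "left_mult W ` S" m n \<sigma> .
    show ?thesis ..
  qed
  then show ?thesis using assms(3,4) by (rule special_matching_iff_graph_automorphism)
qed

end
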